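(* Fix positive reals $\alpha,\beta,M$. Then every $\mu\in\mathrm{AC}(\Gamma_M;\Lambda_{\alpha,\beta})$ is uniquely determined (among the elements of $\mathrm{AC}(\Gamma_M;\Lambda_{\alpha,\beta})$) by its restriction to the hyperbola branch $\Gamma_M^-$ if and only if $\alpha\beta M^2<16\pi^2$. The same holds with $\Gamma_M^-$ replaced by $\Gamma_M^+$.
   Context: For a finite complex-valued Borel measure $\mu$ on $\mathbb{R}^2$, its Fourier transform is $\hat\mu(\xi)=\int_{\mathbb{R}^2}\mathrm{e}^{\mathrm{i}\pi\langle x,\xi\rangle}\,\mathrm{d}\mu(x)$, where $\langle x,\xi\rangle=x_1\xi_1+x_2\xi_2$. For a finite disjoint union $\Gamma\subset\mathbb{R}^2$ of smooth curves, $\mathrm{AC}(\Gamma)$ is the space of finite complex-valued Borel measures on $\mathbb{R}^2$ supported on $\Gamma$ that are absolutely continuous with respect to arc length measure on $\Gamma$. For $\Lambda\subset\mathbb{R}^2$, $\mathrm{AC}(\Gamma;\Lambda)$ is the subspace of those $\mu\in\mathrm{AC}(\Gamma)$ with $\hat\mu=0$ on $\Lambda$. $\Gamma_M=\{x\in\mathbb{R}^2:\ x_1x_2=M^2/(4\pi^2)\}$, $\Gamma_M^+=\{x\in\Gamma_M:\ x_1>0\}$, $\Gamma_M^-=\Gamma_M\setminus\Gamma_M^+$, and $\Lambda_{\alpha,\beta}=(\alpha\mathbb{Z}\times\{0\})\cup(\{0\}\times\beta\mathbb{Z})$. *)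

theory Defs
  imports "HOL-Analysis.Analysis"
begin

section \<open>Complex Borel measures\<close>

text \<open>
  A complex measure is a countably additive complex-valued set function on the Borel sets
  (the empty set gets value 0 because the constant series must converge; finiteness of the
  total variation is automatic, since all values are complex numbers). Values off the Borel
  sets are normalised to 0, so that equality of measures is equality of set functions.
\<close>

definition complex_borel_measure :: "('a::topological_space set \<Rightarrow> complex) \<Rightarrow> bool" where
  "complex_borel_measure \<mu> \<longleftrightarrow>
     (\<forall>A. A \<notin> sets borel \<longrightarrow> \<mu> A = 0) \<and>
     (\<forall>A::nat \<Rightarrow> 'a set. range A \<subseteq> sets borel \<longrightarrow> disjoint_family A \<longrightarrow>
        (\<lambda>n. \<mu> (A n)) sums \<mu> (\<Union>n. A n))"

definition restrict_cmeasure ::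
    "('a::topological_space set \<Rightarrow> complex) \<Rightarrow> 'a set \<Rightarrow> ('a set \<Rightarrow> complex)" where
  "restrict_cmeasure \<mu> S = (\<lambda>A. if A \<in> sets borel then \<mu> (A \<inter> S) else 0)"

text \<open>
  Positive part in the Jordan decomposition of a real signed measure,
  \<open>A \<mapsto> sup {\<nu> B | B \<subseteq> A Borel}\<close>; the negative part is the positive part of \<open>-\<nu>\<close>. Taking the
  supremum in \<^typ>\<open>ennreal\<close> is harmless: \<^const>\<open>ennreal\<close> sends negative reals to 0, and
  \<open>B = {}\<close> already contributes 0.
\<close>

definition jordan_pos :: "('a::topological_space set \<Rightarrow> real) \<Rightarrow> 'a measure" where
  "jordan_pos \<nu> =
     measure_of UNIV (sets borel) (\<lambda>A. SUP B\<in>{B \<in> sets borel. B \<subseteq> A}. ennreal (\<nu> B))"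

definition cmeasure_integral ::
    "('a::topological_space set \<Rightarrow> complex) \<Rightarrow> ('a \<Rightarrow> complex) \<Rightarrow> complex" where
  "cmeasure_integral \<mu> f =
     (LINT x|jordan_pos (\<lambda>A. Re (\<mu> A)). f x) - (LINT x|jordan_pos (\<lambda>A. - Re (\<mu> A)). f x)
     + \<i> * ((LINT x|jordan_pos (\<lambda>A. Im (\<mu> A)). f x) - (LINT x|jordan_pos (\<lambda>A. - Im (\<mu> A)). f x))"

definition fourier :: "((real \<times> real) set \<Rightarrow> complex) \<Rightarrow> real \<times> real \<Rightarrow> complex" where
  "fourier \<mu> \<xi> = cmeasure_integral \<mu> (\<lambda>x. exp (\<i> * of_real (pi * (x \<bullet> \<xi>))))"


section \<open>Arc length and absolutely continuous measures\<close>

text \<open>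
  Arc length measure of the curve, or finite disjoint union of curves, parametrised
  injectively by \<open>\<gamma>\<close> on the open set \<open>I\<close>: the image of \<open>|\<gamma>'(t)| dt\<close> under \<open>\<gamma>\<close>, as a Borel
  measure on the plane.
\<close>

definition arc_length_measure :: "(real \<Rightarrow> real \<times> real) \<Rightarrow> real set \<Rightarrow> (real \<times> real) measure" where
  "arc_length_measure \<gamma> I =
     distr (density (restrict_space lborel I) (\<lambda>t. ennreal (norm (vector_derivative \<gamma> (at t)))))
       borel \<gamma>"

definition AC :: "(real \<times> real) set \<Rightarrow> (real \<times> real) measure \<Rightarrow> ((real \<times> real) set \<Rightarrow> complex) set" where
  "AC \<Gamma> \<sigma> = {\<mu>. complex_borel_measure \<mu> \<and>
     (\<forall>A\<in>sets borel. A \<inter> \<Gamma> = {} \<longrightarrow> \<mu> A = 0) \<and>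
     (\<forall>A\<in>sets borel. emeasure \<sigma> A = 0 \<longrightarrow> \<mu> A = 0)}"

definition AC_vanishing :: "(real \<times> real) set \<Rightarrow> (real \<times> real) measure \<Rightarrow> (real \<times> real) set
    \<Rightarrow> ((real \<times> real) set \<Rightarrow> complex) set" where
  "AC_vanishing \<Gamma> \<sigma> \<Lambda> = {\<mu> \<in> AC \<Gamma> \<sigma>. \<forall>\<xi>\<in>\<Lambda>. fourier \<mu> \<xi> = 0}"


section \<open>The hyperbola and the lattice-cross\<close>

definition hyperbola :: "real \<Rightarrow> (real \<times> real) set" where
  "hyperbola M = {x. fst x * snd x = M\<^sup>2 / (4 * pi\<^sup>2)}"

definition hyperbola_pos :: "real \<Rightarrow> (real \<times> real) set" where
  "hyperbola_pos M = {x \<in> hyperbola M. fst x > 0}"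

definition hyperbola_neg :: "real \<Rightarrow> (real \<times> real) set" where
  "hyperbola_neg M = hyperbola M - hyperbola_pos M"

definition hyperbola_param :: "real \<Rightarrow> real \<Rightarrow> real \<times> real" where
  "hyperbola_param M t = (t, M\<^sup>2 / (4 * pi\<^sup>2 * t))"

definition hyperbola_arc_length :: "real \<Rightarrow> (real \<times> real) measure" where
  "hyperbola_arc_length M = arc_length_measure (hyperbola_param M) (- {0})"

definition AC_hyperbola :: "real \<Rightarrow> (real \<times> real) set \<Rightarrow> ((real \<times> real) set \<Rightarrow> complex) set" where
  "AC_hyperbola M \<Lambda> = AC_vanishing (hyperbola M) (hyperbola_arc_length M) \<Lambda>"

definition lattice_cross :: "real \<Rightarrow> real \<Rightarrow> (real \<times> real) set" where
  "lattice_cross \<alpha> \<beta> = ((*) \<alpha> ` \<int>) \<times> {0} \<union> {0} \<times> ((*) \<beta> ` \<int>)"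

lemma hyperbola_param_bij:
  assumes "M \<noteq> 0"
  shows "bij_betw (hyperbola_param M) (- {0}) (hyperbola M)"
proof (rule bij_betw_byWitness[where f' = fst])
  show "\<forall>x\<in>hyperbola M. hyperbola_param M (fst x) = x"
  proof
    fix x assume x: "x \<in> hyperbola M"
    have "fst x \<noteq> 0" using x assms by (auto simp: hyperbola_def)
    then have "snd x = M\<^sup>2 / (4 * pi\<^sup>2 * fst x)"
      using x by (simp add: hyperbola_def field_simps)
    then show "hyperbola_param M (fst x) = x"
      by (simp add: hyperbola_param_def prod_eq_iff)
  qed
qed (use assms in \<open>auto simp: hyperbola_param_def hyperbola_def\<close>)

lemma hyperbola_param_has_vector_derivative:
  assumes "t \<noteq> 0"
  shows "(hyperbola_param M has_vector_derivative (1, - M\<^sup>2 / (4 * pi\<^sup>2 * t\<^sup>2))) (at t)"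
proof -
  have "((\<lambda>t. M\<^sup>2 / (4 * pi\<^sup>2 * t)) has_real_derivative - M\<^sup>2 / (4 * pi\<^sup>2 * t\<^sup>2)) (at t)"
    using assms by (auto intro!: derivative_eq_intros simp: field_simps power2_eq_square)
  then have "((\<lambda>t. (t, M\<^sup>2 / (4 * pi\<^sup>2 * t))) has_vector_derivative (1, - M\<^sup>2 / (4 * pi\<^sup>2 * t\<^sup>2))) (at t)"
    by (intro has_vector_derivative_Pair)
       (auto simp: has_real_derivative_iff_has_vector_derivative)
  then show ?thesis by (simp add: hyperbola_param_def[abs_def])
qed

lemma hyperbola_param_measurable [measurable]: "hyperbola_param M \<in> borel_measurable borel"
  unfolding hyperbola_param_def[abs_def] by measurable

end

theory Submission
  imports Defs "HOL-Probability.Probability"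
begin

text \<open>
  Put \<open>c = \<alpha> \<beta> M\<^sup>2 / (16 \<pi>\<^sup>2)\<close>.  In the coordinate \<open>s = \<alpha> x\<^sub>1 / 2\<close> on a branch (up to sign), vanishing of
  the Fourier transform on the lattice-cross says that the images of the measure under \<open>s \<mapsto> frac s\<close>
  and \<open>s \<mapsto> frac (c / s)\<close> are both zero.  So the part on \<open>s < 1\<close> is determined by the part on \<open>s \<ge> 1\<close>,
  and the part on \<open>c / s < 1\<close> by the part on \<open>c / s \<ge> 1\<close>.  Composing the two, the dynamics of the Gauss-type
  map \<open>x \<mapsto> frac (c / x)\<close> on \<open>(0, 1)\<close> decides.

  If \<open>c < 1\<close>, the total variation on \<open>(0, 1)\<close> is bounded by the variation on the points of \<open>(0, c]\<close> that survive
  arbitrarily many steps of the map without entering the hole \<open>(c, 1)\<close>; with respect to the weight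
  \<open>1 / (1 + x)\<close> each step shrinks the surviving set by the factor \<open>2 c / (1 + c) < 1\<close>, so it is null.

  If \<open>c \<ge> 1\<close>, the map has an absolutely continuous invariant probability measure, and placing it at
  \<open>s = x\<close> with sign \<open>+\<close> and at \<open>s = c / x\<close> with sign \<open>-\<close> yields a nonzero measure with vanishing transform.
  For \<open>c = 1\<close> it is the Gauss measure; for \<open>c > 1\<close> it is a weak limit of orbit averages of Lebesgue measure,
  whose densities are bounded because their positive variation on the circle is.
\<close>

section \<open>Signed measures and the Hahn decomposition\<close>

text \<open>The constant \<open>c\<close> arises because
  \<open>exp (\<i> * pi * \<alpha> * k * x1) = cis (2 * pi * k * s)\<close> for
  \<open>s = \<alpha> * x1 / 2\<close>, while \<open>x1 * x2 = M^2 / (4 * pi^2)\<close> turns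
  \<open>\<beta> * x2 / 2\<close> into \<open>c / s\<close>. The threshold is geometric first: the
  half-lines \<open>s < 1\<close> and \<open>c / s < 1\<close>, each controlled by its complement,
  overlap exactly when \<open>c < 1\<close>. When \<open>c \<ge> 1\<close> they are disjoint, so
  that a measure and its mirror image can be placed on them with opposite signs without cancelling.
  At \<open>c = 1\<close> the expansion of the map degenerates at the endpoint 1, so the estimate
  for \<open>c > 1\<close> breaks down and an explicit density takes its place. For
  \<open>c > 1\<close> a weak limit might a priori be singular, or charge the point 0, where
  \<open>c / x\<close> is discontinuous; a density bound uniform along the orbit excludes both. Mass
  is estimated through total variation, which comes from Hahn sets of real signed measures; a
  complex measure enters through its real and imaginary parts.\<close>

definition signed_measure :: "('a::topological_space set \<Rightarrow> real) \<Rightarrow> bool" where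
  "signed_measure \<nu> \<longleftrightarrow> (\<forall>A::nat \<Rightarrow> 'a set. range A \<subseteq> sets borel \<longrightarrow> disjoint_family A \<longrightarrow>
     (\<lambda>n. \<nu> (A n)) sums \<nu> (\<Union>n. A n))"

lemma signed_measureD:
  fixes A :: "nat \<Rightarrow> 'a::topological_space set"
  assumes "signed_measure \<nu>" "\<And>n. A n \<in> sets borel" "disjoint_family A"
  shows "(\<lambda>n. \<nu> (A n)) sums \<nu> (\<Union>n. A n)"
  using assms unfolding signed_measure_def by blast

lemma signed_measure_empty:
  assumes "signed_measure \<nu>"
  shows "\<nu> {} = 0"
proof -
  have "(\<lambda>n::nat. \<nu> {}) sums \<nu> (\<Union>n::nat. {})"
    using assms by (intro signed_measureD) (auto simp: disjoint_family_on_def)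
  then have "(\<lambda>n::nat. \<nu> {}) \<longlonglongrightarrow> 0"
    using sums_summable summable_LIMSEQ_zero by blast
  then show ?thesis by (simp add: LIMSEQ_const_iff)
qed

lemma signed_measure_Un:
  assumes \<nu>: "signed_measure \<nu>" and "A \<in> sets borel" "B \<in> sets borel" "A \<inter> B = {}"
  shows "\<nu> (A \<union> B) = \<nu> A + \<nu> B"
proof -
  have "(\<lambda>n. \<nu> (binaryset A B n)) sums \<nu> (\<Union>n. binaryset A B n)"
    using assms by (intro signed_measureD) (auto simp: binaryset_def disjoint_family_on_def)
  moreover have "(\<lambda>n. \<nu> (binaryset A B n)) sums (\<nu> A + \<nu> B)"
    using binaryset_sums[of \<nu> A B] signed_measure_empty[OF \<nu>] by blast
  ultimately show ?thesis using sums_unique2 by (metis UN_binaryset_eq)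
qed

lemma signed_measure_split:
  assumes "signed_measure \<nu>" and "A \<in> sets borel" "B \<in> sets borel"
  shows "\<nu> A = \<nu> (A \<inter> B) + \<nu> (A - B)"
proof -
  have "\<nu> (A \<inter> B \<union> (A - B)) = \<nu> (A \<inter> B) + \<nu> (A - B)"
    using assms by (intro signed_measure_Un) auto
  moreover have "A \<inter> B \<union> (A - B) = A" by auto
  ultimately show ?thesis by simp
qed

lemma signed_measure_decseq:
  assumes \<nu>: "signed_measure \<nu>" and B: "\<And>n. B n \<in> sets borel" and "decseq B"
  shows "(\<lambda>n. \<nu> (B n)) \<longlonglongrightarrow> \<nu> (\<Inter>n. B n)"
proof -
  define D where "D n = B n - B (Suc n)" for n
  have sub: "B n \<subseteq> B m" if "m \<le> n" for m n using \<open>decseq B\<close> that by (auto simp: decseq_def)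
  have "disjoint_family D"
    unfolding disjoint_family_on_def
  proof (intro ballI impI)
    fix m n :: nat assume "m \<noteq> n"
    have "D n \<inter> D m = {}" if "m < n" for m n using sub[of "Suc m" n] that by (auto simp: D_def)
    then show "D m \<inter> D n = {}" using \<open>m \<noteq> n\<close> by (metis inf_commute linorder_neqE_nat)
  qed
  moreover have "D n \<in> sets borel" for n using B by (simp add: D_def)
  ultimately have "(\<lambda>n. \<nu> (D n)) sums \<nu> (\<Union>n. D n)"
    using \<nu> by (intro signed_measureD)
  moreover have "(\<Union>n. D n) = B 0 - (\<Inter>n. B n)"
  proof (intro equalityI subsetI)
    fix x assume x: "x \<in> B 0 - (\<Inter>n. B n)"
    define k where "k = (LEAST k. x \<notin> B k)"
    have k: "x \<notin> B k" unfolding k_def by (rule LeastI_ex) (use x in auto)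
    have "k \<noteq> 0" using k x by (metis Diff_iff)
    then obtain j where j: "k = Suc j" using not0_implies_Suc by blast
    have "x \<in> B j" using not_less_Least[of j "\<lambda>k. x \<notin> B k"] j unfolding k_def by auto
    then show "x \<in> (\<Union>n. D n)" using k j by (auto simp: D_def)
  qed (use sub[of 0] in \<open>auto simp: D_def\<close>)
  moreover have "\<nu> (D n) = \<nu> (B n) - \<nu> (B (Suc n))" for n
    using signed_measure_split[OF \<nu> B B, of n "Suc n"] sub[of n "Suc n"]
    by (simp add: D_def inf.absorb2)
  moreover have "\<nu> (B 0) = \<nu> (\<Inter>n. B n) + \<nu> (B 0 - (\<Inter>n. B n))"
  proof -
    have "(\<Inter>n. B n) \<in> sets borel" using B by auto
    moreover have "B 0 \<inter> (\<Inter>n. B n) = (\<Inter>n. B n)" by auto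
    ultimately show ?thesis using signed_measure_split[OF \<nu> B, of "\<Inter>n. B n" 0] by simp
  qed
  ultimately have "(\<lambda>n. \<nu> (B 0) - (\<Sum>i<n. \<nu> (B i) - \<nu> (B (Suc i)))) \<longlonglongrightarrow> \<nu> (B 0) - (\<nu> (B 0) - \<nu> (\<Inter>n. B n))"
    by (intro tendsto_diff tendsto_const) (simp add: sums_def)
  then show ?thesis by (simp add: sum_lessThan_telescope'[of "\<lambda>i. \<nu> (B i)"])
qed

section \<open>Positive sets, and maximality as the source of a Hahn set\<close>

definition positive_set :: "('a::topological_space set \<Rightarrow> real) \<Rightarrow> 'a set \<Rightarrow> bool" where
  "positive_set \<nu> A \<longleftrightarrow> A \<in> sets borel \<and> (\<forall>B\<in>sets borel. B \<subseteq> A \<longrightarrow> 0 \<le> \<nu> B)"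

lemma positive_setD: "positive_set \<nu> A \<Longrightarrow> B \<in> sets borel \<Longrightarrow> B \<subseteq> A \<Longrightarrow> 0 \<le> \<nu> B"
  by (auto simp: positive_set_def)

lemma positive_set_borel: "positive_set \<nu> A \<Longrightarrow> A \<in> sets borel"
  by (auto simp: positive_set_def)

text \<open>Greedy removal: as long as a piece of value below \<open>- e\<close> is left, deleting
  it increases \<open>\<nu>\<close>. Infinitely many deletions would give disjoint pieces whose
  values form a convergent series with all terms at most \<open>- e\<close>, which is
  impossible.\<close>

lemma almost_positive_subset:
  assumes \<nu>: "signed_measure \<nu>" and A: "A \<in> sets borel" and "e > 0"
  shows "\<exists>B\<in>sets borel. B \<subseteq> A \<and> \<nu> A \<le> \<nu> B \<and> (\<forall>C\<in>sets borel. C \<subseteq> B \<longrightarrow> - e \<le> \<nu> C)"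
proof (rule ccontr)
  assume neg: "\<not> ?thesis"
  have "\<exists>C\<in>sets borel. C \<subseteq> B \<and> \<nu> C < - e" if "B \<in> sets borel" "B \<subseteq> A" "\<nu> A \<le> \<nu> B" for B
  proof (rule ccontr)
    assume "\<not> ?thesis"
    then have "\<forall>C\<in>sets borel. C \<subseteq> B \<longrightarrow> - e \<le> \<nu> C" by (meson not_le)
    then show False using neg that by blast
  qed
  then obtain c where c: "\<And>B. B \<in> sets borel \<Longrightarrow> B \<subseteq> A \<Longrightarrow> \<nu> A \<le> \<nu> B \<Longrightarrow>
      c B \<in> sets borel \<and> c B \<subseteq> B \<and> \<nu> (c B) < - e"
    by metis
  define B where "B n = ((\<lambda>X. X - c X) ^^ n) A" for n
  have B_Suc: "B (Suc n) = B n - c (B n)" for n by (simp add: B_def)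
  have B: "B n \<in> sets borel \<and> B n \<subseteq> A \<and> \<nu> A \<le> \<nu> (B n)" for n
  proof (induction n)
    case 0 show ?case using A by (simp add: B_def)
  next
    case (Suc n)
    have "\<nu> (B n) = \<nu> (c (B n)) + \<nu> (B n - c (B n))"
      using signed_measure_split[OF \<nu>, of "B n" "c (B n)"] c[of "B n"] Suc
      by (simp add: inf.absorb2)
    then show ?case using c[of "B n"] Suc \<open>e > 0\<close> unfolding B_Suc by auto
  qed
  have dec: "decseq B" by (rule decseq_SucI) (auto simp: B_Suc)
  have "disjoint_family (\<lambda>n. c (B n))"
    unfolding disjoint_family_on_def
  proof (intro ballI impI)
    fix m n :: nat assume "m \<noteq> n"
    have "c (B m) \<inter> c (B n) = {}" if "m < n" for m n
    proof -
      have "B n \<subseteq> B (Suc m)" using that by (intro decseqD[OF dec]) simp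
      moreover have "c (B n) \<subseteq> B n" using c B by blast
      ultimately show ?thesis unfolding B_Suc by blast
    qed
    then show "c (B m) \<inter> c (B n) = {}" using \<open>m \<noteq> n\<close> by (metis inf_commute linorder_neqE_nat)
  qed
  then have "(\<lambda>n. \<nu> (c (B n))) sums \<nu> (\<Union>n. c (B n))"
    using \<nu> B c by (intro signed_measureD) auto
  then have "(\<lambda>n. \<nu> (c (B n))) \<longlonglongrightarrow> 0" using sums_summable summable_LIMSEQ_zero by blast
  moreover have "\<nu> (c (B n)) \<le> - e" for n using c[of "B n"] B[of n] by auto
  ultimately have "0 \<le> - e" by (intro LIMSEQ_le_const2[of _ 0]) auto
  then show False using \<open>e > 0\<close> by simp
qed

text \<open>The tolerances \<open>1 / (n + 1)\<close> are used one after another on nested sets, so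
  the intersection tolerates no negative subset at all, and continuity from above keeps its value at
  least \<open>\<nu> A\<close>.\<close>

lemma positive_subset:
  assumes \<nu>: "signed_measure \<nu>" and A: "A \<in> sets borel"
  shows "\<exists>B. positive_set \<nu> B \<and> B \<subseteq> A \<and> \<nu> A \<le> \<nu> B"
proof -
  have "\<exists>B. B \<in> sets borel \<and> B \<subseteq> X \<and> \<nu> X \<le> \<nu> B \<and>
      (\<forall>C\<in>sets borel. C \<subseteq> B \<longrightarrow> - inverse (real (Suc n)) \<le> \<nu> C)" if "X \<in> sets borel" for X n
    using almost_positive_subset[OF \<nu> that, of "inverse (real (Suc n))"] by auto
  then obtain b where b: "\<And>X n. X \<in> sets borel \<Longrightarrow> b X n \<in> sets borel \<and> b X n \<subseteq> X \<and> \<nu> X \<le> \<nu> (b X n) \<and>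
      (\<forall>C\<in>sets borel. C \<subseteq> b X n \<longrightarrow> - inverse (real (Suc n)) \<le> \<nu> C)"
    by metis
  define B where "B = rec_nat A (\<lambda>n X. b X n)"
  have B_Suc: "B (Suc n) = b (B n) n" for n by (simp add: B_def)
  have B: "B n \<in> sets borel" for n
    by (induction n) (use A b in \<open>auto simp: B_def\<close>)
  have dec: "decseq B" by (rule decseq_SucI) (use b B B_Suc in auto)
  have mono: "\<nu> A \<le> \<nu> (B n)" for n
  proof (induction n)
    case (Suc n) then show ?case using b[OF B[of n], of n] by (simp add: B_Suc)
  qed (simp add: B_def)
  have lim: "(\<lambda>n. \<nu> (B n)) \<longlonglongrightarrow> \<nu> (\<Inter>n. B n)" by (rule signed_measure_decseq[OF \<nu> B dec])
  have "0 \<le> \<nu> C" if C: "C \<in> sets borel" "C \<subseteq> (\<Inter>n. B n)" for C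
  proof -
    have "- inverse (real (Suc n)) \<le> \<nu> C" for n
    proof -
      have "C \<subseteq> b (B n) n" using C(2) B_Suc[of n] by auto
      then show ?thesis using b[OF B[of n], of n] C(1) by blast
    qed
    moreover have "(\<lambda>n. - inverse (real (Suc n))) \<longlonglongrightarrow> - 0"
      by (intro tendsto_minus LIMSEQ_inverse_real_of_nat)
    ultimately have "- 0 \<le> \<nu> C" by (intro LIMSEQ_le_const2[of _ "- 0"]) blast+
    then show ?thesis by simp
  qed
  moreover have "(\<Inter>n. B n) \<subseteq> A" by (rule INF_lower2[of 0]) (auto simp: B_def)
  moreover have "\<nu> A \<le> \<nu> (\<Inter>n. B n)" using LIMSEQ_le_const[OF lim] mono by blast
  ultimately show ?thesis
    using B by (intro exI[of _ "\<Inter>n. B n"]) (auto simp: positive_set_def)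
qed

lemma positive_set_UN:
  assumes \<nu>: "signed_measure \<nu>" and P: "\<And>n::nat. positive_set \<nu> (P n)"
  shows "positive_set \<nu> (\<Union>n. P n)"
  unfolding positive_set_def
proof (intro conjI ballI impI)
  have PB: "P n \<in> sets borel" for n using P positive_set_borel by blast
  then show "(\<Union>n. P n) \<in> sets borel" by auto
  fix B assume B: "B \<in> sets borel" "B \<subseteq> (\<Union>n. P n)"
  have D: "disjointed P n \<in> sets borel" for n
    using PB sets.range_disjointed_sets[of P borel] by auto
  have "disjoint_family (\<lambda>n. B \<inter> disjointed P n)"
    using disjoint_family_disjointed[of P] unfolding disjoint_family_on_def by blast
  then have "(\<lambda>n. \<nu> (B \<inter> disjointed P n)) sums \<nu> (\<Union>n. B \<inter> disjointed P n)"
    using \<nu> B D by (intro signed_measureD) auto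
  moreover have "(\<Union>n. B \<inter> disjointed P n) = B" using B UN_disjointed_eq[of P] by auto
  moreover have "0 \<le> \<nu> (B \<inter> disjointed P n)" for n
    using B D disjointed_subset[of P n] by (intro positive_setD[OF P[of n]]) auto
  ultimately show "0 \<le> \<nu> B" using sums_le[OF _ sums_zero, of "\<lambda>n. \<nu> (B \<inter> disjointed P n)"] by metis
qed

text \<open>The union of positive sets that nearly attain \<open>Sup V\<close> attains it. A subset
  of the complement with positive value would contain a positive set of positive value, and
  adjoining that to \<open>H\<close> would exceed the supremum.\<close>

lemma Hahn_decomposition:
  assumes \<nu>: "signed_measure \<nu>"
  obtains H where "positive_set \<nu> H" "positive_set (\<lambda>A. - \<nu> A) (- H)"
proof -
  define V where "V = {\<nu> P |P. positive_set \<nu> P}"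
  have le: "\<nu> A \<le> \<nu> B" if "positive_set \<nu> B" "A \<in> sets borel" "A \<subseteq> B" for A B
  proof -
    have "\<nu> B = \<nu> A + \<nu> (B - A)"
      using signed_measure_split[OF \<nu>, of B A] that positive_set_borel[OF that(1)]
      by (simp add: inf.absorb2)
    moreover have "0 \<le> \<nu> (B - A)"
      using that positive_set_borel[OF that(1)] by (intro positive_setD[OF that(1)]) auto
    ultimately show ?thesis by simp
  qed
  have "positive_set \<nu> {}" by (auto simp: positive_set_def signed_measure_empty[OF \<nu>])
  then have "V \<noteq> {}" by (auto simp: V_def)
  \<comment> \<open>Unboundedness would yield positive sets with values above every
    \<open>n\<close>; their union has one real value dominating all of them.\<close>
  have bdd: "bdd_above V"
  proof (rule ccontr)
    assume "\<not> bdd_above V"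
    then have "\<exists>P. positive_set \<nu> P \<and> real n < \<nu> P" for n
      unfolding bdd_above_def V_def by (force simp: not_le)
    then obtain P where P: "\<And>n. positive_set \<nu> (P n)" "\<And>n. real n < \<nu> (P n)" by metis
    have "real n < \<nu> (\<Union>n. P n)" for n
    proof -
      have "\<nu> (P n) \<le> \<nu> (\<Union>n. P n)"
        by (rule le[OF positive_set_UN[OF \<nu> P(1)] positive_set_borel[OF P(1)]]) blast
      then show ?thesis using P(2)[of n] by linarith
    qed
    then show False using reals_Archimedean2[of "\<nu> (\<Union>n. P n)"] by (metis less_asym)
  qed
  have "\<exists>P. positive_set \<nu> P \<and> Sup V - inverse (real (Suc n)) < \<nu> P" for n
    using less_cSup_iff[OF \<open>V \<noteq> {}\<close> bdd, of "Sup V - inverse (real (Suc n))"]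
    by (auto simp: V_def)
  then obtain P where P: "\<And>n. positive_set \<nu> (P n)" "\<And>n. Sup V - inverse (real (Suc n)) < \<nu> (P n)"
    by metis
  define H where "H = (\<Union>n. P n)"
  have H: "positive_set \<nu> H" unfolding H_def by (rule positive_set_UN[OF \<nu> P(1)])
  have "Sup V - inverse (real (Suc n)) \<le> \<nu> H" for n
  proof -
    have "\<nu> (P n) \<le> \<nu> H"
      using positive_set_borel[OF P(1)] by (intro le H) (auto simp: H_def)
    then show ?thesis using P(2)[of n] by linarith
  qed
  moreover have "(\<lambda>n. Sup V - inverse (real (Suc n))) \<longlonglongrightarrow> Sup V - 0"
    by (intro tendsto_diff tendsto_const LIMSEQ_inverse_real_of_nat)
  ultimately have "Sup V - 0 \<le> \<nu> H" by (intro LIMSEQ_le_const2[of _ "Sup V - 0"]) blast+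
  then have Sup: "Sup V \<le> \<nu> H" by simp
  have "\<nu> A \<le> 0" if A: "A \<in> sets borel" "A \<subseteq> - H" for A
  proof -
    obtain B where B: "positive_set \<nu> B" "B \<subseteq> A" "\<nu> A \<le> \<nu> B" using positive_subset[OF \<nu> A(1)] by blast
    \<comment> \<open>The binary union is written as a sequence so that the countable statement on
      positive sets covers it.\<close>
    have "positive_set \<nu> (\<Union>n::nat. if n = 0 then H else B)"
      by (rule positive_set_UN[OF \<nu>]) (use H B in auto)
    moreover have "(\<Union>n::nat. if n = 0 then H else B) = H \<union> B" by (force split: if_splits)
    ultimately have "\<nu> (H \<union> B) \<in> V" by (auto simp: V_def)
    then have "\<nu> (H \<union> B) \<le> Sup V" using bdd by (intro cSup_upper)
    moreover have "\<nu> (H \<union> B) = \<nu> H + \<nu> B"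
      using A B H by (intro signed_measure_Un[OF \<nu>]) (auto dest: positive_set_borel)
    ultimately show ?thesis using Sup B by linarith
  qed
  then have "positive_set (\<lambda>A. - \<nu> A) (- H)"
    using H unfolding positive_set_def by auto
  with H that show thesis by blast
qed

section \<open>Jordan parts computed from a Hahn set\<close>

lemma signed_measure_uminus:
  assumes "signed_measure \<nu>" shows "signed_measure (\<lambda>A. - \<nu> A)"
  using assms unfolding signed_measure_def by (simp add: sums_minus)

lemma sets_jordan_pos [simp, measurable_cong]: "sets (jordan_pos \<nu>) = sets borel"
  using sets.sigma_sets_eq[of borel] by (simp add: jordan_pos_def sets_measure_of_conv)

lemma space_jordan_pos [simp]: "space (jordan_pos \<nu>) = UNIV"
  by (simp add: jordan_pos_def space_measure_of_conv)

text \<open>The supremum defining \<open>jordan_pos\<close> is attained at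
  \<open>A \<inter> H\<close>: dropping what lies outside \<open>H\<close> and filling up inside
  \<open>H\<close> can only raise the value. Countable additivity of this explicit form is what
  makes \<open>measure_of\<close> return the intended set function.\<close>

lemma emeasure_jordan_pos:
  assumes \<nu>: "signed_measure \<nu>" and H: "positive_set \<nu> H" "positive_set (\<lambda>A. - \<nu> A) (- H)"
    and A: "A \<in> sets borel"
  shows "emeasure (jordan_pos \<nu>) A = ennreal (\<nu> (A \<inter> H))"
proof -
  have HB: "H \<in> sets borel" using H positive_set_borel by blast
  have sup: "(SUP B\<in>{B \<in> sets borel. B \<subseteq> A}. ennreal (\<nu> B)) = ennreal (\<nu> (A \<inter> H))"
    if A: "A \<in> sets borel" for A
  proof (rule SUP_eqI)
    fix B assume B: "B \<in> {B \<in> sets borel. B \<subseteq> A}"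
    have "\<nu> B = \<nu> (B \<inter> H) + \<nu> (B - H)" using B HB by (intro signed_measure_split[OF \<nu>]) auto
    moreover have "0 \<le> - \<nu> (B - H)" using B HB by (intro positive_setD[OF H(2)]) auto
    moreover have "\<nu> (A \<inter> H) = \<nu> (A \<inter> H \<inter> (B \<inter> H)) + \<nu> (A \<inter> H - (B \<inter> H))"
      using A B HB by (intro signed_measure_split[OF \<nu>]) auto
    moreover have "A \<inter> H \<inter> (B \<inter> H) = B \<inter> H" using B by auto
    moreover have "0 \<le> \<nu> (A \<inter> H - (B \<inter> H))" using A B HB by (intro positive_setD[OF H(1)]) auto
    ultimately show "ennreal (\<nu> B) \<le> ennreal (\<nu> (A \<inter> H))" by (intro ennreal_leI) simp
  next
    fix y assume "\<And>B. B \<in> {B \<in> sets borel. B \<subseteq> A} \<Longrightarrow> ennreal (\<nu> B) \<le> y"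
    then show "ennreal (\<nu> (A \<inter> H)) \<le> y" using A HB by auto
  qed
  show ?thesis
  proof (subst emeasure_measure_of[OF jordan_pos_def])
    show "positive (sets (jordan_pos \<nu>)) (\<lambda>A. SUP B\<in>{B \<in> sets borel. B \<subseteq> A}. ennreal (\<nu> B))"
      by (auto simp: positive_def sup signed_measure_empty[OF \<nu>])
    show "countably_additive (sets (jordan_pos \<nu>)) (\<lambda>A. SUP B\<in>{B \<in> sets borel. B \<subseteq> A}. ennreal (\<nu> B))"
      unfolding countably_additive_def
    proof (intro allI impI)
      fix F :: "nat \<Rightarrow> 'a set"
      assume F: "range F \<subseteq> sets (jordan_pos \<nu>)" "disjoint_family F"
      then have FB: "F n \<in> sets borel" for n by auto
      have "(\<lambda>n. \<nu> (F n \<inter> H)) sums \<nu> (\<Union>n. F n \<inter> H)"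
        using F FB HB by (intro signed_measureD[OF \<nu>]) (auto simp: disjoint_family_on_def)
      moreover have "0 \<le> \<nu> (F n \<inter> H)" for n using FB HB by (intro positive_setD[OF H(1)]) auto
      ultimately have "(\<Sum>n. ennreal (\<nu> (F n \<inter> H))) = ennreal (\<nu> (\<Union>n. F n \<inter> H))"
        by (intro suminf_ennreal_eq) auto
      moreover have "(\<Union>n. F n \<inter> H) = (\<Union>n. F n) \<inter> H" by auto
      moreover have "(\<Union>n. F n) \<in> sets borel" using FB by auto
      ultimately show "(\<Sum>n. SUP B\<in>{B \<in> sets borel. B \<subseteq> F n}. ennreal (\<nu> B)) =
          (SUP B\<in>{B \<in> sets borel. B \<subseteq> (\<Union>n. F n)}. ennreal (\<nu> B))"
        by (simp add: sup FB)
    qed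
  qed (use A sup in auto)
qed

lemma jordan_pos_finite:
  assumes \<nu>: "signed_measure \<nu>"
  shows "finite_measure (jordan_pos \<nu>)"
proof -
  obtain H where H: "positive_set \<nu> H" "positive_set (\<lambda>A. - \<nu> A) (- H)"
    using Hahn_decomposition[OF \<nu>] .
  show ?thesis by (rule finite_measureI) (simp add: emeasure_jordan_pos[OF \<nu> H])
qed

lemma jordan_decomposition:
  assumes \<nu>: "signed_measure \<nu>" and A: "A \<in> sets borel"
  shows "\<nu> A = measure (jordan_pos \<nu>) A - measure (jordan_pos (\<lambda>A. - \<nu> A)) A"
proof -
  obtain H where H: "positive_set \<nu> H" "positive_set (\<lambda>A. - \<nu> A) (- H)"
    using Hahn_decomposition[OF \<nu>] .
  have HB: "H \<in> sets borel" using H positive_set_borel by blast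
  have "measure (jordan_pos \<nu>) A = \<nu> (A \<inter> H)"
    using A HB by (simp add: measure_def emeasure_jordan_pos[OF \<nu> H] positive_setD[OF H(1)])
  moreover have "emeasure (jordan_pos (\<lambda>A. - \<nu> A)) A = ennreal (- \<nu> (A \<inter> - H))"
    using H A by (intro emeasure_jordan_pos signed_measure_uminus \<nu>) auto
  moreover have "0 \<le> - \<nu> (A \<inter> - H)" using A HB by (intro positive_setD[OF H(2)]) auto
  ultimately show ?thesis
    using signed_measure_split[OF \<nu> A HB] by (simp add: measure_def Diff_eq)
qed

section \<open>Fourier coefficients determine measures modulo 1\<close>

inductive trig_poly :: "(real \<Rightarrow> complex) \<Rightarrow> bool" where
  base: "trig_poly (\<lambda>x. cis (2 * pi * of_int k * x))"
| add: "trig_poly f \<Longrightarrow> trig_poly g \<Longrightarrow> trig_poly (\<lambda>x. f x + g x)"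
| scale: "trig_poly f \<Longrightarrow> trig_poly (\<lambda>x. c * f x)"

lemma trig_poly_mult:
  assumes "trig_poly f" "trig_poly g"
  shows "trig_poly (\<lambda>x. f x * g x)"
  using assms(1)
proof induction
  case (base k)
  show ?case using assms(2)
  proof induction
    case (base l)
    have "cis (2 * pi * of_int k * x) * cis (2 * pi * of_int l * x) = cis (2 * pi * of_int (k + l) * x)" for x
      by (simp add: cis_mult algebra_simps)
    then show ?case using trig_poly.base[of "k + l"] by simp
  next
    case (add f g)
    then show ?case using trig_poly.add by (simp add: distrib_left)
  next
    case (scale f c)
    then show ?case using trig_poly.scale[OF scale.IH, of c] by (simp add: mult.left_commute)
  qed
next
  case (add f g)
  then show ?case using trig_poly.add by (simp add: distrib_right)
next
  case (scale f c)
  then show ?case using trig_poly.scale[OF scale.IH, of c] by (simp add: mult.assoc)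
qed

text \<open>Euler's formula turns a real-linear functional on the circle into a combination of
  \<open>cis t\<close> and \<open>cis (- t)\<close>; closure under products then reaches all real
  polynomials in the two coordinates, the class supplied by Stone-Weierstrass.\<close>

lemma trig_poly_real_polynomial_function:
  fixes p :: "complex \<Rightarrow> real"
  assumes "real_polynomial_function p"
  shows "trig_poly (\<lambda>x. complex_of_real (p (cis (2 * pi * x))))"
  using assms
proof induction
  case (linear f)
  interpret bounded_linear f by fact
  have "complex_of_real (f (cis t)) =
      (f 1 / 2 + f \<i> / (2 * \<i>)) * cis t + (f 1 / 2 - f \<i> / (2 * \<i>)) * cis (- t)" for t
  proof -
    have "f (cis t) = f (cos t *\<^sub>R 1 + sin t *\<^sub>R \<i>)"
      by (rule arg_cong[of _ _ f]) (simp add: complex_eq_iff)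
    then have "f (cis t) = cos t * f 1 + sin t * f \<i>" by (simp only: add scaleR real_scaleR_def)
    then show ?thesis by (simp add: complex_eq_iff Re_divide Im_divide field_simps)
  qed
  moreover have "trig_poly (\<lambda>x. (f 1 / 2 + f \<i> / (2 * \<i>)) * cis (2 * pi * of_int 1 * x) +
      (f 1 / 2 - f \<i> / (2 * \<i>)) * cis (2 * pi * of_int (-1) * x))"
    by (intro trig_poly.intros)
  ultimately show ?case by simp
next
  case (const c)
  have "trig_poly (\<lambda>x. complex_of_real c * cis (2 * pi * of_int 0 * x))"
    by (intro trig_poly.intros)
  then show ?case by simp
next
  case (add f g)
  then show ?case using trig_poly.add by simp
next
  case (mult f g)
  then show ?case using trig_poly_mult by simp
qed

section \<open>Equal Fourier coefficients force equal masses of closed sets on the circle\<close>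

context
  fixes P Q :: "real measure"
  assumes P: "finite_measure P" "sets P = sets borel"
    and Q: "finite_measure Q" "sets Q = sets borel"
    and coeff: "\<And>k::int. (LINT x|P. cis (2 * pi * of_int k * x)) = (LINT x|Q. cis (2 * pi * of_int k * x))"
begin

interpretation P: finite_measure P by (fact P(1))
interpretation Q: finite_measure Q by (fact Q(1))

lemma integral_trig_poly_eq:
  assumes "trig_poly f"
  shows "integrable P f \<and> integrable Q f \<and> (LINT x|P. f x) = (LINT x|Q. f x)"
  using assms
proof induction
  case (base k)
  have m: "(\<lambda>x::real. cis (2 * pi * of_int k * x)) \<in> borel_measurable borel"
    by (intro borel_measurable_continuous_onI continuous_intros)
  have "integrable P (\<lambda>x. cis (2 * pi * of_int k * x))"
    using m by (intro P.integrable_const_bound[of _ 1]) (auto simp: measurable_cong_sets[OF P(2) refl])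
  moreover have "integrable Q (\<lambda>x. cis (2 * pi * of_int k * x))"
    using m by (intro Q.integrable_const_bound[of _ 1]) (auto simp: measurable_cong_sets[OF Q(2) refl])
  ultimately show ?case using coeff by blast
qed auto

lemma total_mass_eq: "measure P UNIV = measure Q UNIV"
proof -
  have "space P = UNIV" "space Q = UNIV" using P(2) Q(2) by (metis sets_eq_imp_space_eq space_borel)+
  then show ?thesis using coeff[of 0] by (simp add: scaleR_conv_of_real)
qed

lemma integral_continuous_circle_eq:
  fixes F :: "complex \<Rightarrow> real"
  assumes F: "continuous_on (sphere 0 1) F"
  shows "(LINT x|P. F (cis (2 * pi * x))) = (LINT x|Q. F (cis (2 * pi * x)))"
proof -
  have c: "continuous_on UNIV (\<lambda>x::real. F (cis (2 * pi * x)))"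
    by (rule continuous_on_compose2[OF F]) (auto intro!: continuous_intros)
  then have m: "(\<lambda>x::real. F (cis (2 * pi * x))) \<in> borel_measurable borel"
    by (rule borel_measurable_continuous_onI)
  have "compact (F ` sphere 0 1)" by (intro compact_continuous_image F) auto
  then obtain B where "\<forall>z\<in>F ` sphere 0 1. norm z \<le> B"
    using compact_imp_bounded bounded_iff by metis
  then have B: "\<bar>F (cis t)\<bar> \<le> B" for t by auto
  have iP: "integrable P (\<lambda>x. F (cis (2 * pi * x)))"
    using m B by (intro P.integrable_const_bound[of _ B]) (auto simp: measurable_cong_sets[OF P(2) refl])
  have iQ: "integrable Q (\<lambda>x. F (cis (2 * pi * x)))"
    using m B by (intro Q.integrable_const_bound[of _ B]) (auto simp: measurable_cong_sets[OF Q(2) refl])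
  have "\<bar>(LINT x|P. F (cis (2 * pi * x))) - (LINT x|Q. F (cis (2 * pi * x)))\<bar> \<le> e * (measure P UNIV + measure Q UNIV)"
    if "e > 0" for e
  proof -
    obtain g where g: "real_polynomial_function g" "\<And>x. x \<in> sphere 0 1 \<Longrightarrow> \<bar>F x - g x\<bar> < e"
      using Stone_Weierstrass_real_polynomial_function[OF compact_sphere F \<open>e > 0\<close>] by metis
    let ?G = "\<lambda>x. g (cis (2 * pi * x))"
    have tp: "integrable P (\<lambda>x. complex_of_real (?G x))" "integrable Q (\<lambda>x. complex_of_real (?G x))"
       "(LINT x|P. complex_of_real (?G x)) = (LINT x|Q. complex_of_real (?G x))"
      using integral_trig_poly_eq[OF trig_poly_real_polynomial_function[OF g(1)]] by auto
    then have eq: "(LINT x|P. ?G x) = (LINT x|Q. ?G x)" by simp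
    have "\<bar>(LINT x|R. F (cis (2 * pi * x))) - (LINT x|R. ?G x)\<bar> \<le> e * measure R UNIV"
      if "finite_measure R" "space R = UNIV" "integrable R (\<lambda>x. F (cis (2 * pi * x)))"
        "integrable R (\<lambda>x. complex_of_real (?G x))" for R
    proof -
      interpret R: finite_measure R by fact
      have iG: "integrable R ?G" using integrable_Re[OF that(4)] by simp
      have "\<bar>(LINT x|R. F (cis (2 * pi * x)) - ?G x)\<bar> \<le> (LINT x|R. \<bar>F (cis (2 * pi * x)) - ?G x\<bar>)"
        by (rule integral_abs_bound)
      also have "\<dots> \<le> (LINT x|R. e)"
        using that iG g(2)[of "cis _"] by (intro integral_mono) (auto intro: less_imp_le)
      finally show ?thesis using that iG by (simp add: mult.commute)
    qed
    note b = this
    have sp: "space P = UNIV" "space Q = UNIV" using P(2) Q(2) by (metis sets_eq_imp_space_eq space_borel)+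
    show ?thesis
      using b[OF P(1) sp(1) iP tp(1)] b[OF Q(1) sp(2) iQ tp(2)] eq by (simp add: algebra_simps)
  qed
  note bound = this
  show ?thesis
  proof (rule ccontr)
    assume ne: "\<not> ?thesis"
    define d where "d = \<bar>(LINT x|P. F (cis (2 * pi * x))) - (LINT x|Q. F (cis (2 * pi * x)))\<bar>"
    define w where "w = measure P UNIV + measure Q UNIV"
    have "d > 0" using ne by (simp add: d_def)
    have "w \<ge> 0" by (simp add: w_def)
    \<comment> \<open>The tolerance \<open>d / (2 * (w + 1))\<close> makes the total error less than
      \<open>d\<close>; the summand 1 keeps the denominator positive when both masses
      vanish.\<close>
    have "d \<le> d / (2 * (w + 1)) * w"
    proof -
      have "0 < d / (2 * (w + 1))" using \<open>d > 0\<close> \<open>w \<ge> 0\<close> by simp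
      from bound[OF this] show ?thesis unfolding d_def[symmetric] w_def[symmetric] .
    qed
    then have "d * (2 * (w + 1)) \<le> d * w" using \<open>w \<ge> 0\<close> by (simp add: field_simps)
    then show False using \<open>d > 0\<close> \<open>w \<ge> 0\<close> by simp
  qed
qed

text \<open>The truncated functions \<open>1 - n * infdist z K\<close> are continuous and decrease
  to the indicator of \<open>K\<close>, so the equality for continuous functions passes to
  \<open>K\<close> by dominated convergence.\<close>

lemma measure_closed_arc_eq:
  assumes K: "compact K" "K \<noteq> {}"
  shows "measure P {x. cis (2 * pi * x) \<in> K} = measure Q {x. cis (2 * pi * x) \<in> K}"
proof -
  define F where "F n z = max 0 (1 - real n * infdist z K)" for n and z :: complex
  have F01: "0 \<le> F n z" "F n z \<le> 1" for n z by (auto simp: F_def infdist_nonneg)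
  have cF: "continuous_on S (F n)" for n S unfolding F_def by (intro continuous_intros)
  have lim: "(\<lambda>n. F n z) \<longlonglongrightarrow> indicator K z" for z
  proof (cases "z \<in> K")
    case True
    then have "F n z = 1" for n by (simp add: F_def)
    with True show ?thesis by simp
  next
    case False
    then have d: "infdist z K > 0"
      using K compact_imp_closed infdist_pos_not_in_closed by blast
    then obtain N :: nat where N: "inverse (infdist z K) < real N" using reals_Archimedean2 by blast
    have "F n z = 0" if "N \<le> n" for n
    proof -
      have "inverse (infdist z K) * infdist z K \<le> real n * infdist z K"
        using N that d by (intro mult_right_mono) auto
      then show ?thesis using d by (simp add: F_def)
    qed
    then have "\<forall>\<^sub>F n in sequentially. F n z = 0" using eventually_sequentially by blast
    with False show ?thesis by (simp add: tendsto_eventually)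
  qed
  have c: "continuous_on UNIV (\<lambda>x::real. cis (2 * pi * x))" by (intro continuous_intros)
  have Kb: "{x. cis (2 * pi * x) \<in> K} \<in> sets borel"
    using closed_vimage[OF compact_imp_closed[OF K(1)] c] by (auto simp: vimage_def)
  have "(\<lambda>n. LINT x|R. F n (cis (2 * pi * x))) \<longlonglongrightarrow> measure R {x. cis (2 * pi * x) \<in> K}"
    if R: "finite_measure R" "sets R = sets borel" for R
  proof -
    interpret R: finite_measure R by fact
    have "(\<lambda>n. LINT x|R. F n (cis (2 * pi * x))) \<longlonglongrightarrow> (LINT x|R. indicator {x. cis (2 * pi * x) \<in> K} x)"
    proof (rule integral_dominated_convergence[where w="\<lambda>_. 1"])
      show "(\<lambda>x. F n (cis (2 * pi * x))) \<in> borel_measurable R" for n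
        unfolding measurable_cong_sets[OF R(2) refl]
        by (intro borel_measurable_continuous_onI continuous_on_compose2[OF cF[of UNIV] c]) auto
      show "indicator {x. cis (2 * pi * x) \<in> K} \<in> borel_measurable R"
        unfolding measurable_cong_sets[OF R(2) refl] using Kb by simp
      show "AE x in R. (\<lambda>n. F n (cis (2 * pi * x))) \<longlonglongrightarrow> indicator {x. cis (2 * pi * x) \<in> K} x"
        using lim by (simp add: indicator_def)
    qed (use F01 in auto)
    moreover have "{x. cis (2 * pi * x) \<in> K} \<inter> space R = {x. cis (2 * pi * x) \<in> K}"
      using R(2) by (metis inf_top_right sets_eq_imp_space_eq space_borel)
    ultimately show ?thesis by simp
  qed
  note lims = this
  have "(LINT x|P. F n (cis (2 * pi * x))) = (LINT x|Q. F n (cis (2 * pi * x)))" for n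
    by (rule integral_continuous_circle_eq[OF cF])
  then show ?thesis using lims[OF P] lims[OF Q] LIMSEQ_unique by simp
qed

end

section \<open>Back from arcs to fractional parts\<close>

lemma cis_frac: "cis (2 * pi * frac x) = cis (2 * pi * x)"
proof -
  have "cis (2 * pi * x) = cis (2 * pi * frac x) * cis (2 * pi * of_int \<lfloor>x\<rfloor>)"
    by (simp add: frac_def cis_mult algebra_simps)
  then show ?thesis by (simp add: cis_multiple_2pi)
qed

text \<open>All arcs start at the point 1, so membership reads off the distribution function of
  \<open>frac\<close>. Both \<open>frac x\<close> and \<open>y\<close> lie in \<open>[0, 1)\<close>,
  which forces the integer between them to be 0.\<close>

lemma cis_in_arc_iff:
  assumes "0 \<le> b" "b < 1"
  shows "cis (2 * pi * x) \<in> (\<lambda>y. cis (2 * pi * y)) ` {0..b} \<longleftrightarrow> frac x \<le> b"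
proof
  assume "cis (2 * pi * x) \<in> (\<lambda>y. cis (2 * pi * y)) ` {0..b}"
  then obtain y where y: "0 \<le> y" "y \<le> b" "cis (2 * pi * frac x) = cis (2 * pi * y)"
    by (auto simp: cis_frac)
  then obtain n :: int where "2 * pi * frac x = 2 * pi * y + 2 * pi * n"
    using sin_cos_eq_iff[of "2 * pi * frac x" "2 * pi * y"] by (auto simp: complex_eq_iff)
  then have "2 * pi * frac x = 2 * pi * (y + n)" by (simp add: algebra_simps)
  then have n: "frac x = y + n" by simp
  have "- 1 < real_of_int n" "real_of_int n < 1"
    using n y assms frac_lt_1[of x] frac_ge_0[of x] by linarith+
  then have "n = 0" by linarith
  then show "frac x \<le> b" using n y by simp
next
  assume "frac x \<le> b"
  then show "cis (2 * pi * x) \<in> (\<lambda>y. cis (2 * pi * y)) ` {0..b}"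
    by (intro image_eqI[of _ _ "frac x"]) (auto simp: cis_frac)
qed


lemma borel_measurable_frac [measurable]: "(frac :: real \<Rightarrow> real) \<in> borel_measurable borel"
  unfolding frac_def by measurable

text \<open>Both images under \<open>frac\<close> have the same distribution function, and
  half-lines generate the Borel sets. Arcs handle thresholds in \<open>[0, 1)\<close>; above that
  only the total mass counts, which is the coefficient for \<open>k = 0\<close>.\<close>

lemma measure_frac_eq:
  fixes P Q :: "real measure"
  assumes P: "finite_measure P" "sets P = sets borel"
    and Q: "finite_measure Q" "sets Q = sets borel"
    and coeff: "\<And>k::int. (LINT x|P. cis (2 * pi * of_int k * x)) = (LINT x|Q. cis (2 * pi * of_int k * x))"
    and E: "E \<in> sets borel"
  shows "measure P {x. frac x \<in> E} = measure Q {x. frac x \<in> E}"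
proof -
  interpret P: finite_measure P by (fact P(1))
  interpret Q: finite_measure Q by (fact Q(1))
  have sp: "space P = UNIV" "space Q = UNIV" using P(2) Q(2) by (metis sets_eq_imp_space_eq space_borel)+
  have fm: "frac \<in> measurable P borel" "frac \<in> measurable Q borel"
    using P(2) Q(2) by (simp_all add: measurable_cong_sets[OF P(2) refl] measurable_cong_sets[OF Q(2) refl])
  have le: "measure P {x. frac x \<le> b} = measure Q {x. frac x \<le> b}" for b
  proof -
    consider "b < 0" | "1 \<le> b" | "0 \<le> b" "b < 1" by linarith
    then show ?thesis
    proof cases
      case 1
      then have "{x::real. frac x \<le> b} = {}" using frac_ge_0 by (force simp: not_le intro: less_le_trans)
      then show ?thesis by simp
    next
      case 2
      then have "{x::real. frac x \<le> b} = UNIV" using frac_lt_1 by (force intro: less_imp_le less_le_trans)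
      then show ?thesis using total_mass_eq[OF P Q coeff] by simp
    next
      case 3
      have "compact ((\<lambda>y. cis (2 * pi * y)) ` {0..b})"
        by (intro compact_continuous_image continuous_intros) auto
      then show ?thesis
        using measure_closed_arc_eq[OF P Q coeff, of "(\<lambda>y. cis (2 * pi * y)) ` {0..b}"] 3
        unfolding cis_in_arc_iff[OF 3] by auto
    qed
  qed
  have "distr P borel frac = distr Q borel frac"
  proof (rule measure_eqI_generator_eq[where E="range atMost" and \<Omega>=UNIV and A="\<lambda>n. {..real n}"])
    show "Int_stable (range (atMost :: real \<Rightarrow> _))" by (auto simp: Int_stable_def)
    fix X :: "real set" assume "X \<in> range atMost"
    then obtain b where b: "X = {..b}" by auto
    have "emeasure P {x. frac x \<le> b} = emeasure Q {x. frac x \<le> b}"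
      using le by (simp add: P.emeasure_eq_measure Q.emeasure_eq_measure)
    then show "emeasure (distr P borel frac) X = emeasure (distr Q borel frac) X"
      using fm b by (simp add: emeasure_distr sp vimage_def)
  next
    show "(\<Union>i. {..real i}) = UNIV" using real_arch_simple by auto
    show "emeasure (distr P borel frac) {..real i} \<noteq> \<infinity>" for i
      using fm by (simp add: emeasure_distr)
  qed (auto simp: borel_eq_atMost)
  then have "measure (distr P borel frac) E = measure (distr Q borel frac) E" by simp
  then show ?thesis using fm E by (simp add: measure_distr sp vimage_def)
qed

section \<open>Vanishing transforms of complex measures along the multiples of a vector\<close>

lemma signed_measure_Re: "complex_borel_measure \<mu> \<Longrightarrow> signed_measure (\<lambda>A. Re (\<mu> A))"
  unfolding complex_borel_measure_def signed_measure_def by (auto intro: sums_Re)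

lemma signed_measure_Im: "complex_borel_measure \<mu> \<Longrightarrow> signed_measure (\<lambda>A. Im (\<mu> A))"
  unfolding complex_borel_measure_def signed_measure_def by (auto intro: sums_Im)

text \<open>Real and imaginary part of the measure can be separated because the vanishing condition is
  symmetric under \<open>k \<mapsto> -k\<close>, which conjugates the Fourier coefficients of a real measure.\<close>

lemma fourier_vanishing_imp_frac_null:
  fixes v :: "real \<times> real"
  assumes \<mu>: "complex_borel_measure \<mu>"
    and van: "\<And>k::int. fourier \<mu> (of_int k *\<^sub>R v) = 0"
    and E: "E \<in> sets borel"
  shows "\<mu> {x. frac (x \<bullet> v / 2) \<in> E} = 0"
proof -
  define X where "X x = x \<bullet> v / 2" for x :: "real \<times> real"
  have X: "X \<in> borel_measurable borel" unfolding X_def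
    by (intro borel_measurable_continuous_onI continuous_intros) auto
  have Xb: "{x. frac (X x) \<in> E} \<in> sets borel"
    using measurable_sets[OF measurable_compose[OF X borel_measurable_frac] E]
    by (simp add: vimage_def)
  define J where "J \<nu> k = (LINT x|jordan_pos \<nu>. cis (2 * pi * of_int k * X x))
     - (LINT x|jordan_pos (\<lambda>A. - \<nu> A). cis (2 * pi * of_int k * X x))" for \<nu> and k :: int
  have J0: "J (\<lambda>A. Re (\<mu> A)) k + \<i> * J (\<lambda>A. Im (\<mu> A)) k = 0" for k
  proof -
    \<comment> \<open>The transform carries \<open>pi\<close> where characters of period 1 carry
      \<open>2 * pi\<close>; the factor 1/2 in \<open>X\<close> absorbs the difference.\<close>
    have "exp (\<i> * of_real (pi * (x \<bullet> (of_int k *\<^sub>R v)))) = cis (2 * pi * of_int k * X x)" for x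
      unfolding cis_conv_exp by (rule arg_cong[of _ _ exp]) (simp add: X_def)
    then show ?thesis using van[of k] unfolding fourier_def cmeasure_integral_def J_def by simp
  qed
  have cnjJ: "J \<nu> (- k) = cnj (J \<nu> k)" for \<nu> k
  proof -
    have "cis (2 * pi * of_int (- k) * X x) = cnj (cis (2 * pi * of_int k * X x))" for x
      by (simp add: cis_cnj)
    then show ?thesis unfolding J_def by (simp only: Bochner_Integration.integral_cnj complex_cnj_diff)
  qed
  have zero: "J (\<lambda>A. Re (\<mu> A)) k = 0" "J (\<lambda>A. Im (\<mu> A)) k = 0" for k
  proof -
    let ?a = "J (\<lambda>A. Re (\<mu> A)) k" and ?b = "J (\<lambda>A. Im (\<mu> A)) k"
    have "cnj ?a + \<i> * cnj ?b = 0" using J0[of "- k"] by (simp add: cnjJ)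
    then have "cnj (cnj ?a + \<i> * cnj ?b) = 0" by simp
    then have "?a - \<i> * ?b = 0" by simp
    with J0[of k] show "?a = 0" "?b = 0" by (auto simp: complex_eq_iff)
  qed
  have "\<nu> {x. frac (X x) \<in> E} = 0" if \<nu>: "signed_measure \<nu>" and J: "\<And>k. J \<nu> k = 0" for \<nu>
  proof -
    \<comment> \<open>The vanishing of \<open>J \<nu> k\<close> says that the positive and the
      negative part, pushed forward by \<open>X\<close>, have equal coefficients; the comparison of
      two positive measures thus applies to them.\<close>
    let ?P = "jordan_pos \<nu>" and ?Q = "jordan_pos (\<lambda>A. - \<nu> A)"
    interpret P: finite_measure ?P by (rule jordan_pos_finite[OF \<nu>])
    interpret Q: finite_measure ?Q by (rule jordan_pos_finite[OF signed_measure_uminus[OF \<nu>]])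
    have XP: "X \<in> measurable ?P borel" "X \<in> measurable ?Q borel" using X by (simp_all cong: measurable_cong_sets)
    have m: "(\<lambda>x::real. cis (2 * pi * of_int k * x)) \<in> borel_measurable borel" for k :: int
      by (intro borel_measurable_continuous_onI continuous_intros)
    have "measure (distr ?P borel X) {x. frac x \<in> E} = measure (distr ?Q borel X) {x. frac x \<in> E}"
    proof (rule measure_frac_eq)
      show "(LINT x|distr ?P borel X. cis (2 * pi * of_int k * x)) =
          (LINT x|distr ?Q borel X. cis (2 * pi * of_int k * x))" for k
        using J[of k] XP m by (simp add: integral_distr J_def)
    qed (use E XP in \<open>auto intro: P.finite_measure_distr Q.finite_measure_distr\<close>)
    moreover have "{x::real. frac x \<in> E} \<in> sets borel"
      using measurable_sets[OF borel_measurable_frac E] by (simp add: vimage_def)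
    ultimately have "measure ?P {x. frac (X x) \<in> E} = measure ?Q {x. frac (X x) \<in> E}"
      using XP by (simp add: measure_distr vimage_def)
    then show ?thesis using jordan_decomposition[OF \<nu> Xb] by simp
  qed
  from this[OF signed_measure_Re[OF \<mu>] zero(1)] this[OF signed_measure_Im[OF \<mu>] zero(2)]
  show ?thesis unfolding X_def by (simp add: complex_eq_iff)
qed

section \<open>Escape of the Gauss-type map for small parameters\<close>

lemma frac_vimage_borel: "E \<in> sets borel \<Longrightarrow> {x::real. frac x \<in> E} \<in> sets borel"
  using measurable_sets[OF borel_measurable_frac] by (simp add: vimage_def)

lemma divide_vimage_borel:
  fixes c :: real
  assumes "E \<in> sets borel"
  shows "{x. c / x \<in> E} \<in> sets borel"
proof -
  have "(\<lambda>x. c / x) \<in> borel_measurable borel" by measurable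
  from measurable_sets[OF this assms] show ?thesis by (simp add: vimage_def)
qed

lemma scale_vimage_borel:
  fixes a :: real
  assumes "E \<in> sets borel"
  shows "{x. a * x \<in> E} \<in> sets borel"
proof -
  have "(\<lambda>x. a * x) \<in> borel_measurable borel" by measurable
  from measurable_sets[OF this assms] show ?thesis by (simp add: vimage_def)
qed

text \<open>Branches are numbered from 0, so branch \<open>j\<close> has integer part
  \<open>j + 1\<close>. Since \<open>E\<close> avoids the endpoints, membership determines the
  floor.\<close>

lemma frac_in_unit_iff:
  fixes y :: real
  assumes "E \<subseteq> {0<..<1}"
  shows "1 \<le> y \<and> frac y \<in> E \<longleftrightarrow> (\<exists>j::nat. y - (real j + 1) \<in> E)"
proof
  assume *: "1 \<le> y \<and> frac y \<in> E"
  then have "1 \<le> \<lfloor>y\<rfloor>" by simp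
  then have "real (nat (\<lfloor>y\<rfloor> - 1)) + 1 = of_int \<lfloor>y\<rfloor>" by simp
  then show "\<exists>j::nat. y - (real j + 1) \<in> E"
    using * by (intro exI[of _ "nat (\<lfloor>y\<rfloor> - 1)"]) (simp add: frac_def)
next
  assume "\<exists>j::nat. y - (real j + 1) \<in> E"
  then obtain j :: nat where j: "y - (real j + 1) \<in> E" by blast
  then have b: "0 < y - (real j + 1)" "y - (real j + 1) < 1" using assms by auto
  then have "\<lfloor>y\<rfloor> = int j + 1" by (intro floor_unique) auto
  then show "1 \<le> y \<and> frac y \<in> E" using j b by (simp add: frac_def)
qed

section \<open>Inverse branches of the Gauss-type map and the weight
  \<open>1 / (1 + x)\<close>\<close>

lemma gauss_branch_borel:
  fixes a c :: real
  assumes "E \<in> sets borel"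
  shows "{x. 0 < x \<and> c / x - a \<in> E} \<in> sets borel"
proof -
  have "(\<lambda>x. c / x - a) \<in> borel_measurable borel" by measurable
  from measurable_sets[OF this assms] have "{0<..} \<inter> {x. c / x - a \<in> E} \<in> sets borel"
    by (intro sets.Int) (auto simp: vimage_def)
  moreover have "{0<..} \<inter> {x. c / x - a \<in> E} = {x. 0 < x \<and> c / x - a \<in> E}" by auto
  ultimately show ?thesis by simp
qed

text \<open>The weight on the right is \<open>1 / (1 + x)\<close> evaluated on the inverse branch
  \<open>c / (t + j + 1)\<close>, multiplied by the Jacobian
  \<open>c / (t + j + 1)^2\<close>.\<close>

lemma nn_integral_gauss_branch:
  fixes c :: real
  assumes "0 < c" and E: "E \<in> sets borel" "E \<subseteq> {0<..<1}"
  shows "(\<integral>\<^sup>+x. ennreal (1 / (1 + x)) * indicator {x. 0 < x \<and> c / x - (real j + 1) \<in> E} x \<partial>lborel) =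
     (\<integral>\<^sup>+x. ennreal (c / ((x + real j + 1) * (x + real j + 1 + c))) * indicator E x \<partial>lborel)"
proof -
  define A where "A = {x. 0 < x \<and> c / x - (real j + 1) \<in> E}"
  define f where "f x = ennreal (1 / (1 + x)) * indicator A x" for x
  \<comment> \<open>The inverse branch is decreasing, so it is reflected to \<open>[-1, 0]\<close>,
    where it has the nonnegative derivative that the substitution rule expects; the sign is undone
    afterwards.\<close>
  define g where "g t = c / (real j + 1 - t)" for t
  define g' where "g' t = c / (real j + 1 - t)\<^sup>2" for t
  have A: "A \<in> sets borel" unfolding A_def by (rule gauss_branch_borel[OF E(1)])
  have f: "f \<in> borel_measurable borel" unfolding f_def using A by measurable
  have "(\<integral>\<^sup>+x. f x \<partial>lborel) = (\<integral>\<^sup>+x. f x * indicator {g (-1)..g 0} x \<partial>lborel)"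
  proof (rule nn_integral_cong)
    fix x
    have "x \<in> {g (-1)..g 0}" if "x \<in> A"
    proof -
      have "0 < x" "real j + 1 < c / x" "c / x < real j + 2" using that E(2) by (auto simp: A_def)
      then have "(real j + 1) * x < c" "c < (real j + 2) * x" by (simp_all add: field_simps)
      then show ?thesis by (auto simp: g_def field_simps)
    qed
    then show "f x = f x * indicator {g (-1)..g 0} x" by (auto simp: f_def indicator_def)
  qed
  also have "\<dots> = (\<integral>\<^sup>+x. f (g x) * g' x * indicator {-1..0} x \<partial>lborel)"
  proof (rule nn_integral_substitution_aux[OF f])
    show "(g has_real_derivative g' x) (at x)" if "x \<in> {-1..0}" for x
      unfolding g_def g'_def using that
      by (auto intro!: derivative_eq_intros simp: power2_eq_square field_simps)
    show "continuous_on {-1..0} g'" unfolding g'_def by (intro continuous_intros) auto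
    show "0 \<le> g' x" for x unfolding g'_def using \<open>0 < c\<close> by simp
  qed auto
  also have "\<dots> = (\<integral>\<^sup>+x. f (g (- x)) * g' (- x) * indicator {-1..0} (- x) \<partial>lborel)"
  proof -
    have "(\<lambda>x. f (g x) * g' x * indicator {-1..0} x) \<in> borel_measurable borel"
      unfolding g_def g'_def using f by measurable
    from nn_integral_real_affine[OF this, of "-1" 0] show ?thesis by simp
  qed
  also have "\<dots> = (\<integral>\<^sup>+x. ennreal (c / ((x + real j + 1) * (x + real j + 1 + c))) * indicator E x \<partial>lborel)"
  proof (rule nn_integral_cong)
    fix x :: real
    show "f (g (- x)) * g' (- x) * indicator {-1..0} (- x) =
      ennreal (c / ((x + real j + 1) * (x + real j + 1 + c))) * indicator E x"
    proof (cases "0 \<le> x \<and> x \<le> 1")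
      case True
      then have p: "0 < g (- x)" using \<open>0 < c\<close> by (simp add: g_def)
      have "c / g (- x) = real j + 1 + x" using \<open>0 < c\<close> by (simp add: g_def)
      then have "g (- x) \<in> A \<longleftrightarrow> x \<in> E" using p by (simp add: A_def)
      moreover have "1 / (1 + g (- x)) * g' (- x) = c / ((x + real j + 1) * (x + real j + 1 + c))"
      proof -
        define y where "y = x + real j + 1"
        have "0 < y" using True by (simp add: y_def)
        moreover have "g (- x) = c / y" "g' (- x) = c / y\<^sup>2" by (simp_all add: g_def g'_def y_def add_ac)
        moreover have "1 / (1 + c / y) * (c / y\<^sup>2) = c / (y * (y + c))"
          using \<open>0 < y\<close> \<open>0 < c\<close> by (simp add: field_simps power2_eq_square)
        ultimately show ?thesis by (simp add: y_def)
      qed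
      moreover have "0 \<le> g' (- x)" using \<open>0 < c\<close> by (simp add: g'_def)
      ultimately show ?thesis
        using True p by (auto simp: f_def indicator_def ennreal_mult'[symmetric])
    next
      case False
      then have "x \<notin> E" "- x \<notin> {-1..0}" using E(2) by auto
      then show ?thesis by simp
    qed
  qed
  finally show ?thesis by (simp add: f_def A_def)
qed

text \<open>The branches are disjoint, so their contributions add up to the transfer operator
  applied to \<open>1 / (1 + x)\<close>. The restriction \<open>x \<le> c\<close> leaves out exactly
  the branch with integer part 0.\<close>

lemma nn_integral_gauss_preimage:
  fixes c :: real
  assumes "0 < c" and E: "E \<in> sets borel" "E \<subseteq> {0<..<1}"
  shows "(\<integral>\<^sup>+x. ennreal (1 / (1 + x)) * indicator {x. 0 < x \<and> x \<le> c \<and> frac (c / x) \<in> E} x \<partial>lborel) =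
     (\<integral>\<^sup>+x. (\<Sum>j. ennreal (c / ((x + real j + 1) * (x + real j + 1 + c)))) * indicator E x \<partial>lborel)"
proof -
  define A where "A j = {x. 0 < x \<and> c / x - (real j + 1) \<in> E}" for j
  have A: "A j \<in> sets borel" for j unfolding A_def by (rule gauss_branch_borel[OF E(1)])
  have un: "{x. 0 < x \<and> x \<le> c \<and> frac (c / x) \<in> E} = (\<Union>j. A j)"
  proof -
    have "0 < x \<and> x \<le> c \<and> frac (c / x) \<in> E \<longleftrightarrow> x \<in> (\<Union>j. A j)" for x
    proof (cases "0 < x")
      case True
      then have "x \<le> c \<longleftrightarrow> 1 \<le> c / x" by (simp add: field_simps)
      then show ?thesis using True frac_in_unit_iff[OF E(2), of "c / x"] by (simp add: A_def)
    qed (auto simp: A_def)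
    then show ?thesis by blast
  qed
  have disj: "disjoint_family A"
    unfolding disjoint_family_on_def
  proof (intro ballI impI)
    fix i j :: nat assume "i \<noteq> j"
    show "A i \<inter> A j = {}"
    proof (rule ccontr)
      assume "A i \<inter> A j \<noteq> {}"
      then obtain x where "c / x - (real i + 1) \<in> E" "c / x - (real j + 1) \<in> E" by (auto simp: A_def)
      then have "0 < c / x - (real i + 1)" "c / x - (real i + 1) < 1"
        "0 < c / x - (real j + 1)" "c / x - (real j + 1) < 1" using E(2) by auto
      then have "real i < real j + 1" "real j < real i + 1" by linarith+
      then show False using \<open>i \<noteq> j\<close> by linarith
    qed
  qed
  define L where "L = density lborel (\<lambda>x. ennreal (1 / (1 + x)))"
  have L: "emeasure L B = (\<integral>\<^sup>+x. ennreal (1 / (1 + x)) * indicator B x \<partial>lborel)" if "B \<in> sets borel" for B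
    unfolding L_def using that by (intro emeasure_density) auto
  have "emeasure L (\<Union>j. A j) = (\<Sum>j. emeasure L (A j))"
    using A disj by (intro suminf_emeasure[symmetric]) (auto simp: L_def)
  also have "\<dots> = (\<Sum>j. \<integral>\<^sup>+x. ennreal (c / ((x + real j + 1) * (x + real j + 1 + c))) * indicator E x \<partial>lborel)"
    unfolding L[OF A] unfolding A_def nn_integral_gauss_branch[OF assms] ..
  also have "\<dots> = (\<integral>\<^sup>+x. (\<Sum>j. ennreal (c / ((x + real j + 1) * (x + real j + 1 + c))) * indicator E x) \<partial>lborel)"
    using E by (intro nn_integral_suminf[symmetric]) auto
  finally show ?thesis using L[of "\<Union>j. A j"] A by (simp add: un)
qed

text \<open>For \<open>c = 1\<close> this sum is the invariance of the Gauss density; for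
  \<open>c < 1\<close> it serves as the comparison series. The terms are differences of consecutive
  reciprocals.\<close>

lemma sums_telescope_reciprocal:
  fixes x :: real
  assumes "0 < x"
  shows "(\<lambda>j. 1 / ((x + real j + 1) * (x + real j + 2))) sums (1 / (1 + x))"
proof -
  have "(\<lambda>n. 1 / (x + 1 + real n)) \<longlonglongrightarrow> 0" by real_asymp
  from telescope_sums'[OF this]
  have "(\<lambda>n. 1 / (x + 1 + real n) - 1 / (x + 1 + real (Suc n))) sums (1 / (x + 1))" by simp
  moreover have "1 / (x + 1 + real n) - 1 / (x + 1 + real (Suc n)) = 1 / ((x + real n + 1) * (x + real n + 2))" for n
    using assms by (simp add: divide_simps) (simp add: algebra_simps)
  ultimately show ?thesis by (simp add: add_ac)
qed

text \<open>With \<open>y = x + j + 1 > 1\<close>, the quotient \<open>(y + 1) / (y + c)\<close>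
  decreases in \<open>y\<close> and equals \<open>2 / (1 + c)\<close> at \<open>y = 1\<close>; this
  is the origin of the contraction factor. Each term is compared with its counterpart for
  \<open>c = 1\<close>, whose sum telescopes.\<close>

lemma gauss_weight_contraction:
  fixes c x :: real
  assumes "0 < c" "c < 1" "0 < x"
  shows "(\<Sum>j. ennreal (c / ((x + real j + 1) * (x + real j + 1 + c)))) \<le> ennreal (2 * c / (1 + c) * (1 / (1 + x)))"
proof -
  have "c / ((x + real j + 1) * (x + real j + 1 + c)) \<le> 2 * c / (1 + c) * (1 / ((x + real j + 1) * (x + real j + 2)))" for j
  proof -
    define y where "y = x + real j + 1"
    have "1 < y" using assms by (simp add: y_def)
    have "1 * (1 - c) \<le> y * (1 - c)" using \<open>1 < y\<close> assms by (intro mult_right_mono) auto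
    then have "(1 + c) * (y + 1) \<le> 2 * (y + c)" by (simp add: algebra_simps)
    then have "1 / (y + c) \<le> 2 / (1 + c) * (1 / (y + 1))"
      using \<open>1 < y\<close> assms by (simp add: divide_simps)
    then have "c / y * (1 / (y + c)) \<le> c / y * (2 / (1 + c) * (1 / (y + 1)))"
      using \<open>1 < y\<close> assms by (intro mult_left_mono) auto
    then show ?thesis by (simp add: y_def mult_ac add_ac)
  qed
  then have "(\<Sum>j. ennreal (c / ((x + real j + 1) * (x + real j + 1 + c)))) \<le>
      (\<Sum>j. ennreal (2 * c / (1 + c) * (1 / ((x + real j + 1) * (x + real j + 2)))))"
    by (intro suminf_le ennreal_leI) auto
  also have "\<dots> = ennreal (2 * c / (1 + c) * (1 / (1 + x)))"
    using assms by (intro suminf_ennreal_eq sums_mult sums_telescope_reciprocal) auto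
  finally show ?thesis .
qed

text \<open>A point with integral \<open>c / x\<close> is dropped as well, because its image 0 lies
  in no survivor set.\<close>

primrec survivors :: "real \<Rightarrow> nat \<Rightarrow> real set" where
  "survivors c 0 = {0<..<1}"
| "survivors c (Suc n) = {x. 0 < x \<and> x \<le> c \<and> frac (c / x) \<in> survivors c n}"

lemma survivors_borel: "survivors c n \<in> sets borel"
proof (induction n)
  case (Suc n)
  have "survivors c (Suc n) = {0<..c} \<inter> {x. c / x \<in> {y. frac y \<in> survivors c n}}" by auto
  then show ?case using divide_vimage_borel[OF frac_vimage_borel[OF Suc], of c]
    by simp
qed simp

lemma survivors_Suc_subset:
  assumes "0 < c" "c < 1"
  shows "survivors c (Suc n) \<subseteq> survivors c n"
proof (induction n)
  case (Suc n)
  then show ?case by auto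
qed (use assms in auto)

lemma survivors_subset:
  assumes "0 < c" "c < 1"
  shows "survivors c n \<subseteq> {0<..<1}"
  by (induction n) (use survivors_Suc_subset[OF assms] in auto)

lemma survivors_Inter_null:
  assumes c: "0 < c" "c < 1"
  shows "emeasure lborel (\<Inter>n. survivors c n) = 0"
proof -
  define r where "r = 2 * c / (1 + c)"
  have r: "0 \<le> r" "r < 1" using c by (auto simp: r_def field_simps)
  define L where "L n = (\<integral>\<^sup>+x. ennreal (1 / (1 + x)) * indicator (survivors c n) x \<partial>lborel)" for n
  have Suc: "L (Suc n) \<le> ennreal r * L n" for n
  proof -
    have "L (Suc n) = (\<integral>\<^sup>+x. (\<Sum>j. ennreal (c / ((x + real j + 1) * (x + real j + 1 + c)))) * indicator (survivors c n) x \<partial>lborel)"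
      unfolding L_def survivors.simps(2)
      by (rule nn_integral_gauss_preimage[OF c(1) survivors_borel survivors_subset[OF c]])
    also have "\<dots> \<le> (\<integral>\<^sup>+x. ennreal r * (ennreal (1 / (1 + x)) * indicator (survivors c n) x) \<partial>lborel)"
    proof (rule nn_integral_mono)
      fix x
      show "(\<Sum>j. ennreal (c / ((x + real j + 1) * (x + real j + 1 + c)))) * indicator (survivors c n) x \<le>
        ennreal r * (ennreal (1 / (1 + x)) * indicator (survivors c n) x)"
      proof (cases "x \<in> survivors c n")
        case True
        then have "0 < x" using survivors_subset[OF c] by force
        then have "(\<Sum>j. ennreal (c / ((x + real j + 1) * (x + real j + 1 + c)))) \<le> ennreal r * ennreal (1 / (1 + x))"
          using gauss_weight_contraction[OF c \<open>0 < x\<close>] r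
          by (subst ennreal_mult'[symmetric]) (auto simp: r_def)
        with True show ?thesis by simp
      qed simp
    qed
    also have "\<dots> = ennreal r * L n"
      unfolding L_def using survivors_borel by (intro nn_integral_cmult) auto
    finally show ?thesis .
  qed
  have Ln: "L n \<le> ennreal (r ^ n)" for n
  proof (induction n)
    case 0
    have "L 0 \<le> (\<integral>\<^sup>+x. indicator {0<..<1::real} x \<partial>lborel)"
      unfolding L_def by (intro nn_integral_mono) (auto simp: indicator_def)
    then show ?case by simp
  next
    case (Suc n)
    have "L (Suc n) \<le> ennreal r * ennreal (r ^ n)"
      using order_trans[OF \<open>L (Suc n) \<le> ennreal r * L n\<close> mult_left_mono[OF Suc]] by simp
    then show ?case using r by (simp add: ennreal_mult'[symmetric])
  qed
  \<comment> \<open>On \<open>(0, 1)\<close> the weight is at least 1/2, hence the factor 2 in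
    passing back to Lebesgue measure.\<close>
  have "emeasure lborel (\<Inter>n. survivors c n) \<le> ennreal (2 * r ^ n)" for n
  proof -
    have "emeasure lborel (\<Inter>n. survivors c n) \<le> emeasure lborel (survivors c n)"
      using survivors_borel by (intro emeasure_mono) auto
    also have "\<dots> = (\<integral>\<^sup>+x. indicator (survivors c n) x \<partial>lborel)" using survivors_borel by simp
    also have "\<dots> \<le> (\<integral>\<^sup>+x. ennreal 2 * (ennreal (1 / (1 + x)) * indicator (survivors c n) x) \<partial>lborel)"
    proof (rule nn_integral_mono)
      fix x
      show "indicator (survivors c n) x \<le> ennreal 2 * (ennreal (1 / (1 + x)) * indicator (survivors c n) x)"
      proof (cases "x \<in> survivors c n")
        case True
        then have "0 < x" "x < 1" using survivors_subset[OF c, of n] by auto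
        then have "1 \<le> ennreal 2 * ennreal (1 / (1 + x))"
          by (subst ennreal_mult'[symmetric]) (auto simp: field_simps)
        with True show ?thesis by simp
      qed simp
    qed
    also have "\<dots> = ennreal 2 * L n"
      unfolding L_def using survivors_borel by (intro nn_integral_cmult) auto
    also have "\<dots> \<le> ennreal 2 * ennreal (r ^ n)" by (intro mult_left_mono Ln) simp
    finally show ?thesis using r by (simp add: ennreal_mult')
  qed
  moreover have "(\<lambda>n. ennreal (2 * r ^ n)) \<longlonglongrightarrow> ennreal (2 * 0)"
    using r by (intro tendsto_ennrealI tendsto_mult tendsto_const LIMSEQ_power_zero) auto
  ultimately have "emeasure lborel (\<Inter>n. survivors c n) \<le> ennreal (2 * 0)"
    by (intro LIMSEQ_le_const) blast+
  then show ?thesis by simp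
qed


section \<open>Total variation, kept real-valued so that it is again a signed measure\<close>

definition hahn_variation :: "('a::topological_space set \<Rightarrow> real) \<Rightarrow> 'a set \<Rightarrow> 'a set \<Rightarrow> real" where
  "hahn_variation \<nu> H A = \<nu> (A \<inter> H) - \<nu> (A - H)"

context
  fixes \<nu> :: "'a::topological_space set \<Rightarrow> real" and H
  assumes \<nu>: "signed_measure \<nu>" and H: "positive_set \<nu> H" "positive_set (\<lambda>A. - \<nu> A) (- H)"
begin

lemma hahn_set_borel: "H \<in> sets borel"
  using H positive_set_borel by blast

lemma signed_measure_hahn_variation: "signed_measure (hahn_variation \<nu> H)"
  unfolding signed_measure_def hahn_variation_def
proof (intro allI impI)
  fix A :: "nat \<Rightarrow> 'a set" assume A: "range A \<subseteq> sets borel" "disjoint_family A"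
  have "disjoint_family (\<lambda>n. A n \<inter> H)" "disjoint_family (\<lambda>n. A n - H)"
    using A(2) unfolding disjoint_family_on_def by blast+
  then have "(\<lambda>n. \<nu> (A n \<inter> H) - \<nu> (A n - H)) sums (\<nu> (\<Union>n. A n \<inter> H) - \<nu> (\<Union>n. A n - H))"
    using A(1) hahn_set_borel by (intro sums_diff signed_measureD[OF \<nu>]) auto
  moreover have "(\<Union>n. A n \<inter> H) = (\<Union>n. A n) \<inter> H" "(\<Union>n. A n - H) = (\<Union>n. A n) - H" by auto
  ultimately show "(\<lambda>n. \<nu> (A n \<inter> H) - \<nu> (A n - H)) sums (\<nu> ((\<Union>n. A n) \<inter> H) - \<nu> ((\<Union>n. A n) - H))"
    by simp
qed

lemma hahn_variation_nonneg: "A \<in> sets borel \<Longrightarrow> 0 \<le> hahn_variation \<nu> H A"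
  using positive_setD[OF H(1), of "A \<inter> H"] positive_setD[OF H(2), of "A - H"] hahn_set_borel
  by (force simp: hahn_variation_def)

lemma hahn_variation_mono:
  assumes "A \<in> sets borel" "B \<in> sets borel" "A \<subseteq> B"
  shows "hahn_variation \<nu> H A \<le> hahn_variation \<nu> H B"
  using signed_measure_split[OF signed_measure_hahn_variation, of B A] hahn_variation_nonneg[of "B - A"] assms
  by (simp add: inf.absorb2)

lemma abs_le_hahn_variation:
  assumes A: "A \<in> sets borel"
  shows "\<bar>\<nu> A\<bar> \<le> hahn_variation \<nu> H A"
proof -
  have "0 \<le> \<nu> (A \<inter> H)" using A hahn_set_borel by (intro positive_setD[OF H(1)]) auto
  moreover have "0 \<le> - \<nu> (A - H)" using A hahn_set_borel by (intro positive_setD[OF H(2)]) auto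
  ultimately show ?thesis
    using signed_measure_split[OF \<nu> A hahn_set_borel] by (simp add: hahn_variation_def)
qed

lemma hahn_variation_eq_0:
  assumes "\<And>B. B \<in> sets borel \<Longrightarrow> B \<subseteq> A \<Longrightarrow> \<nu> B = 0" "A \<in> sets borel"
  shows "hahn_variation \<nu> H A = 0"
  using assms hahn_set_borel unfolding hahn_variation_def by simp

end

text \<open>On \<open>(0, 1)\<close> the signed measure is minus the sum of its translates, so its variation there is
  bounded by the variation of the part living on \<open>[1, \<infinity>)\<close>.\<close>

lemma hahn_variation_unit_interval_le:
  fixes \<nu> :: "real set \<Rightarrow> real"
  assumes \<nu>: "signed_measure \<nu>" and H: "positive_set \<nu> H" "positive_set (\<lambda>A. - \<nu> A) (- H)"
    and pos: "\<And>A. A \<in> sets borel \<Longrightarrow> A \<inter> {0<..} = {} \<Longrightarrow> \<nu> A = 0"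
    and per: "\<And>E. E \<in> sets borel \<Longrightarrow> \<nu> {x. frac x \<in> E} = 0"
    and E: "E \<in> sets borel" "E \<subseteq> {0<..<1}"
  shows "hahn_variation \<nu> H E \<le> hahn_variation \<nu> H {x. 1 \<le> x \<and> frac x \<in> E}"
proof -
  let ?m = "hahn_variation \<nu> H"
  have tail: "{x. 1 \<le> x \<and> frac x \<in> F} \<in> sets borel" if "F \<in> sets borel" for F :: "real set"
  proof -
    have "{1..} \<inter> {x. frac x \<in> F} \<in> sets borel" using frac_vimage_borel[OF that] by (intro sets.Int) auto
    moreover have "{1..} \<inter> {x. frac x \<in> F} = {x. 1 \<le> x \<and> frac x \<in> F}" by auto
    ultimately show ?thesis by simp
  qed
  have le: "\<bar>\<nu> F\<bar> \<le> ?m {x. 1 \<le> x \<and> frac x \<in> F}" if F: "F \<in> sets borel" "F \<subseteq> {0<..<1}" for F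
  proof -
    let ?T = "{x. 1 \<le> x \<and> frac x \<in> F}" and ?U = "{x::real. frac x \<in> F}"
    have fr: "frac x = x" if "x \<in> F" for x using that F(2) by (intro frac_eq[THEN iffD2]) auto
    have "0 = \<nu> (?U \<inter> {0<..}) + \<nu> (?U - {0<..})"
      using per[OF F(1)] signed_measure_split[OF \<nu> frac_vimage_borel[OF F(1)], of "{0<..}"] by simp
    moreover have "\<nu> (?U - {0<..}) = 0" using frac_vimage_borel[OF F(1)] by (intro pos) auto
    moreover have "?U \<inter> {0<..} = F \<union> ?T"
    proof (intro equalityI subsetI)
      fix x assume x: "x \<in> ?U \<inter> {0<..}"
      show "x \<in> F \<union> ?T"
      proof (cases "1 \<le> x")
        case False
        then have "frac x = x" using x by (intro frac_eq[THEN iffD2]) auto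
        then show ?thesis using x by auto
      qed (use x in auto)
    qed (use F(2) fr in force)
    moreover have "\<nu> (F \<union> ?T) = \<nu> F + \<nu> ?T"
      using F tail[OF F(1)] by (intro signed_measure_Un[OF \<nu>]) auto
    ultimately have "\<nu> F = - \<nu> ?T" by simp
    then show ?thesis using abs_le_hahn_variation[OF \<nu> H tail[OF F(1)]] by simp
  qed
  have HB: "H \<in> sets borel" using H positive_set_borel by blast
  \<comment> \<open>On \<open>E \<inter> H\<close> and on \<open>E - H\<close> the variation is an
    absolute value of \<open>\<nu>\<close>, so the bound for single sets adds up without
    loss.\<close>
  have "?m E \<le> \<bar>\<nu> (E \<inter> H)\<bar> + \<bar>\<nu> (E - H)\<bar>" by (simp add: hahn_variation_def)
  also have "\<dots> \<le> ?m {x. 1 \<le> x \<and> frac x \<in> E \<inter> H} + ?m {x. 1 \<le> x \<and> frac x \<in> E - H}"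
    using E HB by (intro add_mono le) auto
  also have "\<dots> = ?m ({x. 1 \<le> x \<and> frac x \<in> E \<inter> H} \<union> {x. 1 \<le> x \<and> frac x \<in> E - H})"
    using E HB by (intro signed_measure_Un[symmetric] signed_measure_hahn_variation[OF \<nu> H] tail) auto
  also have "{x. 1 \<le> x \<and> frac x \<in> E \<inter> H} \<union> {x. 1 \<le> x \<and> frac x \<in> E - H} = {x. 1 \<le> x \<and> frac x \<in> E}"
    by auto
  finally show ?thesis .
qed

section \<open>Null sets under inversion and scaling\<close>

lemma null_set_differentiable_image:
  fixes g :: "real \<Rightarrow> real"
  assumes N: "N \<in> sets borel" "emeasure lborel N = 0" and g: "g differentiable_on N"
    and S: "S \<in> sets borel" "S \<subseteq> g ` N"
  shows "emeasure lborel S = 0"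
proof -
  have "N \<in> null_sets lebesgue" using N by (intro null_sets_completionI) auto
  then have "negligible N" by (simp add: negligible_iff_null_sets)
  then have "negligible (g ` N)" using g by (intro negligible_differentiable_image_negligible) auto
  then have "S \<in> null_sets lebesgue" using negligible_subset[OF _ S(2)] negligible_iff_null_sets by blast
  then show ?thesis using S(1) by (simp add: null_sets_def emeasure_completion)
qed

lemma null_set_divide:
  fixes c :: real
  assumes "c \<noteq> 0" and N: "N \<in> sets borel" "emeasure lborel N = 0"
  shows "emeasure lborel {x. 0 < x \<and> c / x \<in> N} = 0"
proof (rule null_set_differentiable_image)
  show "emeasure lborel (N - {0}) = 0"
    using N emeasure_mono[of "N - {0}" N lborel] by auto
  show "(\<lambda>y. c / y) differentiable_on (N - {0})"
    unfolding differentiable_on_def by (intro ballI differentiable_divide) auto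
  show "{x. 0 < x \<and> c / x \<in> N} \<subseteq> (\<lambda>y. c / y) ` (N - {0})"
  proof
    fix x assume x: "x \<in> {x. 0 < x \<and> c / x \<in> N}"
    then show "x \<in> (\<lambda>y. c / y) ` (N - {0})"
      using \<open>c \<noteq> 0\<close> by (intro image_eqI[of _ _ "c / x"]) auto
  qed
  show "{x. 0 < x \<and> c / x \<in> N} \<in> sets borel" using gauss_branch_borel[OF N(1), of c 0] by simp
qed (use N in auto)

lemma null_set_scale:
  fixes a :: real
  assumes "a \<noteq> 0" and N: "N \<in> sets borel" "emeasure lborel N = 0"
  shows "emeasure lborel {x. a * x \<in> N} = 0"
proof (rule null_set_differentiable_image[OF N])
  show "(\<lambda>y. y / a) differentiable_on N"
    unfolding differentiable_on_def using \<open>a \<noteq> 0\<close> by (intro ballI differentiable_divide) auto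
  show "{x. a * x \<in> N} \<subseteq> (\<lambda>y. y / a) ` N"
  proof
    fix x assume "x \<in> {x. a * x \<in> N}"
    then show "x \<in> (\<lambda>y. y / a) ` N" using \<open>a \<noteq> 0\<close> by (intro image_eqI[of _ _ "a * x"]) auto
  qed
  show "{x. a * x \<in> N} \<in> sets borel" by (rule scale_vimage_borel[OF N(1)])
qed

text \<open>Let \<open>m\<close> and \<open>m'\<close> be the variation in the coordinates
  \<open>x\<close> and \<open>c / x\<close>. Each periodicity moves the variation of a survivor set
  in one coordinate to the next survivor set in the other, so it is the sum \<open>m + m'\<close>
  that can be iterated. Its limit lives on a null set; hence \<open>\<nu>\<close> vanishes where
  \<open>x < 1\<close> or \<open>c / x < 1\<close>, and for \<open>c < 1\<close> this is the whole
  half-line.\<close>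

lemma hyperbola_branch_uniqueness:
  fixes \<nu> :: "real set \<Rightarrow> real" and c :: real
  assumes c: "0 < c" "c < 1" and \<nu>: "signed_measure \<nu>"
    and pos: "\<And>A. A \<in> sets borel \<Longrightarrow> A \<inter> {0<..} = {} \<Longrightarrow> \<nu> A = 0"
    and ac: "\<And>A. A \<in> sets borel \<Longrightarrow> emeasure lborel A = 0 \<Longrightarrow> \<nu> A = 0"
    and per1: "\<And>E. E \<in> sets borel \<Longrightarrow> \<nu> {x. frac x \<in> E} = 0"
    and per2: "\<And>E. E \<in> sets borel \<Longrightarrow> \<nu> {x. frac (c / x) \<in> E} = 0"
    and A: "A \<in> sets borel"
  shows "\<nu> A = 0"
proof -
  obtain H where H: "positive_set \<nu> H" "positive_set (\<lambda>A. - \<nu> A) (- H)"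
    using Hahn_decomposition[OF \<nu>] .
  define \<nu>' where "\<nu>' A = \<nu> {x. c / x \<in> A}" for A
  define H' where "H' = {x. c / x \<in> H}"
  have inv: "c / (c / x) = x" for x using c by simp
  have \<nu>': "signed_measure \<nu>'"
    unfolding signed_measure_def \<nu>'_def
  proof (intro allI impI)
    fix A :: "nat \<Rightarrow> real set" assume A: "range A \<subseteq> sets borel" "disjoint_family A"
    have "disjoint_family (\<lambda>n. {x. c / x \<in> A n})" using A(2) unfolding disjoint_family_on_def by blast
    moreover have "{x. c / x \<in> A n} \<in> sets borel" for n using A(1) by (intro divide_vimage_borel) auto
    ultimately have "(\<lambda>n. \<nu> {x. c / x \<in> A n}) sums \<nu> (\<Union>n. {x. c / x \<in> A n})"
      by (intro signed_measureD[OF \<nu>])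
    moreover have "(\<Union>n. {x. c / x \<in> A n}) = {x. c / x \<in> (\<Union>n. A n)}" by auto
    ultimately show "(\<lambda>n. \<nu> {x. c / x \<in> A n}) sums \<nu> {x. c / x \<in> (\<Union>n. A n)}" by simp
  qed
  have pos_set: "positive_set (\<lambda>A. \<kappa> {x. c / x \<in> A}) {x. c / x \<in> P}" if "positive_set \<kappa> P" for \<kappa> P
    unfolding positive_set_def
  proof (intro conjI ballI impI)
    show "{x. c / x \<in> P} \<in> sets borel" using that by (intro divide_vimage_borel positive_set_borel)
    fix B assume B: "B \<in> sets borel" "B \<subseteq> {x. c / x \<in> P}"
    then have "{x. c / x \<in> B} \<subseteq> P" using inv by force
    then show "0 \<le> \<kappa> {x. c / x \<in> B}" using B by (intro positive_setD[OF that] divide_vimage_borel)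
  qed
  have H': "positive_set \<nu>' H'" "positive_set (\<lambda>A. - \<nu>' A) (- H')"
  proof -
    show "positive_set \<nu>' H'" using pos_set[OF H(1)] by (simp add: \<nu>'_def[abs_def] H'_def)
    have "- H' = {x. c / x \<in> - H}" by (auto simp: H'_def)
    then show "positive_set (\<lambda>A. - \<nu>' A) (- H')" using pos_set[OF H(2)] by (simp add: \<nu>'_def[abs_def])
  qed
  define m where "m = hahn_variation \<nu> H"
  define m' where "m' = hahn_variation \<nu>' H'"
  have m': "m' A = m {x. c / x \<in> A}" for A
  proof -
    have "{x. c / x \<in> A \<inter> H'} = {x. c / x \<in> A} \<inter> H" "{x. c / x \<in> A - H'} = {x. c / x \<in> A} - H"
      using c by (auto simp: H'_def inv)
    then show ?thesis by (simp add: m_def m'_def hahn_variation_def \<nu>'_def)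
  qed
  have m: "m A = m' {x. c / x \<in> A}" for A unfolding m' mem_Collect_eq inv by simp
  have pos': "\<nu>' A = 0" if "A \<in> sets borel" "A \<inter> {0<..} = {}" for A
    unfolding \<nu>'_def
  proof (rule pos)
    show "{x. c / x \<in> A} \<inter> {0<..} = {}" using that(2) c by (force simp: disjoint_iff)
  qed (use that divide_vimage_borel in blast)
  have per1': "\<nu>' {x. frac x \<in> E} = 0" if "E \<in> sets borel" for E using per2[OF that] by (simp add: \<nu>'_def)
  let ?S = "survivors c"
  \<comment> \<open>Being at least 1 in one coordinate means lying in \<open>(0, c]\<close> in the
    other; this turns the tail into one more survival step.\<close>
  have tail: "{x. c / x \<in> {y. 1 \<le> y \<and> frac y \<in> ?S n}} = ?S (Suc n)" for n
  proof -
    have "1 \<le> c / x \<longleftrightarrow> 0 < x \<and> x \<le> c" for x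
    proof (cases "0 < x")
      case False
      then have "c / x \<le> 0" using c by (intro divide_nonneg_nonpos) auto
      with False show ?thesis by simp
    qed (simp add: field_simps)
    then show ?thesis by auto
  qed
  have step: "m (?S n) \<le> m' (?S (Suc n))" "m' (?S n) \<le> m (?S (Suc n))" for n
  proof -
    have "m (?S n) \<le> m {x. 1 \<le> x \<and> frac x \<in> ?S n}"
      unfolding m_def using hahn_variation_unit_interval_le[OF \<nu> H pos per1 survivors_borel survivors_subset[OF c]] .
    also have "\<dots> = m' (?S (Suc n))" unfolding m tail ..
    finally show "m (?S n) \<le> m' (?S (Suc n))" .
    have "m' (?S n) \<le> m' {x. 1 \<le> x \<and> frac x \<in> ?S n}"
      unfolding m'_def using hahn_variation_unit_interval_le[OF \<nu>' H' pos' per1' survivors_borel survivors_subset[OF c]] .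
    also have "\<dots> = m (?S (Suc n))" unfolding m' tail ..
    finally show "m' (?S n) \<le> m (?S (Suc n))" .
  qed
  \<comment> \<open>The sets shrink, yet these values do not: the initial one is bounded by every
    later one, and so by their limit 0.\<close>
  have sum: "m (?S 0) + m' (?S 0) \<le> m (?S n) + m' (?S n)" for n
  proof (induction n)
    case (Suc n)
    then show ?case using step[of n] by linarith
  qed simp
  have dec: "decseq ?S" using survivors_Suc_subset[OF c] by (intro decseq_SucI)
  have sm: "signed_measure m" "signed_measure m'"
    unfolding m_def m'_def using signed_measure_hahn_variation[OF \<nu> H] signed_measure_hahn_variation[OF \<nu>' H'] .
  have IB: "(\<Inter>n. ?S n) \<in> sets borel" using survivors_borel by auto
  have null: "m N = 0" "m' N = 0" if N: "N \<in> sets borel" "emeasure lborel N = 0" for N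
  proof -
    have z: "\<nu> B = 0" if "B \<in> sets borel" "B \<subseteq> N" for B
    proof -
      have "emeasure lborel B \<le> emeasure lborel N" using that N by (intro emeasure_mono) auto
      then show ?thesis using ac[OF that(1)] N by simp
    qed
    show "m N = 0" unfolding m_def using z N by (intro hahn_variation_eq_0[OF \<nu> H])
    have "\<nu>' B = 0" if B: "B \<in> sets borel" "B \<subseteq> N" for B
    proof -
      have "emeasure lborel B \<le> emeasure lborel N" using B N by (intro emeasure_mono) auto
      then have B0: "emeasure lborel B = 0" using N by simp
      let ?D = "{x. c / x \<in> B}"
      have D: "?D \<in> sets borel" by (rule divide_vimage_borel[OF B(1)])
      have "\<nu> (?D \<inter> {0<..}) = 0"
      proof (rule ac)
        have "?D \<inter> {0<..} = {x. 0 < x \<and> c / x \<in> B}" by auto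
        then show "emeasure lborel (?D \<inter> {0<..}) = 0" using null_set_divide[OF _ B(1) B0, of c] c by simp
      qed (use D in auto)
      moreover have "\<nu> (?D - {0<..}) = 0" using D by (intro pos) auto
      ultimately show ?thesis using signed_measure_split[OF \<nu> D, of "{0<..}"] by (simp add: \<nu>'_def)
    qed
    then show "m' N = 0" unfolding m'_def using N by (intro hahn_variation_eq_0[OF \<nu>' H'])
  qed
  have "(\<lambda>n. m (?S n) + m' (?S n)) \<longlonglongrightarrow> m (\<Inter>n. ?S n) + m' (\<Inter>n. ?S n)"
    using dec survivors_borel by (intro tendsto_add signed_measure_decseq sm)
  then have "(\<lambda>n. m (?S n) + m' (?S n)) \<longlonglongrightarrow> 0" using null[OF IB survivors_Inter_null[OF c]] by simp
  then have "m (?S 0) + m' (?S 0) \<le> 0" using sum by (intro LIMSEQ_le_const) auto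
  moreover have nn: "0 \<le> m B" "0 \<le> m' B" if "B \<in> sets borel" for B
    unfolding m_def m'_def using hahn_variation_nonneg[OF \<nu> H that] hahn_variation_nonneg[OF \<nu>' H' that] .
  ultimately have "m (?S 0) = 0" "m' (?S 0) = 0"
    using nn[OF survivors_borel[of c 0]] by linarith+
  then have m0: "m {0<..<1} = 0" "m {x. c / x \<in> {0<..<1}} = 0" by (simp_all add: m')
  have zero: "\<nu> B = 0" if "B \<in> sets borel" "B \<subseteq> C" "C \<in> sets borel" "m C = 0" for B C
    using abs_le_hahn_variation[OF \<nu> H that(1)] hahn_variation_mono[OF \<nu> H that(1,3,2)] that(4)
    by (simp add: m_def)
  have "\<nu> A = \<nu> (A \<inter> {0<..}) + \<nu> (A - {0<..})" by (rule signed_measure_split[OF \<nu> A]) simp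
  also have "\<nu> (A - {0<..}) = 0" using A by (intro pos) auto
  also have "\<nu> (A \<inter> {0<..}) = \<nu> (A \<inter> {0<..} \<inter> {0<..<1}) + \<nu> (A \<inter> {0<..} - {0<..<1})"
    using A by (intro signed_measure_split[OF \<nu>]) auto
  also have "\<nu> (A \<inter> {0<..} \<inter> {0<..<1}) = 0" using A m0(1) by (intro zero[of _ "{0<..<1}"]) auto
  also have "\<nu> (A \<inter> {0<..} - {0<..<1}) = 0"
  proof (rule zero)
    \<comment> \<open>For \<open>x \<ge> 1\<close> the assumption \<open>c < 1\<close> gives
      \<open>c / x < 1\<close>.\<close>
    show "A \<inter> {0<..} - {0<..<1} \<subseteq> {x. c / x \<in> {0<..<1}}" using c by (auto simp: field_simps)
  qed (use A m0(2) divide_vimage_borel in auto)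
  finally show ?thesis by simp
qed

section \<open>Invariant measures of the Gauss-type map\<close>

definition gauss_map :: "real \<Rightarrow> real \<Rightarrow> real" where
  "gauss_map c x = frac (c / x)"

lemma gauss_map_measurable [measurable]: "gauss_map c \<in> borel_measurable borel"
  unfolding gauss_map_def[abs_def] by measurable

lemma gauss_map_unit: "gauss_map c x \<in> {0..1}"
  using frac_ge_0[of "c / x"] frac_lt_1[of "c / x"] by (simp add: gauss_map_def)

text \<open>The positive variation on the circle of a density is the supremum of its integrals against
  derivatives \<open>h = \<Phi>'\<close> with \<open>\<Phi>\<close> periodic and \<open>[0, 1]\<close>-valued.\<close>

definition circle_test :: "(real \<Rightarrow> real) \<Rightarrow> bool" where
  "circle_test h \<longleftrightarrow> h \<in> borel_measurable borel \<and> (\<exists>B. \<forall>x\<in>{0..1}. \<bar>h x\<bar> \<le> B) \<and>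
     (\<exists>\<Phi> S K. countable S \<and> (\<forall>x\<in>{0..1}. \<forall>y\<in>{0..1}. \<bar>\<Phi> x - \<Phi> y\<bar> \<le> K * \<bar>x - y\<bar>) \<and> (\<forall>x\<in>{0..1}. 0 \<le> \<Phi> x \<and> \<Phi> x \<le> 1) \<and> \<Phi> 0 = \<Phi> 1 \<and>
       (\<forall>x\<in>{0<..<1} - S. (\<Phi> has_real_derivative h x) (at x)))"

section \<open>Periodic extension of functions on the unit interval\<close>

lemma lipschitz_frac_compose:
  fixes \<Phi> :: "real \<Rightarrow> real"
  assumes L: "\<And>x y. x \<in> {0..1} \<Longrightarrow> y \<in> {0..1} \<Longrightarrow> \<bar>\<Phi> x - \<Phi> y\<bar> \<le> K * \<bar>x - y\<bar>" and "\<Phi> 0 = \<Phi> 1"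
  shows "\<bar>\<Phi> (frac x) - \<Phi> (frac y)\<bar> \<le> K * \<bar>x - y\<bar>"
proof -
  have K: "0 \<le> K" using L[of 0 1] by simp
  have fr: "frac z \<in> {0..1}" for z :: real using frac_ge_0[of z] frac_lt_1[of z] by simp
  have *: "\<bar>\<Phi> (frac x) - \<Phi> (frac y)\<bar> \<le> K * \<bar>x - y\<bar>" if "x \<le> y" for x y
  proof (cases "\<lfloor>x\<rfloor> = \<lfloor>y\<rfloor>")
    case True
    then show ?thesis using L[OF fr fr, of x y] by (simp add: frac_def)
  next
    case False
    then have "\<lfloor>x\<rfloor> + 1 \<le> \<lfloor>y\<rfloor>" using floor_mono[OF that] by simp
    \<comment> \<open>An integer separates the points: the estimate runs from \<open>x\<close> up to
      an integer and from an integer on to \<open>y\<close>, and \<open>\<Phi> 1 = \<Phi> 0\<close>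
      makes the two pieces fit.\<close>
    then have d: "(1 - frac x) + frac y \<le> \<bar>x - y\<bar>" unfolding frac_def by linarith
    have "\<bar>\<Phi> (frac x) - \<Phi> 1\<bar> \<le> K * (1 - frac x)" using L[OF fr, of 1 x] fr[of x] by simp
    moreover have "\<bar>\<Phi> 0 - \<Phi> (frac y)\<bar> \<le> K * frac y" using L[OF _ fr, of 0 y] fr[of y] by simp
    ultimately have "\<bar>\<Phi> (frac x) - \<Phi> (frac y)\<bar> \<le> K * ((1 - frac x) + frac y)"
      using \<open>\<Phi> 0 = \<Phi> 1\<close> by (simp add: distrib_left)
    also have "\<dots> \<le> K * \<bar>x - y\<bar>" by (rule mult_left_mono[OF d K])
    finally show ?thesis .
  qed
  show ?thesis using *[of x y] *[of y x] by (cases "x \<le> y") (auto simp: abs_minus_commute)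
qed

lemma continuous_on_lipschitz_bound:
  fixes f :: "real \<Rightarrow> real"
  assumes "\<And>x y. \<bar>f x - f y\<bar> \<le> K * \<bar>x - y\<bar>"
  shows "continuous_on UNIV f"
proof -
  have "0 \<le> K" using assms[of 0 1] by simp
  then have "K-lipschitz_on UNIV f" using assms by (auto simp: lipschitz_on_def dist_real_def)
  then show ?thesis by (rule lipschitz_on_continuous_on)
qed

lemma has_derivative_frac_compose:
  fixes \<Phi> :: "real \<Rightarrow> real"
  assumes "(\<Phi> has_real_derivative d) (at (frac x))" "frac x \<noteq> 0"
  shows "((\<lambda>x. \<Phi> (frac x)) has_real_derivative d) (at x)"
proof -
  define n where "n = \<lfloor>x\<rfloor>"
  have n: "of_int n < x" "x < of_int n + 1"
  proof -
    have "of_int n \<le> x" "x < of_int n + 1" "x \<noteq> of_int n"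
      using floor_correct[of x] assms(2) by (auto simp: n_def frac_def)
    then show "of_int n < x" "x < of_int n + 1" by linarith+
  qed
  have "((\<lambda>x. x - of_int n) has_real_derivative 1) (at x)" by (auto intro!: derivative_eq_intros)
  moreover have "(\<Phi> has_real_derivative d) (at (x - of_int n))" using assms(1) by (simp add: frac_def n_def)
  ultimately have "((\<lambda>x. \<Phi> (x - of_int n)) has_real_derivative d * 1) (at x)" by (intro DERIV_chain2[of \<Phi> d "\<lambda>x. x - of_int n"])
  then have "((\<lambda>x. \<Phi> (x - of_int n)) has_real_derivative d) (at x)" by simp
  then show ?thesis
  proof (rule has_field_derivative_transform_within_open)
    show "open {of_int n<..<of_int n + 1 :: real}" by simp
    show "\<Phi> (y - of_int n) = \<Phi> (frac y)" if "y \<in> {of_int n<..<of_int n + 1}" for y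
    proof -
      have "\<lfloor>y\<rfloor> = n" using that by (intro floor_unique) auto
      then show ?thesis by (simp add: frac_def)
    qed
  qed (use n in auto)
qed

text \<open>The discontinuity of \<open>x\<^sup>2 \<Phi>(c/x)\<close> between \<open>1\<close> and \<open>0\<close> on the circle is compensated by the linear
  term \<open>\<Phi>(c) x\<close>, whose contribution to the test function is nonnegative.  This gains the factor \<open>c\<close>
  for every \<open>c > 1\<close>, where the usual Lasota-Yorke estimate would need \<open>c > 2\<close>.\<close>

lemma circle_test_gauss_map:
  assumes c: "0 < c" and h: "circle_test h"
  shows "\<exists>k. circle_test k \<and> (\<forall>x\<in>{0..1}. c * h (gauss_map c x) \<le> k x + 2)"
proof -
  obtain B \<Phi> S K where hm: "h \<in> borel_measurable borel" and B: "\<And>x. x \<in> {0..1} \<Longrightarrow> \<bar>h x\<bar> \<le> B"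
    and S: "countable S" and \<Phi>: "\<And>x y. x \<in> {0..1} \<Longrightarrow> y \<in> {0..1} \<Longrightarrow> \<bar>\<Phi> x - \<Phi> y\<bar> \<le> K * \<bar>x - y\<bar>" "\<Phi> 0 = \<Phi> 1"
    and \<Phi>01: "\<And>x. x \<in> {0..1} \<Longrightarrow> 0 \<le> \<Phi> x \<and> \<Phi> x \<le> 1"
    and der: "\<And>x. x \<in> {0<..<1} - S \<Longrightarrow> (\<Phi> has_real_derivative h x) (at x)"
    using h unfolding circle_test_def by blast
  define \<phi> where "\<phi> y = \<Phi> (frac y)" for y
  have \<phi>L: "\<bar>\<phi> x - \<phi> y\<bar> \<le> K * \<bar>x - y\<bar>" for x y
    unfolding \<phi>_def by (rule lipschitz_frac_compose[OF \<Phi>])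
  have \<phi>c: "continuous_on UNIV \<phi>" by (rule continuous_on_lipschitz_bound[OF \<phi>L])
  have K: "0 \<le> K" using \<phi>L[of 0 1] by simp
  have \<phi>01: "0 \<le> \<phi> y" "\<phi> y \<le> 1" for y
    using \<Phi>01[of "frac y"] frac_ge_0[of y] frac_lt_1[of y] by (auto simp: \<phi>_def)
  have \<phi>m: "\<phi> \<in> borel_measurable borel" by (rule borel_measurable_continuous_onI[OF \<phi>c])
  define b where "b = \<phi> c"
  have b: "0 \<le> b" "b \<le> 1" using \<phi>01 by (auto simp: b_def)
  \<comment> \<open>\<open>k\<close> is the derivative of \<open>\<Psi>\<close>: the factor
    \<open>x^2\<close> cancels the \<open>c / x^2\<close> of the chain rule down to
    \<open>c\<close>. The other terms are at least -2 on \<open>[0, 1]\<close>, because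
    \<open>x * \<phi> (c / x) \<le> 1\<close>; this is the 2 of the conclusion.\<close>
  define k where "k x = c * h (gauss_map c x) + b - 2 * x * \<phi> (c / x)" for x
  \<comment> \<open>The constant \<open>1 - b\<close> shifts the primitive into
    \<open>[0, 1]\<close>; it is also the common value at 0 and 1, because
    \<open>b = \<phi> c\<close>.\<close>
  define \<Psi> where "\<Psi> x = b * x - x\<^sup>2 * \<phi> (c / x) + (1 - b)" for x
  \<comment> \<open>Pulling back adds the points where \<open>c / x\<close> is an integer or hits an
    exceptional point modulo 1. They accumulate at 0, so countability, rather than finiteness, is
    the stable condition.\<close>
  define S' where "S' = {x. x \<noteq> 0 \<and> frac (c / x) \<in> insert 0 S}"
  have "circle_test k"
    unfolding circle_test_def
  proof (intro conjI exI ballI)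
    show "k \<in> borel_measurable borel" unfolding k_def using hm \<phi>m by measurable
    show "\<bar>k x\<bar> \<le> c * B + 3" if "x \<in> {0..1}" for x
    proof -
      have "\<bar>c * h (gauss_map c x)\<bar> \<le> c * B"
        using c B[OF gauss_map_unit] by (simp add: abs_mult)
      moreover have "x * \<phi> (c / x) \<le> 1 * 1" using that \<phi>01 by (intro mult_mono) auto
      moreover have "0 \<le> x * \<phi> (c / x)" using that \<phi>01 by simp
      ultimately show ?thesis using b unfolding k_def by linarith
    qed
    have "S' \<subseteq> (\<lambda>(n::int, s). c / (s + of_int n)) ` (UNIV \<times> insert 0 S)"
    proof
      fix x assume x: "x \<in> S'"
      then have "c / (frac (c / x) + of_int \<lfloor>c / x\<rfloor>) = x" using c by (simp add: frac_def S'_def)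
      then show "x \<in> (\<lambda>(n::int, s). c / (s + of_int n)) ` (UNIV \<times> insert 0 S)"
        using x by (intro image_eqI[of _ _ "(\<lfloor>c / x\<rfloor>, frac (c / x))"]) (auto simp: S'_def)
    qed
    then show "countable S'" using S by (elim countable_subset) auto
    show "\<Psi> 0 = \<Psi> 1" by (simp add: \<Psi>_def b_def)
  next
    fix x y :: real assume "x \<in> {0..1}" "y \<in> {0..1}"
    have *: "\<bar>y\<^sup>2 * \<phi> (c / y) - x\<^sup>2 * \<phi> (c / x)\<bar> \<le> (2 + K * c) * (y - x)"
      if xy: "0 \<le> x" "x < y" "y \<le> 1" for x y
    proof -
      have "\<bar>y\<^sup>2 - x\<^sup>2\<bar> * \<phi> (c / y) \<le> 2 * (y - x) * 1"
      proof (rule mult_mono)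
        have "\<bar>y\<^sup>2 - x\<^sup>2\<bar> = (y + x) * (y - x)"
          using xy by (simp add: power2_eq_square square_diff_square_factored abs_mult)
        also have "\<dots> \<le> 2 * (y - x)" using xy by (intro mult_right_mono) auto
        finally show "\<bar>y\<^sup>2 - x\<^sup>2\<bar> \<le> 2 * (y - x)" .
      qed (use xy \<phi>01 in auto)
      moreover have "x\<^sup>2 * \<bar>\<phi> (c / y) - \<phi> (c / x)\<bar> \<le> K * c * (y - x)"
      proof (cases "x = 0")
        case True
        then show ?thesis using xy K c by simp
      next
        case False
        have "x\<^sup>2 * \<bar>\<phi> (c / y) - \<phi> (c / x)\<bar> \<le> x\<^sup>2 * (K * \<bar>c / y - c / x\<bar>)"
          by (intro mult_left_mono \<phi>L) simp
        also have "\<bar>c / y - c / x\<bar> = c * (y - x) / (x * y)"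
        proof -
          have "c / y - c / x = - (c * (y - x) / (x * y))" using False xy by (simp add: field_simps)
          then show ?thesis using False xy c by simp
        qed
        also have "x\<^sup>2 * (K * (c * (y - x) / (x * y))) = (K * c * (y - x)) * (x / y)"
          using False xy by (simp add: field_simps power2_eq_square)
        \<comment> \<open>Here \<open>x < y\<close> enters: the factor \<open>x^2\<close> has
          absorbed the unbounded slope of \<open>c / x\<close> near 0 up to the ratio
          \<open>x / y\<close>.\<close>
        also have "\<dots> \<le> (K * c * (y - x)) * 1"
          using False xy K c by (intro mult_left_mono) auto
        finally show ?thesis by simp
      qed
      moreover have "y\<^sup>2 * \<phi> (c / y) - x\<^sup>2 * \<phi> (c / x) =
          (y\<^sup>2 - x\<^sup>2) * \<phi> (c / y) + x\<^sup>2 * (\<phi> (c / y) - \<phi> (c / x))" by (simp add: algebra_simps)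
      moreover have "\<bar>(y\<^sup>2 - x\<^sup>2) * \<phi> (c / y)\<bar> = \<bar>y\<^sup>2 - x\<^sup>2\<bar> * \<phi> (c / y)" using \<phi>01 by (simp add: abs_mult)
      moreover have "\<bar>x\<^sup>2 * (\<phi> (c / y) - \<phi> (c / x))\<bar> = x\<^sup>2 * \<bar>\<phi> (c / y) - \<phi> (c / x)\<bar>" by (simp add: abs_mult)
      ultimately have "\<bar>y\<^sup>2 * \<phi> (c / y) - x\<^sup>2 * \<phi> (c / x)\<bar> \<le> 2 * (y - x) + K * c * (y - x)" by linarith
      then show ?thesis by (simp add: distrib_right)
    qed
    have **: "\<bar>\<Psi> y - \<Psi> x\<bar> \<le> (3 + K * c) * \<bar>y - x\<bar>" if xy: "0 \<le> x" "x < y" "y \<le> 1" for x y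
    proof -
      have "b * (y - x) \<le> 1 * (y - x)" using b xy by (intro mult_right_mono) auto
      moreover have "0 \<le> b * (y - x)" using b xy by simp
      moreover have "\<Psi> y - \<Psi> x = b * (y - x) - (y\<^sup>2 * \<phi> (c / y) - x\<^sup>2 * \<phi> (c / x))"
        by (simp add: \<Psi>_def algebra_simps)
      moreover have "\<bar>s - A\<bar> \<le> d + e" if "\<bar>A\<bar> \<le> e" "s \<le> 1 * d" "0 \<le> s" for s A d e :: real
        using that by linarith
      ultimately have "\<bar>\<Psi> y - \<Psi> x\<bar> \<le> (y - x) + (2 + K * c) * (y - x)" using *[OF xy] by presburger
      then show ?thesis using xy by (simp add: algebra_simps)
    qed
    show "\<bar>\<Psi> x - \<Psi> y\<bar> \<le> (3 + K * c) * \<bar>x - y\<bar>"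
      using **[of x y] **[of y x] \<open>x \<in> {0..1}\<close> \<open>y \<in> {0..1}\<close>
      by (cases x y rule: linorder_cases) (auto simp: abs_minus_commute)
  next
    fix x :: real assume x: "x \<in> {0..1}"
    have "x\<^sup>2 * \<phi> (c / x) \<le> x\<^sup>2" using \<phi>01(2) by (simp add: mult_left_le)
    moreover have "0 \<le> x\<^sup>2 * \<phi> (c / x)" using \<phi>01(1) by simp
    moreover have "b * (1 - x) \<le> 1 * (1 - x)" using b x by (intro mult_right_mono) auto
    moreover have "0 \<le> b * (1 - x)" using b x by simp
    moreover have "x\<^sup>2 \<le> x" using x by (simp add: power2_eq_square mult_left_le)
    ultimately show "0 \<le> \<Psi> x" "\<Psi> x \<le> 1"
      unfolding \<Psi>_def right_diff_distrib by linarith+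
  next
    fix x :: real assume x: "x \<in> {0<..<1} - S'"
    then have nz: "frac (c / x) \<noteq> 0" and nS: "frac (c / x) \<notin> S" by (auto simp: S'_def)
    have "frac (c / x) \<in> {0<..<1} - S" using nz nS frac_ge_0[of "c / x"] frac_lt_1[of "c / x"] by auto
    from has_derivative_frac_compose[OF der[OF this] nz]
    have d1: "(\<phi> has_real_derivative h (gauss_map c x)) (at (c / x))"
      by (simp add: \<phi>_def[abs_def] gauss_map_def)
    have d2: "((\<lambda>x. c / x) has_real_derivative - (c / x\<^sup>2)) (at x)"
      using x by (auto intro!: derivative_eq_intros simp: power2_eq_square)
    have "((\<lambda>x. \<phi> (c / x)) has_real_derivative h (gauss_map c x) * - (c / x\<^sup>2)) (at x)"
      by (rule DERIV_chain2[OF d1 d2])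
    then have "(\<Psi> has_real_derivative b - (2 * x * \<phi> (c / x) + x\<^sup>2 * (h (gauss_map c x) * - (c / x\<^sup>2)))) (at x)"
      unfolding \<Psi>_def[abs_def] by (auto intro!: derivative_eq_intros)
    moreover have "b - (2 * x * \<phi> (c / x) + x\<^sup>2 * (h (gauss_map c x) * - (c / x\<^sup>2))) = k x"
      using x by (simp add: k_def)
    ultimately show "(\<Psi> has_real_derivative k x) (at x)" by simp
  qed
  moreover have "c * h (gauss_map c x) \<le> k x + 2" if "x \<in> {0..1}" for x
  proof -
    have "x * \<phi> (c / x) \<le> 1 * 1" using that \<phi>01 by (intro mult_mono) auto
    then show ?thesis using b unfolding k_def by linarith
  qed
  ultimately show ?thesis by blast
qed

section \<open>Mass bounds for iterated images of Lebesgue measure\<close>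

definition unit_lebesgue :: "real measure" where
  "unit_lebesgue = density lborel (\<lambda>x. ennreal (indicator {0..1} x))"

lemma sets_unit_lebesgue [simp, measurable_cong]: "sets unit_lebesgue = sets borel"
  by (simp add: unit_lebesgue_def)

lemma space_unit_lebesgue [simp]: "space unit_lebesgue = UNIV"
  by (simp add: unit_lebesgue_def)

lemma prob_space_unit_lebesgue: "prob_space unit_lebesgue"
proof (rule prob_spaceI)
  have "emeasure unit_lebesgue UNIV = (\<integral>\<^sup>+x. indicator {0..1::real} x \<partial>lborel)"
    by (simp add: unit_lebesgue_def emeasure_density ennreal_indicator)
  then show "emeasure unit_lebesgue (space unit_lebesgue) = 1" by simp
qed

interpretation UL: prob_space unit_lebesgue by (rule prob_space_unit_lebesgue)

lemma AE_unit_lebesgue: "AE x in unit_lebesgue. x \<in> {0..1}"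
  unfolding unit_lebesgue_def by (subst AE_density) (auto simp: indicator_def)

text \<open>A fundamental theorem of calculus for Lipschitz functions: difference quotients of the
  periodic extension have mean zero by translation invariance, are bounded by \<open>K\<close>, and
  converge to \<open>h\<close> off a countable set.\<close>

lemma circle_test_integral:
  assumes "circle_test h"
  shows "(LINT x|unit_lebesgue. h x) = 0"
proof -
  obtain B \<Phi> S K where hm: "h \<in> borel_measurable borel" and B: "\<And>x. x \<in> {0..1} \<Longrightarrow> \<bar>h x\<bar> \<le> B"
    and S: "countable S" and \<Phi>: "\<And>x y. x \<in> {0..1} \<Longrightarrow> y \<in> {0..1} \<Longrightarrow> \<bar>\<Phi> x - \<Phi> y\<bar> \<le> K * \<bar>x - y\<bar>" "\<Phi> 0 = \<Phi> 1"
    and der: "\<And>x. x \<in> {0<..<1} - S \<Longrightarrow> (\<Phi> has_real_derivative h x) (at x)"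
    using assms unfolding circle_test_def by blast
  define \<phi> where "\<phi> y = \<Phi> (frac y)" for y
  have \<phi>L: "\<bar>\<phi> x - \<phi> y\<bar> \<le> K * \<bar>x - y\<bar>" for x y
    unfolding \<phi>_def by (rule lipschitz_frac_compose[OF \<Phi>])
  have \<phi>c: "continuous_on A \<phi>" for A
    using continuous_on_lipschitz_bound[OF \<phi>L] continuous_on_subset by blast
  define t where "t n = inverse (real (Suc n))" for n
  have t: "0 < t n" "t n \<le> 1" for n by (auto simp: t_def field_simps)
  define q where "q n x = (\<phi> (x + t n) - \<phi> x) / t n" for n x
  have qc: "continuous_on A (q n)" for A n
    unfolding q_def using t[of n] by (intro continuous_intros continuous_on_compose2[OF \<phi>c[of UNIV]]) auto
  have zero: "(LINT x|unit_lebesgue. q n x) = 0" for n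
  proof -
    have "integral {0..1} (\<phi> \<circ> (\<lambda>x. x + t n)) = integral {0 + t n..1 + t n} \<phi>"
      by (rule integral_shift[OF \<phi>c])
    also have "\<dots> = integral {t n..1} \<phi> + integral {1..1 + t n} \<phi>"
      using t[of n] integrable_continuous_real[OF \<phi>c]
        Henstock_Kurzweil_Integration.integral_combine[of "t n" 1 "1 + t n" \<phi>] by simp
    also have "integral {1..1 + t n} \<phi> = integral {0..t n} (\<phi> \<circ> (\<lambda>x. x + 1))"
      using integral_shift[OF \<phi>c, where a=0 and b="t n" and c=1] by (simp add: add.commute)
    also have "\<phi> \<circ> (\<lambda>x. x + 1) = \<phi>" by (simp add: \<phi>_def fun_eq_iff frac_1_eq)
    also have "integral {t n..1} \<phi> + integral {0..t n} \<phi> = integral {0..1} \<phi>"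
      using t[of n] Henstock_Kurzweil_Integration.integral_combine[of 0 "t n" 1 \<phi>] integrable_continuous_real[OF \<phi>c]
      by simp
    finally have "integral {0..1} (q n) = 0"
      unfolding q_def using \<phi>c
      by (simp add: comp_def Henstock_Kurzweil_Integration.integral_diff integrable_continuous_real
          continuous_on_compose2[OF \<phi>c[of UNIV]] continuous_intros)
    moreover have "set_integrable lborel {0..1} (q n)"
      by (rule borel_integrable_atLeastAtMost') (rule qc)
    ultimately have "(LINT x:{0..1}|lborel. q n x) = 0" by (simp add: set_borel_integral_eq_integral)
    then show ?thesis
      unfolding unit_lebesgue_def set_lebesgue_integral_def
      using borel_measurable_continuous_onI[OF qc] by (subst integral_density) auto
  qed
  have "(\<lambda>n. LINT x|unit_lebesgue. q n x) \<longlonglongrightarrow> (LINT x|unit_lebesgue. h x)"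
  proof (rule integral_dominated_convergence[where w="\<lambda>_. K"])
    show "h \<in> borel_measurable unit_lebesgue" "q n \<in> borel_measurable unit_lebesgue" for n
      using hm borel_measurable_continuous_onI[OF qc] by (simp_all cong: measurable_cong_sets)
    have "norm (q n x) \<le> K" for n x
      using \<phi>L[of "x + t n" x] t[of n] by (simp add: q_def field_simps)
    then show "AE x in unit_lebesgue. norm (q n x) \<le> K" for n by simp
    have "AE x in lborel. x \<notin> insert 0 (insert 1 S)"
      using S by (intro AE_not_in countable_imp_null_set_lborel) auto
    then have "AE x in lborel. 0 < ennreal (indicator {0..1} x) \<longrightarrow> x \<in> {0<..<1} - S"
      by (rule eventually_mono) (auto simp: indicator_def split: if_splits)
    then have "AE x in unit_lebesgue. x \<in> {0<..<1} - S"
      unfolding unit_lebesgue_def by (subst AE_density) auto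
    then show "AE x in unit_lebesgue. (\<lambda>n. q n x) \<longlonglongrightarrow> h x"
    proof eventually_elim
      case (elim x)
      have "frac x = x" using elim by (intro frac_eq[THEN iffD2]) auto
      then have "(\<phi> has_real_derivative h x) (at x)"
        unfolding \<phi>_def[abs_def] using elim der[OF elim] by (intro has_derivative_frac_compose) auto
      then have "(\<lambda>y. (\<phi> (x + y) - \<phi> x) / y) \<midarrow>0\<rightarrow> h x" by (simp add: DERIV_def)
      moreover have "t \<longlonglongrightarrow> 0" unfolding t_def by (rule LIMSEQ_inverse_real_of_nat)
      then have "filterlim t (at 0) sequentially" using t by (intro filterlim_atI) (auto simp: less_imp_neq[symmetric])
      ultimately show ?case unfolding q_def by (rule filterlim_compose)
    qed
  qed simp
  then show ?thesis using zero by (simp add: LIMSEQ_const_iff)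
qed

lemma gauss_map_pow_measurable [measurable]: "gauss_map c ^^ n \<in> borel_measurable borel"
  by (induction n) (auto simp: comp_def)

lemma gauss_map_pow_unit: "x \<in> {0..1} \<Longrightarrow> (gauss_map c ^^ n) x \<in> {0..1}"
  using gauss_map_unit by (cases n) auto

lemma AE_gauss_map_pow_unit: "AE x in unit_lebesgue. (gauss_map c ^^ n) x \<in> {0..1}"
  by (rule eventually_mono[OF AE_unit_lebesgue gauss_map_pow_unit])

lemma circle_test_integrable:
  assumes "circle_test h"
  shows "integrable unit_lebesgue (\<lambda>x. h ((gauss_map c ^^ n) x))"
proof -
  obtain B where hm: "h \<in> borel_measurable borel" and B: "\<And>x. x \<in> {0..1} \<Longrightarrow> \<bar>h x\<bar> \<le> B"
    using assms unfolding circle_test_def by blast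
  show ?thesis
  proof (rule UL.integrable_const_bound[of _ B])
    show "AE x in unit_lebesgue. norm (h ((gauss_map c ^^ n) x)) \<le> B"
      using AE_gauss_map_pow_unit by eventually_elim (use B in auto)
  qed (use hm in measurable)
qed

text \<open>The estimate runs on the dual side: instead of pushing a density forward, the test
  function is pulled back. Each step turns a bound \<open>V\<close> into \<open>(V + 2) / c\<close>,
  and \<open>2 / (c - 1)\<close> is the fixed point of this recursion.\<close>

lemma circle_test_integral_pow_le:
  assumes c: "1 < c" and "circle_test h"
  shows "(LINT x|unit_lebesgue. h ((gauss_map c ^^ n) x)) \<le> 2 / (c - 1)"
  using assms(2)
proof (induction n arbitrary: h)
  case 0
  then show ?case using circle_test_integral c by simp
next
  case (Suc n)
  obtain k where k: "circle_test k" "\<And>x. x \<in> {0..1} \<Longrightarrow> c * h (gauss_map c x) \<le> k x + 2"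
    using circle_test_gauss_map[of c, OF _ Suc.prems] c by auto
  have "c * (LINT x|unit_lebesgue. h ((gauss_map c ^^ Suc n) x)) =
      (LINT x|unit_lebesgue. c * h ((gauss_map c ^^ Suc n) x))" by simp
  also have "\<dots> \<le> (LINT x|unit_lebesgue. k ((gauss_map c ^^ n) x) + 2)"
  proof (rule integral_mono_AE)
    show "integrable unit_lebesgue (\<lambda>x. c * h ((gauss_map c ^^ Suc n) x))"
      by (intro integrable_mult_right circle_test_integrable Suc.prems)
    show "integrable unit_lebesgue (\<lambda>x. k ((gauss_map c ^^ n) x) + 2)"
      using circle_test_integrable[OF k(1), of n c] by simp
    show "AE x in unit_lebesgue. c * h ((gauss_map c ^^ Suc n) x) \<le> k ((gauss_map c ^^ n) x) + 2"
      using AE_gauss_map_pow_unit by eventually_elim (use k(2) in auto)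
  qed
  also have "\<dots> = (LINT x|unit_lebesgue. k ((gauss_map c ^^ n) x)) + 2"
    using circle_test_integrable[OF k(1), of n c] by (simp add: UL.prob_space[simplified])
  also have "\<dots> \<le> 2 / (c - 1) + 2" using Suc.IH[OF k(1)] by simp
  also have "\<dots> = c * (2 / (c - 1))" using c by (simp add: field_simps)
  finally show ?case using c by (simp only: mult_le_cancel_left_pos)
qed

text \<open>The primitive is a ramp rising from 0 to 1 over \<open>[a, b]\<close> minus
  \<open>x\<close>, shifted by \<open>a\<close> so that its minimum, taken at \<open>a\<close>, is
  0. Such tests convert a variation bound into a bound for the mean density over the
  interval.\<close>

lemma circle_test_interval:
  assumes "0 \<le> a" "a < b" "b \<le> 1"
  shows "circle_test (\<lambda>x. indicator {a..b} x / (b - a) - 1)"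
  unfolding circle_test_def
proof (intro conjI exI ballI)
  let ?\<Phi> = "\<lambda>x. max 0 (min 1 ((x - a) / (b - a))) - x + a"
  show "(\<lambda>x. indicator {a..b} x / (b - a) - 1) \<in> borel_measurable borel" by measurable
  show "\<bar>indicator {a..b} x / (b - a) - 1\<bar> \<le> 1 / (b - a) + 1" for x
    using assms by (auto simp: indicator_def abs_if)
  show "countable {a, b}" by simp
  show "\<bar>?\<Phi> x - ?\<Phi> y\<bar> \<le> (1 / (b - a) + 1) * \<bar>x - y\<bar>" for x y
  proof -
    have "\<bar>max 0 (min 1 u) - max 0 (min 1 v)\<bar> \<le> \<bar>u - v\<bar>" for u v :: real
      by (auto simp: max_def min_def)
    from this[of "(x - a) / (b - a)" "(y - a) / (b - a)"]
    have "\<bar>max 0 (min 1 ((x - a) / (b - a))) - max 0 (min 1 ((y - a) / (b - a)))\<bar> \<le> 1 / (b - a) * \<bar>x - y\<bar>"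
      using assms by (simp add: diff_divide_distrib[symmetric] abs_divide)
    moreover have "(1 / (b - a) + 1) * \<bar>x - y\<bar> = 1 / (b - a) * \<bar>x - y\<bar> + \<bar>x - y\<bar>"
      by (simp add: distrib_right)
    moreover have "\<bar>p - x + a - (q - y + a)\<bar> \<le> \<bar>p - q\<bar> + \<bar>x - y\<bar>" for p q by linarith
    ultimately show ?thesis by (smt (verit))
  qed
  show "?\<Phi> 0 = ?\<Phi> 1" using assms by (auto simp: max_def min_def field_simps)
  fix x :: real
  {
    assume x: "x \<in> {0..1}"
    consider "x \<le> a" | "a < x" "x < b" | "b \<le> x" by linarith
    then have "0 \<le> ?\<Phi> x \<and> ?\<Phi> x \<le> 1"
    proof cases
      case 1
      then have "(x - a) / (b - a) \<le> 0" using assms by (simp add: divide_nonpos_pos)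
      then show ?thesis using 1 x assms by (auto simp: max_def min_def)
    next
      case 2
      then have "0 < (x - a) / (b - a)" "(x - a) / (b - a) < 1" using assms by (auto simp: field_simps)
      moreover have "x - a \<le> (x - a) / (b - a)" 
        using mult_left_mono[of "b - a" 1 "x - a"] 2 assms by (simp add: pos_le_divide_eq)
      moreover define q where "q = (x - a) / (b - a)"
      ultimately have "0 < q" "q < 1" "x - a \<le> q" by auto
      then show ?thesis using 2 unfolding q_def[symmetric] by (simp add: max_def min_def)
    next
      case 3
      then have "1 \<le> (x - a) / (b - a)" using assms by (simp add: field_simps)
      then show ?thesis using 3 x assms by (auto simp: max_def min_def)
    qed
    then show "0 \<le> ?\<Phi> x" "?\<Phi> x \<le> 1" by auto
  }
  assume x: "x \<in> {0<..<1} - {a, b}"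
  consider "x < a" | "a < x" "x < b" | "b < x" using x by force
  then show "(?\<Phi> has_real_derivative indicator {a..b} x / (b - a) - 1) (at x)"
  proof cases
    case 1
    have "((\<lambda>x. 0 - x + a) has_real_derivative -1) (at x)" by (auto intro!: derivative_eq_intros)
    then have "(?\<Phi> has_real_derivative -1) (at x)"
      by (rule has_field_derivative_transform_within_open[of _ _ _ "{..<a}"])
         (use 1 assms in \<open>auto simp: max_def min_def field_simps\<close>)
    then show ?thesis using 1 by simp
  next
    case 2
    have "((\<lambda>x. (x - a) / (b - a) - x + a) has_real_derivative 1 / (b - a) - 1) (at x)"
      using assms by (auto intro!: derivative_eq_intros)
    then have "(?\<Phi> has_real_derivative 1 / (b - a) - 1) (at x)"
      by (rule has_field_derivative_transform_within_open[of _ _ _ "{a<..<b}"])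
         (use 2 assms in \<open>auto simp: max_def min_def field_simps\<close>)
    then show ?thesis using 2 by simp
  next
    case 3
    have "((\<lambda>x. 1 - x + a) has_real_derivative -1) (at x)" by (auto intro!: derivative_eq_intros)
    then have "(?\<Phi> has_real_derivative -1) (at x)"
      by (rule has_field_derivative_transform_within_open[of _ _ _ "{b<..}"])
         (use 3 assms in \<open>auto simp: max_def min_def field_simps\<close>)
    then show ?thesis using 3 by simp
  qed
qed

text \<open>The mean density over a subinterval of \<open>[0, 1]\<close> exceeds the overall mean 1
  by at most the positive variation on the circle, hence the constant
  \<open>1 + 2 / (c - 1)\<close>.\<close>

lemma gauss_map_pow_interval_le:
  assumes c: "1 < c" and "a < b"
  shows "measure unit_lebesgue {x. (gauss_map c ^^ n) x \<in> {a..b}} \<le> (1 + 2 / (c - 1)) * (b - a)"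
proof (cases "1 \<le> b - a")
  case True
  have "measure unit_lebesgue {x. (gauss_map c ^^ n) x \<in> {a..b}} \<le> 1" by (rule UL.prob_le_1)
  also have "1 \<le> (1 + 2 / (c - 1)) * (b - a)"
    using mult_mono[of 1 "1 + 2 / (c - 1)" 1 "b - a"] True c by simp
  finally show ?thesis by simp
next
  case False
  define d where "d = b - a"
  \<comment> \<open>The interval is slid into \<open>[0, 1]\<close>, where the test functions live,
    with its length kept; none of its points in \<open>[0, 1]\<close> is lost.\<close>
  define a' where "a' = max 0 (min a (1 - d))"
  have d: "0 < d" "d < 1" using False assms by (auto simp: d_def)
  have a': "0 \<le> a'" "a' + d \<le> 1" using d by (auto simp: a'_def)
  let ?T = "gauss_map c ^^ n"
  have m: "{x. ?T x \<in> {r..s}} \<in> sets borel" for r s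
    using measurable_sets[OF gauss_map_pow_measurable[where c=c and n=n], of "{r..s}"] by (simp add: vimage_def)
  let ?h = "\<lambda>x. indicator {a'..a' + d} x / (a' + d - a') - 1 :: real"
  have t: "circle_test ?h" using a' d by (intro circle_test_interval) auto
  have "measure unit_lebesgue {x. ?T x \<in> {a..b}} \<le> measure unit_lebesgue {x. ?T x \<in> {a'..a' + d}}"
  proof (rule UL.finite_measure_mono_AE)
    show "AE x in unit_lebesgue. x \<in> {x. ?T x \<in> {a..b}} \<longrightarrow> x \<in> {x. ?T x \<in> {a'..a' + d}}"
      using AE_gauss_map_pow_unit by eventually_elim (auto simp: a'_def d_def)
  qed (use m in simp)
  also have "\<dots> = (LINT x|unit_lebesgue. indicator {x. ?T x \<in> {a'..a' + d}} x)" by simp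
  also have "\<dots> = (LINT x|unit_lebesgue. d * ?h (?T x) + d)"
    using d by (intro Bochner_Integration.integral_cong) (auto simp: indicator_def algebra_simps)
  also have "\<dots> = d * (LINT x|unit_lebesgue. ?h (?T x)) + d"
    using circle_test_integrable[OF t, of n c] by (simp add: UL.prob_space[simplified])
  also have "\<dots> \<le> d * (2 / (c - 1)) + d"
    using circle_test_integral_pow_le[OF c t, of n] d by (intro add_right_mono mult_left_mono) auto
  finally show ?thesis by (simp add: d_def algebra_simps)
qed


section \<open>Orbit averages of Lebesgue measure\<close>

lemma cis_frac_multiple: "cis (2 * pi * of_int k * frac x) = cis (2 * pi * of_int k * x)"
proof -
  have "cis (2 * pi * of_int k * x) = cis (2 * pi * of_int k * frac x) * cis (2 * pi * of_int (k * \<lfloor>x\<rfloor>))"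
    by (simp add: frac_def cis_mult algebra_simps)
  moreover have "cis (2 * pi * of_int (k * \<lfloor>x\<rfloor>)) = 1" by (rule cis_multiple_2pi) simp
  ultimately show ?thesis by simp
qed

text \<open>Choosing the time \<open>k\<close> in \<open>{..n}\<close> at random makes the average
  of the images a single image measure, so that it is at once a probability measure and Fubini
  evaluates its integrals.\<close>

definition orbit_average :: "real \<Rightarrow> nat \<Rightarrow> real measure" where
  "orbit_average c n = distr (uniform_count_measure {..n} \<Otimes>\<^sub>M unit_lebesgue) borel
     (\<lambda>(k, x). (gauss_map c ^^ k) x)"

lemma orbit_average_measurable:
  "(\<lambda>(k, x). (gauss_map c ^^ k) x) \<in> borel_measurable (uniform_count_measure {..n} \<Otimes>\<^sub>M unit_lebesgue)"
proof -
  have "(\<lambda>(k, x). (gauss_map c ^^ k) x) \<in> borel_measurable (count_space {..n} \<Otimes>\<^sub>M unit_lebesgue)"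
    by (rule measurable_pair_measure_countable1) auto
  moreover have "sets (uniform_count_measure {..n} \<Otimes>\<^sub>M unit_lebesgue) = sets (count_space {..n} \<Otimes>\<^sub>M unit_lebesgue)"
    by (intro sets_pair_measure_cong) (auto simp: sets_uniform_count_measure)
  ultimately show ?thesis by (simp cong: measurable_cong_sets)
qed

lemma pair_prob_orbit: "pair_prob_space (uniform_count_measure {..n::nat}) unit_lebesgue"
  by (intro pair_prob_space.intro pair_sigma_finite.intro prob_space_imp_sigma_finite
      prob_space_uniform_count_measure prob_space_unit_lebesgue) auto

lemma real_distribution_orbit_average: "real_distribution (orbit_average c n)"
proof -
  interpret pair_prob_space "uniform_count_measure {..n}" unit_lebesgue by (rule pair_prob_orbit)
  have "prob_space (orbit_average c n)"
    unfolding orbit_average_def by (rule prob_space_distr[OF orbit_average_measurable])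
  then show ?thesis by (simp add: real_distribution_def real_distribution_axioms_def orbit_average_def)
qed

lemma integral_orbit_average:
  fixes h :: "real \<Rightarrow> 'b::{banach, second_countable_topology}"
  assumes h: "h \<in> borel_measurable borel" and B: "\<And>x. norm (h x) \<le> B"
  shows "(LINT x|orbit_average c n. h x) =
    (\<Sum>k\<le>n. LINT x|unit_lebesgue. h ((gauss_map c ^^ k) x)) /\<^sub>R real (Suc n)"
proof -
  interpret P: pair_prob_space "uniform_count_measure {..n}" unit_lebesgue by (rule pair_prob_orbit)
  let ?P = "uniform_count_measure {..n} \<Otimes>\<^sub>M unit_lebesgue"
  have "(LINT x|orbit_average c n. h x) = (LINT z|?P. h ((\<lambda>(k, x). (gauss_map c ^^ k) x) z))"
    unfolding orbit_average_def by (rule integral_distr[OF orbit_average_measurable h])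
  also have "\<dots> = (LINT k|uniform_count_measure {..n}. LINT x|unit_lebesgue. h ((gauss_map c ^^ k) x))"
  proof -
    have "integrable ?P (\<lambda>z. h ((\<lambda>(k, x). (gauss_map c ^^ k) x) z))"
      using B by (intro P.integrable_const_bound[of _ B] measurable_compose[OF orbit_average_measurable h]) auto
    from P.integral_fst'[OF this] show ?thesis by simp
  qed
  also have "\<dots> = (\<Sum>k\<le>n. LINT x|unit_lebesgue. h ((gauss_map c ^^ k) x)) /\<^sub>R real (Suc n)"
    by (simp add: uniform_count_measure_def lebesgue_integral_point_measure_finite scaleR_sum_right inverse_eq_divide)
  finally show ?thesis .
qed

lemma orbit_average_interval_le:
  assumes c: "1 < c" and "a < b"
  shows "measure (orbit_average c n) {a..b} \<le> (1 + 2 / (c - 1)) * (b - a)"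
proof -
  interpret real_distribution "orbit_average c n" by (rule real_distribution_orbit_average)
  have "measure (orbit_average c n) {a..b} = (LINT x|orbit_average c n. indicator {a..b} x :: real)" by simp
  also have "\<dots> = (\<Sum>k\<le>n. LINT x|unit_lebesgue. indicator {a..b} ((gauss_map c ^^ k) x)) /\<^sub>R real (Suc n)"
    by (rule integral_orbit_average[where B=1]) (auto simp: indicator_def)
  also have "\<dots> \<le> (\<Sum>k\<le>n. (1 + 2 / (c - 1)) * (b - a)) /\<^sub>R real (Suc n)"
  proof (intro scaleR_left_mono sum_mono)
    fix k
    have "(LINT x|unit_lebesgue. indicator {a..b} ((gauss_map c ^^ k) x)) =
        (LINT x|unit_lebesgue. indicator {x. (gauss_map c ^^ k) x \<in> {a..b}} x :: real)"
      by (intro Bochner_Integration.integral_cong) (auto simp: indicator_def)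
    also have "\<dots> \<le> (1 + 2 / (c - 1)) * (b - a)" using gauss_map_pow_interval_le[OF assms, of k] by simp
    finally show "(LINT x|unit_lebesgue. indicator {a..b} ((gauss_map c ^^ k) x)) \<le> (1 + 2 / (c - 1)) * (b - a)" .
  qed simp
  also have "\<dots> = (1 + 2 / (c - 1)) * (b - a)" by (simp del: of_nat_Suc)
  finally show ?thesis .
qed

lemma orbit_average_unit: "measure (orbit_average c n) {0..1} = 1"
proof -
  interpret real_distribution "orbit_average c n" by (rule real_distribution_orbit_average)
  have "measure (orbit_average c n) {0..1} = (LINT x|orbit_average c n. indicator {0..1} x :: real)" by simp
  also have "\<dots> = (\<Sum>k\<le>n. LINT x|unit_lebesgue. indicator {0..1} ((gauss_map c ^^ k) x)) /\<^sub>R real (Suc n)"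
    by (rule integral_orbit_average[where B=1]) (auto simp: indicator_def)
  also have "(\<Sum>k\<le>n. LINT x|unit_lebesgue. indicator {0..1} ((gauss_map c ^^ k) x)) = (\<Sum>k\<le>n. 1::real)"
  proof (intro sum.cong refl)
    fix k
    have "(LINT x|unit_lebesgue. indicator {0..1} ((gauss_map c ^^ k) x)) = (LINT x|unit_lebesgue. (1::real))"
      by (rule integral_cong_AE) (use AE_gauss_map_pow_unit[where c=c and n=k] in auto)
    then show "(LINT x|unit_lebesgue. indicator {0..1} ((gauss_map c ^^ k) x)) = (1::real)"
      by (simp add: UL.prob_space[simplified])
  qed
  finally show ?thesis by (simp del: of_nat_Suc)
qed

section \<open>Weak limits and their absolute continuity\<close>

lemma tight_orbit_average: "tight (orbit_average c)"
  unfolding tight_def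
proof (intro conjI allI impI)
  show "real_distribution (orbit_average c n)" for n by (rule real_distribution_orbit_average)
  fix e :: real assume "e > 0"
  show "\<exists>a b. a < b \<and> (\<forall>n. 1 - e < measure (orbit_average c n) {a<..b})"
  proof (intro exI conjI allI)
    show "-1 < (1::real)" by simp
    fix n
    interpret real_distribution "orbit_average c n" by (rule real_distribution_orbit_average)
    have "measure (orbit_average c n) {0..1} \<le> measure (orbit_average c n) {-1<..1}"
      by (intro finite_measure_mono) auto
    then show "1 - e < measure (orbit_average c n) {-1<..1}" using \<open>e > 0\<close> by (simp add: orbit_average_unit)
  qed
qed

text \<open>A complementary measure \<open>I\<close> with increments those of
  \<open>L * x - cdf M x\<close> is added, so that the sum with \<open>M\<close> agrees with
  \<open>L\<close> times Lebesgue measure on half-open intervals and hence on all Borel sets. A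
  Lebesgue null set is then null for the summand \<open>M\<close>.\<close>

lemma interval_bound_imp_absolutely_continuous:
  fixes M :: "real measure"
  assumes M: "real_distribution M" and L: "\<And>a b. a < b \<Longrightarrow> measure M {a..b} \<le> L * (b - a)"
    and N: "N \<in> sets borel" "emeasure lborel N = 0"
  shows "emeasure M N = 0"
proof -
  interpret real_distribution M by fact
  have L0: "0 \<le> L" using order_trans[OF measure_nonneg L[of 0 1]] by simp
  have Ioc: "cdf M b - cdf M a \<le> L * (b - a)" "0 \<le> cdf M b - cdf M a" if "a \<le> b" for a b
  proof -
    have "cdf M b - cdf M a \<le> L * (b - a) \<and> 0 \<le> cdf M b - cdf M a"
    proof (cases "a = b")
      case False
      then have ab: "a < b" using that by simp
      then have "cdf M b - cdf M a = measure M {a<..b}" by (simp add: cdf_diff_eq)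
      also have "\<dots> \<le> measure M {a..b}" by (intro finite_measure_mono) auto
      also have "\<dots> \<le> L * (b - a)" by (rule L[OF ab])
      finally show ?thesis using cdf_nondecreasing[OF that] by simp
    qed simp
    then show "cdf M b - cdf M a \<le> L * (b - a)" "0 \<le> cdf M b - cdf M a" by auto
  qed
  define G where "G x = L * x - cdf M x" for x
  define I where "I = interval_measure G"
  have IG: "emeasure I {a<..b} = ennreal (G b - G a)" if "a \<le> b" for a b
    unfolding I_def
  proof (rule emeasure_interval_measure_Ioc[OF that])
    show "G x \<le> G y" if "x \<le> y" for x y using Ioc(1)[OF that] by (simp add: G_def algebra_simps)
    show "continuous (at_right x) G" for x
      unfolding G_def[abs_def] by (intro continuous_intros cdf_is_right_cont)
  qed
  define S where "S = measure_of UNIV (sets borel) (\<lambda>A. emeasure M A + emeasure I A)"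
  have setsS: "sets S = sets borel"
    using sets.sigma_sets_eq[of borel] by (simp add: S_def sets_measure_of_conv)
  have eS: "emeasure S A = emeasure M A + emeasure I A" if "A \<in> sets borel" for A
  proof (rule emeasure_measure_of[OF S_def])
    show "countably_additive (sets S) (\<lambda>A. emeasure M A + emeasure I A)"
      unfolding countably_additive_def
    proof (intro allI impI)
      fix F :: "nat \<Rightarrow> real set" assume F: "range F \<subseteq> sets S" "disjoint_family F"
      then have "(\<Sum>i. emeasure M (F i)) = emeasure M (\<Union>i. F i)" "(\<Sum>i. emeasure I (F i)) = emeasure I (\<Union>i. F i)"
        by (auto intro!: suminf_emeasure simp: setsS I_def)
      then show "(\<Sum>i. emeasure M (F i) + emeasure I (F i)) = emeasure M (\<Union>i. F i) + emeasure I (\<Union>i. F i)"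
        by (simp add: suminf_add[symmetric])
    qed
  qed (use that setsS in \<open>auto simp: positive_def\<close>)
  have "S = density lborel (\<lambda>_. ennreal L)"
  proof (rule measure_eqI_generator_eq[where E="range (\<lambda>(a, b). {a<..b::real})" and \<Omega>=UNIV
        and A="\<lambda>n. {- real n<..real n}"])
    show "Int_stable (range (\<lambda>(a, b). {a<..b::real}))"
      by (auto simp: Int_stable_def split: prod.splits)
    show "sets S = sigma_sets UNIV (range (\<lambda>(a, b). {a<..b::real}))"
      unfolding setsS by (subst borel_sigma_sets_Ioc) simp
    then show "sets (density lborel (\<lambda>_. ennreal L)) = sigma_sets UNIV (range (\<lambda>(a, b). {a<..b::real}))"
      by (simp add: setsS)
    have Ioc_eq: "emeasure S {a<..b} = ennreal (L * (b - a))" if "a \<le> b" for a b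
    proof -
      have "emeasure M {a<..b} = ennreal (cdf M b - cdf M a)"
        using that by (cases "a = b") (simp_all add: emeasure_eq_measure cdf_diff_eq)
      then have "emeasure S {a<..b} = ennreal (cdf M b - cdf M a) + ennreal (G b - G a)"
        using that by (simp add: eS IG)
      also have "\<dots> = ennreal ((cdf M b - cdf M a) + (G b - G a))"
        using Ioc[OF that] by (intro ennreal_plus[symmetric]) (auto simp: G_def algebra_simps)
      finally show ?thesis by (simp add: G_def algebra_simps)
    qed
    show "emeasure S X = emeasure (density lborel (\<lambda>_. ennreal L)) X"
      if Xr: "X \<in> range (\<lambda>(a, b). {a<..b::real})" for X
    proof -
      obtain a b where X: "X = {a<..b}" using Xr by auto
      show ?thesis
      proof (cases "a \<le> b")
        case True
        then show ?thesis using L0 unfolding X Ioc_eq[OF True]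
          by (simp add: emeasure_density nn_integral_cmult_indicator ennreal_mult)
      qed (simp add: X)
    qed
    show "(\<Union>i. {- real i<..real i}) = UNIV"
    proof (intro equalityI subsetI UNIV_I)
      fix x :: real
      obtain n :: nat where "\<bar>x\<bar> < real n" using reals_Archimedean2 by blast
      then show "x \<in> (\<Union>i. {- real i<..real i})" by (intro UN_I[of n]) auto
    qed
    show "emeasure S {- real i<..real i} \<noteq> \<infinity>" for i by (simp add: Ioc_eq)
  qed auto
  then have "emeasure S N = 0" using N by (simp add: emeasure_density nn_integral_cmult_indicator)
  then show ?thesis using eS[OF N(1)] by simp
qed


lemma cis_borel: "(\<lambda>x::real. cis (2 * pi * of_int k * x)) \<in> borel_measurable borel"
  by (intro borel_measurable_continuous_onI continuous_intros)

text \<open>Replacing \<open>x\<close> by \<open>c / x\<close> shifts the orbit by one step, because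
  characters of period 1 do not see the integer part. Only the first and the last term of the two
  averages survive, each of modulus at most 1.\<close>

lemma orbit_average_almost_invariant:
  "norm ((LINT x|orbit_average c n. cis (2 * pi * of_int k * x)) -
     (LINT x|orbit_average c n. cis (2 * pi * of_int k * (c / x)))) \<le> 2 / real (Suc n)"
proof -
  define e where "e x = cis (2 * pi * of_int k * x)" for x
  define a where "a j = (LINT x|unit_lebesgue. e ((gauss_map c ^^ j) x))" for j
  have e: "e \<in> borel_measurable borel" unfolding e_def using cis_borel .
  have ec: "e (c / x) = e (gauss_map c x)" for x by (simp add: e_def gauss_map_def cis_frac_multiple)
  have "(LINT x|orbit_average c n. e x) = (\<Sum>j\<le>n. a j) /\<^sub>R real (Suc n)"
    unfolding a_def by (rule integral_orbit_average[OF e, of 1]) (simp add: e_def)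
  moreover have "(LINT x|orbit_average c n. e (c / x)) = (\<Sum>j\<le>n. a (Suc j)) /\<^sub>R real (Suc n)"
  proof -
    have "(\<lambda>x. e (gauss_map c x)) \<in> borel_measurable borel" using e by measurable
    moreover have "norm (e (gauss_map c x)) \<le> 1" for x by (simp add: e_def)
    ultimately show ?thesis unfolding ec a_def by (subst integral_orbit_average) auto
  qed
  moreover have "(\<Sum>j\<le>n. a j) - (\<Sum>j\<le>n. a (Suc j)) = a 0 - a (Suc n)"
    by (simp add: sum_subtractf[symmetric] sum_telescope)
  ultimately have "(LINT x|orbit_average c n. e x) - (LINT x|orbit_average c n. e (c / x)) = (a 0 - a (Suc n)) /\<^sub>R real (Suc n)"
    by (metis scaleR_diff_right)
  moreover have "norm (a j) \<le> 1" for j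
  proof -
    have "norm (a j) \<le> (LINT x|unit_lebesgue. norm (e ((gauss_map c ^^ j) x)))"
      unfolding a_def by (rule integral_norm_bound)
    then show ?thesis by (simp add: e_def UL.prob_space[simplified])
  qed
  then have "norm (a 0 - a (Suc n)) \<le> 2"
    using norm_triangle_ineq4[of "a 0" "a (Suc n)"] by (smt (verit))
  ultimately show ?thesis by (simp add: e_def divide_simps)
qed

text \<open>The interval bound is carried over to the weak limit before invariance: it makes the
  limit absolutely continuous, in particular without mass at 0, the only possible discontinuity of
  \<open>cis (2 * pi * of_int k * (c / x))\<close>, and weak convergence then applies to this
  function too.\<close>

lemma gauss_invariant_measure_expanding:
  assumes c: "1 < c"
  shows "\<exists>M. real_distribution M \<and> measure M {0<..<1} = 1 \<and>
    (\<forall>N\<in>sets borel. emeasure lborel N = 0 \<longrightarrow> emeasure M N = 0) \<and>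
    (\<forall>k::int. (LINT x|M. cis (2 * pi * of_int k * x)) = (LINT x|M. cis (2 * pi * of_int k * (c / x))))"
proof -
  obtain s M where s: "strict_mono s" and M: "real_distribution M" and "weak_conv_m (orbit_average c \<circ> id \<circ> s) M"
    using tight_imp_convergent_subsubsequence[OF tight_orbit_average, of id c] by (auto simp: strict_mono_def)
  then have conv: "weak_conv_m (\<lambda>n. orbit_average c (s n)) M" by (simp add: comp_def)
  interpret M: real_distribution M by fact
  define \<mu> where "\<mu> n = orbit_average c (s n)" for n
  have rd: "real_distribution (\<mu> n)" for n unfolding \<mu>_def by (rule real_distribution_orbit_average)
  have cont: "(\<lambda>n. LINT x|\<mu> n. f x) \<longlonglongrightarrow> (LINT x|M. f x)"
    if "continuous_on UNIV f" "\<And>x. norm (f x) \<le> 1" for f :: "real \<Rightarrow> real"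
    using weak_conv_imp_bdd_ae_continuous_conv[OF rd M conv[folded \<mu>_def], of f 1] that
      borel_measurable_continuous_onI[OF that(1)]
    by (simp add: continuous_on_eq_continuous_at)
  let ?L = "1 + 2 / (c - 1)"
  have L: "measure M {a..b} \<le> ?L * (b - a)" if "a < b" for a b
  proof -
    have "measure M {a..b} \<le> ?L * (b - a + 2 * d)" if "d > 0" for d
    proof -
      \<comment> \<open>A trapezoid, 1 on \<open>[a, b]\<close> and 0 off
        \<open>[a - d, b + d]\<close>, replaces the indicator because weak convergence tests
        continuous functions; \<open>d\<close> tends to 0 at the end.\<close>
      define f where "f x = max 0 (min 1 (min ((x - a) / d + 1) ((b - x) / d + 1)))" for x
      have f: "continuous_on UNIV f" "\<And>x. norm (f x) \<le> 1" "\<And>x. 0 \<le> f x"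
        unfolding f_def using \<open>d > 0\<close> by (auto intro!: continuous_intros)
      have f1: "indicator {a..b} x \<le> f x" for x
        using \<open>d > 0\<close> by (auto simp: f_def indicator_def)
      have f2: "f x \<le> indicator {a - d..b + d} x" for x
      proof (cases "x \<in> {a - d..b + d}")
        case False
        then have "(x - a) / d + 1 \<le> 0 \<or> (b - x) / d + 1 \<le> 0"
          using \<open>d > 0\<close> by (auto simp: field_simps)
        then show ?thesis using False by (auto simp: f_def)
      qed (use f(2)[of x] in auto)
      have fm: "f \<in> borel_measurable borel" by (rule borel_measurable_continuous_onI[OF f(1)])
      have "measure M {a..b} = (LINT x|M. indicator {a..b} x)" by simp
      also have "\<dots> \<le> (LINT x|M. f x)"
        using f fm f1 by (intro integral_mono M.integrable_const_bound[of _ 1]) (auto simp: indicator_def)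
      also have "\<dots> \<le> ?L * (b - a + 2 * d)"
      proof (rule LIMSEQ_le_const2[OF cont[OF f(1,2)]])
        have "(LINT x|\<mu> n. f x) \<le> ?L * (b - a + 2 * d)" for n
        proof -
          interpret \<mu>: real_distribution "\<mu> n" by (rule rd)
          have "(LINT x|\<mu> n. f x) \<le> (LINT x|\<mu> n. indicator {a - d..b + d} x)"
            using f fm f2 by (intro integral_mono \<mu>.integrable_const_bound[of _ 1]) (auto simp: indicator_def)
          also have "\<dots> = measure (\<mu> n) {a - d..b + d}" by simp
          also have "\<dots> \<le> ?L * ((b + d) - (a - d))"
            unfolding \<mu>_def using \<open>a < b\<close> \<open>d > 0\<close> by (intro orbit_average_interval_le c) simp
          finally show ?thesis by (simp add: algebra_simps)
        qed
        then show "\<exists>N. \<forall>n\<ge>N. (LINT x|\<mu> n. f x) \<le> ?L * (b - a + 2 * d)" by blast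
      qed
      finally show ?thesis .
    qed
    note * = this
    have "(\<lambda>n. ?L * (b - a + 2 * inverse (real (Suc n)))) \<longlonglongrightarrow> ?L * (b - a + 2 * 0)"
      by (intro tendsto_intros LIMSEQ_inverse_real_of_nat)
    moreover have "measure M {a..b} \<le> ?L * (b - a + 2 * inverse (real (Suc n)))" for n by (rule *) simp
    ultimately have "measure M {a..b} \<le> ?L * (b - a + 2 * 0)" by (intro LIMSEQ_le_const) auto
    then show ?thesis by simp
  qed
  have ac: "emeasure M N = 0" if "N \<in> sets borel" "emeasure lborel N = 0" for N
    by (rule interval_bound_imp_absolutely_continuous[OF M L that])
  have supp: "measure M {0<..<1} = 1"
  proof -
    \<comment> \<open>This is the distance to \<open>[0, 1]\<close>, truncated at 1; its integral
      vanishes along the sequence and therefore in the limit. The endpoints are removed afterwards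
      as a null set.\<close>
    define f where "f x = min 1 (max 0 (max (- x) (x - 1)))" for x :: real
    have f: "continuous_on UNIV f" "\<And>x. norm (f x) \<le> 1" "\<And>x. 0 \<le> f x"
      unfolding f_def by (auto intro!: continuous_intros)
    have fm: "f \<in> borel_measurable borel" by (rule borel_measurable_continuous_onI[OF f(1)])
    have "(LINT x|\<mu> n. f x) = 0" for n
    proof -
      interpret \<mu>: real_distribution "\<mu> n" by (rule rd)
      have "AE x in \<mu> n. x \<in> {0..1}"
        using orbit_average_unit[of c "s n"] by (intro \<mu>.AE_prob_1) (simp add: \<mu>_def)
      then have "AE x in \<mu> n. f x = 0" by eventually_elim (auto simp: f_def)
      then show ?thesis using fm by (subst integral_cong_AE[where g="\<lambda>_. 0"]) auto
    qed
    then have "(LINT x|M. f x) = 0" using cont[OF f(1,2)] by (simp add: LIMSEQ_const_iff)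
    moreover have "integrable M f" using f fm by (intro M.integrable_const_bound[of _ 1]) auto
    ultimately have "AE x in M. f x = 0"
      using f(3) integral_nonneg_eq_0_iff_AE[of M f] by auto
    moreover have "AE x in M. x \<notin> {0, 1}"
      by (intro AE_not_in null_setsI ac) (auto intro!: emeasure_lborel_countable)
    ultimately have "AE x in M. x \<in> {0<..<1}"
      by eventually_elim (auto simp: f_def min_def max_def split: if_splits)
    then show ?thesis by (simp add: M.prob_eq_1)
  qed
  have inv: "(LINT x|M. cis (2 * pi * of_int k * x)) = (LINT x|M. cis (2 * pi * of_int k * (c / x)))" for k :: int
  proof -
    let ?e = "\<lambda>x. cis (2 * pi * of_int k * x)"
    have "continuous_on UNIV ?e" by (intro continuous_intros)
    then have e1: "isCont ?e x" for x by (simp add: continuous_on_eq_continuous_at)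
    have e2: "isCont (\<lambda>x. ?e (c / x)) x" if "x \<noteq> 0" for x :: real
      using that by (intro isCont_o2[OF _ e1] continuous_intros) auto
    have "(\<lambda>n. LINT x|\<mu> n. ?e x) \<longlonglongrightarrow> (LINT x|M. ?e x)"
      using weak_conv_imp_bdd_ae_continuous_conv[OF rd M conv[folded \<mu>_def], of ?e 1] e1 cis_borel[of k] by simp
    moreover have "(\<lambda>n. LINT x|\<mu> n. ?e (c / x)) \<longlonglongrightarrow> (LINT x|M. ?e (c / x))"
    proof (rule weak_conv_imp_bdd_ae_continuous_conv[OF rd M conv[folded \<mu>_def], where B=1])
      have "{x. \<not> isCont (\<lambda>x. ?e (c / x)) x} \<subseteq> {0}" using e2 by blast
      then have "emeasure M {x. \<not> isCont (\<lambda>x. ?e (c / x)) x} \<le> emeasure M {0}"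
        by (rule emeasure_mono) simp
      also have "emeasure M {0} = 0" by (rule ac) auto
      finally show "emeasure M {x. \<not> isCont (\<lambda>x. ?e (c / x)) x} = 0" by simp
      show "(\<lambda>x. ?e (c / x)) \<in> borel_measurable borel"
        by (rule measurable_compose[OF _ cis_borel]) measurable
    qed simp
    ultimately have "(\<lambda>n. (LINT x|\<mu> n. ?e x) - (LINT x|\<mu> n. ?e (c / x))) \<longlonglongrightarrow> (LINT x|M. ?e x) - (LINT x|M. ?e (c / x))"
      by (rule tendsto_diff)
    moreover have "(\<lambda>n. (LINT x|\<mu> n. ?e x) - (LINT x|\<mu> n. ?e (c / x))) \<longlonglongrightarrow> 0"
    proof (rule Lim_null_comparison)
      show "\<forall>\<^sub>F n in sequentially. norm ((LINT x|\<mu> n. ?e x) - (LINT x|\<mu> n. ?e (c / x))) \<le> 2 * inverse (real (Suc n))"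
      proof (intro always_eventually allI)
        fix n
        have "norm ((LINT x|\<mu> n. ?e x) - (LINT x|\<mu> n. ?e (c / x))) \<le> 2 / real (Suc (s n))"
          unfolding \<mu>_def by (rule orbit_average_almost_invariant)
        also have "\<dots> \<le> 2 / real (Suc n)"
          using seq_suble[OF s, of n] by (intro divide_left_mono) auto
        finally show "norm ((LINT x|\<mu> n. ?e x) - (LINT x|\<mu> n. ?e (c / x))) \<le> 2 * inverse (real (Suc n))"
          by (simp add: divide_inverse)
      qed
      have "(\<lambda>n. 2 * inverse (real (Suc n))) \<longlonglongrightarrow> 2 * 0"
        by (intro tendsto_intros LIMSEQ_inverse_real_of_nat)
      then show "(\<lambda>n. 2 * inverse (real (Suc n))) \<longlonglongrightarrow> 0" by simp
    qed
    ultimately show ?thesis using LIMSEQ_unique by fastforce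
  qed
  show ?thesis using M supp ac inv by blast
qed

text \<open>The bound \<open>2 / (c - 1)\<close> has no counterpart here, but the density
  \<open>1 / (1 + x)\<close> is explicit: summing over the branches reproduces it by telescoping. It
  stays unnormalised, since a positive finite mass is all that the construction asks for.\<close>

lemma gauss_invariant_measure_one:
  shows "\<exists>M. finite_measure M \<and> sets M = sets borel \<and> 0 < measure M UNIV \<and> (AE x in M. x \<in> {0<..<1}) \<and>
    (\<forall>N\<in>sets borel. emeasure lborel N = 0 \<longrightarrow> emeasure M N = 0) \<and>
    (\<forall>k::int. (LINT x|M. cis (2 * pi * of_int k * x)) = (LINT x|M. cis (2 * pi * of_int k * (1 / x))))"
proof -
  define w where "w x = ennreal (1 / (1 + x)) * indicator {0<..<1} x" for x :: real
  have w [measurable]: "w \<in> borel_measurable borel" unfolding w_def by measurable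
  define M where "M = density lborel w"
  have sM [simp, measurable_cong]: "sets M = sets borel" by (simp add: M_def)
  have spM [simp]: "space M = UNIV" by (simp add: M_def)
  have eM: "emeasure M A = (\<integral>\<^sup>+x. w x * indicator A x \<partial>lborel)" if "A \<in> sets borel" for A
    unfolding M_def using that by (intro emeasure_density) auto
  have "emeasure M UNIV \<le> (\<integral>\<^sup>+x. indicator {0<..<1::real} x \<partial>lborel)"
    unfolding eM[of UNIV, simplified] by (intro nn_integral_mono) (auto simp: w_def indicator_def)
  then have "emeasure M UNIV \<noteq> \<infinity>" by (auto simp: top_unique)
  then have fin: "finite_measure M" by (intro finite_measureI) simp
  interpret finite_measure M by (rule fin)
  have "ennreal (1 / 2) = (\<integral>\<^sup>+x. ennreal (1 / 2) * indicator {0<..<1::real} x \<partial>lborel)"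
    by (simp add: nn_integral_cmult_indicator)
  also have "\<dots> \<le> emeasure M UNIV"
    unfolding eM[of UNIV, simplified] w_def
  proof (intro nn_integral_mono)
    fix x :: real
    have "ennreal (1 / 2) * indicator {0<..<1} x \<le> ennreal (1 / (1 + x)) * indicator {0<..<1} x"
      if "x \<in> {0<..<1}"
      using that by (intro mult_right_mono ennreal_leI) (auto simp: field_simps)
    then show "ennreal (1 / 2) * indicator {0<..<1} x \<le> ennreal (1 / (1 + x)) * indicator {0<..<1} x"
      by (cases "x \<in> {0<..<1}") auto
  qed
  finally have "1 / 2 \<le> measure M UNIV"
    unfolding emeasure_eq_measure by (subst (asm) ennreal_le_iff) auto
  then have pos: "0 < measure M UNIV" by simp
  have supp: "AE x in M. x \<in> {0<..<1}"
    unfolding M_def by (subst AE_density) (auto simp: w_def indicator_def)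
  have ac: "emeasure M N = 0" if N: "N \<in> sets borel" "emeasure lborel N = 0" for N
  proof -
    have "AE x in lborel. x \<notin> N" using N by (intro AE_not_in) auto
    then have "AE x in lborel. w x * indicator N x = 0" by eventually_elim simp
    then show ?thesis unfolding eM[OF N(1)] using N by (subst nn_integral_0_iff_AE) auto
  qed
  have "countable ((\<lambda>n::int. 1 / real_of_int n) ` UNIV)" by simp
  moreover have "{x::real. frac (1 / x) = 0} \<subseteq> (\<lambda>n::int. 1 / real_of_int n) ` UNIV"
  proof
    fix x :: real assume "x \<in> {x. frac (1 / x) = 0}"
    then have "1 / x = of_int \<lfloor>1 / x\<rfloor>" by (simp add: frac_def)
    then have "x = 1 / of_int \<lfloor>1 / x\<rfloor>" by (metis div_by_1 divide_divide_eq_right mult_1)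
    then show "x \<in> (\<lambda>n::int. 1 / real_of_int n) ` UNIV" by blast
  qed
  ultimately have "countable {x::real. frac (1 / x) = 0}" by (rule countable_subset[rotated])
  \<comment> \<open>The preimage of 0 has to be discarded, because the change of variables concerns
    sets inside the open interval.\<close>
  then have Z: "AE x in lborel. frac (1 / x :: real) \<noteq> 0"
    using AE_not_in[OF countable_imp_null_set_lborel] by fastforce
  have "distr M borel (gauss_map 1) = M"
  proof (rule measure_eqI)
    fix A :: "real set" assume "A \<in> sets (distr M borel (gauss_map 1))"
    then have A: "A \<in> sets borel" by simp
    let ?E = "A \<inter> {0<..<1}"
    have vb: "{x. gauss_map 1 x \<in> A} \<in> sets borel"
      using measurable_sets[OF gauss_map_measurable A] by (simp add: vimage_def)
    have "emeasure (distr M borel (gauss_map 1)) A = emeasure M {x. gauss_map 1 x \<in> A}"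
      using A by (subst emeasure_distr) (auto simp: vimage_def)
    also have "\<dots> = (\<integral>\<^sup>+x. w x * indicator {x. gauss_map 1 x \<in> A} x \<partial>lborel)" by (rule eM[OF vb])
    also have "\<dots> = (\<integral>\<^sup>+x. ennreal (1 / (1 + x)) * indicator {x. 0 < x \<and> x \<le> 1 \<and> frac (1 / x) \<in> ?E} x \<partial>lborel)"
    proof (rule nn_integral_cong_AE)
      show "AE x in lborel. w x * indicator {x. gauss_map 1 x \<in> A} x =
          ennreal (1 / (1 + x)) * indicator {x. 0 < x \<and> x \<le> 1 \<and> frac (1 / x) \<in> ?E} x"
        using Z
      proof eventually_elim
        case (elim x)
        then have "frac (1 / x) \<in> {0<..<1}" "x \<noteq> 1"
          using frac_ge_0[of "1 / x"] frac_lt_1[of "1 / x"] by auto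
        then show ?case by (auto simp: w_def indicator_def gauss_map_def)
      qed
    qed
    also have "\<dots> = (\<integral>\<^sup>+x. (\<Sum>j. ennreal (1 / ((x + real j + 1) * (x + real j + 1 + 1)))) * indicator ?E x \<partial>lborel)"
      using A by (intro nn_integral_gauss_preimage) auto
    also have "\<dots> = (\<integral>\<^sup>+x. w x * indicator A x \<partial>lborel)"
    proof (rule nn_integral_cong)
      fix x :: real
      show "(\<Sum>j. ennreal (1 / ((x + real j + 1) * (x + real j + 1 + 1)))) * indicator ?E x = w x * indicator A x"
      proof (cases "x \<in> {0<..<1}")
        case True
        then have "(\<Sum>j. ennreal (1 / ((x + real j + 1) * (x + real j + 1 + 1)))) = ennreal (1 / (1 + x))"
          using sums_telescope_reciprocal[of x] by (intro suminf_ennreal_eq) (auto simp: add.assoc)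
        then show ?thesis using True by (auto simp: w_def indicator_def)
      qed (auto simp: w_def)
    qed
    also have "\<dots> = emeasure M A" by (rule eM[OF A, symmetric])
    finally show "emeasure (distr M borel (gauss_map 1)) A = emeasure M A" .
  qed simp
  note inv = this
  have "(LINT x|M. cis (2 * pi * of_int k * x)) = (LINT x|M. cis (2 * pi * of_int k * (1 / x)))" for k :: int
  proof -
    have "(LINT x|M. cis (2 * pi * of_int k * x)) = (LINT x|distr M borel (gauss_map 1). cis (2 * pi * of_int k * x))"
      by (simp only: inv)
    also have "\<dots> = (LINT x|M. cis (2 * pi * of_int k * gauss_map 1 x))"
      by (rule integral_distr[OF _ cis_borel]) measurable
    finally show ?thesis by (simp only: gauss_map_def cis_frac_multiple)
  qed
  then show ?thesis using fin pos supp ac by (intro exI[of _ M]) simp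
qed

lemma gauss_invariant_measure:
  assumes "1 \<le> c"
  shows "\<exists>M. finite_measure M \<and> sets M = sets borel \<and> 0 < measure M UNIV \<and> (AE x in M. x \<in> {0<..<1}) \<and>
    (\<forall>N\<in>sets borel. emeasure lborel N = 0 \<longrightarrow> emeasure M N = 0) \<and>
    (\<forall>k::int. (LINT x|M. cis (2 * pi * of_int k * x)) = (LINT x|M. cis (2 * pi * of_int k * (c / x))))"
proof (cases "c = 1")
  case True
  then show ?thesis using gauss_invariant_measure_one by simp
next
  case False
  then obtain M where M: "real_distribution M" and one: "measure M {0<..<1} = 1"
    and rest: "\<forall>N\<in>sets borel. emeasure lborel N = 0 \<longrightarrow> emeasure M N = 0"
      "\<forall>k::int. (LINT x|M. cis (2 * pi * of_int k * x)) = (LINT x|M. cis (2 * pi * of_int k * (c / x)))"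
    using gauss_invariant_measure_expanding[of c] assms by auto
  interpret real_distribution M by fact
  have "measure M UNIV = 1" using prob_space by simp
  then show ?thesis
    using rest AE_prob_1[OF one] finite_measure_axioms by (intro exI[of _ M]) simp
qed

section \<open>Transfer to the hyperbola\<close>

lemma hyperbola_param_vimage_borel:
  assumes A: "A \<in> sets borel"
  shows "{t. t \<noteq> 0 \<and> hyperbola_param M t \<in> A} \<in> sets borel"
proof -
  have "- {0} \<inter> {t. hyperbola_param M t \<in> A} \<in> sets borel"
    using measurable_sets[OF hyperbola_param_measurable A, of M] by (intro sets.Int) (auto simp: vimage_def)
  moreover have "- {0} \<inter> {t. hyperbola_param M t \<in> A} = {t. t \<noteq> 0 \<and> hyperbola_param M t \<in> A}" by auto
  ultimately show ?thesis by simp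
qed

text \<open>The speed of the parametrisation never vanishes, its first component being 1, so arc
  length and Lebesgue measure in the parameter have the same null sets.\<close>

lemma hyperbola_arc_length_null_iff:
  assumes A: "A \<in> sets borel"
  shows "emeasure (hyperbola_arc_length M) A = 0 \<longleftrightarrow>
    emeasure lborel {t. t \<noteq> 0 \<and> hyperbola_param M t \<in> A} = 0"
proof -
  let ?R = "restrict_space lborel (- {0::real})"
  define v where "v t = ennreal (norm (vector_derivative (hyperbola_param M) (at t)))" for t
  have v: "v t = ennreal (norm (1 :: real, - M\<^sup>2 / (4 * pi\<^sup>2 * t\<^sup>2)))" if "t \<noteq> 0" for t
    unfolding v_def using vector_derivative_at[OF hyperbola_param_has_vector_derivative[OF that]] by simp
  have v0: "v t \<noteq> 0" if "t \<noteq> 0" for t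
    using that by (simp add: v zero_prod_def)
  have "(\<lambda>t. ennreal (norm (1 :: real, - M\<^sup>2 / (4 * pi\<^sup>2 * t\<^sup>2)))) \<in> borel_measurable ?R"
    by (intro measurable_restrict_space1) measurable
  then have vm: "v \<in> borel_measurable ?R"
    by (rule measurable_cong[THEN iffD1, rotated]) (simp add: v space_restrict_space)
  have pm: "hyperbola_param M \<in> measurable (density ?R v) borel"
    by (simp add: measurable_restrict_space1)
  have Sb: "{t. t \<noteq> 0 \<and> hyperbola_param M t \<in> A} \<in> sets borel"
    by (rule hyperbola_param_vimage_borel[OF A])
  let ?B = "hyperbola_param M -` A \<inter> - {0}"
  have B: "?B \<in> sets ?R"
  proof -
    have "?B = {t. t \<noteq> 0 \<and> hyperbola_param M t \<in> A}" by auto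
    then have "?B \<in> sets lborel" using Sb by simp
    then show ?thesis unfolding sets_restrict_space by (intro image_eqI[of _ _ ?B]) auto
  qed
  have "emeasure (hyperbola_arc_length M) A = emeasure (density ?R v) ?B"
    unfolding hyperbola_arc_length_def arc_length_measure_def v_def[symmetric]
    using A pm by (subst emeasure_distr) (auto simp: v_def space_restrict_space)
  also have "\<dots> = (\<integral>\<^sup>+t. v t * indicator ?B t \<partial>?R)" by (rule emeasure_density[OF vm B])
  also have "\<dots> = 0 \<longleftrightarrow> (AE t in ?R. v t * indicator ?B t = 0)"
    using vm B by (intro nn_integral_0_iff_AE) auto
  also have "\<dots> \<longleftrightarrow> (AE t in lborel. t \<in> - {0} \<longrightarrow> v t * indicator ?B t = 0)"
    by (rule AE_restrict_space_iff) simp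
  also have "\<dots> \<longleftrightarrow> (AE t in lborel. t \<notin> {t. t \<noteq> 0 \<and> hyperbola_param M t \<in> A})"
    using v0 by (intro AE_cong) (auto simp: indicator_def)
  also have "\<dots> \<longleftrightarrow> emeasure lborel {t. t \<noteq> 0 \<and> hyperbola_param M t \<in> A} = 0"
    using Sb by (subst AE_iff_null_sets[symmetric]) (auto simp: null_sets_def)
  finally show ?thesis .
qed


text \<open>Each axis of the cross yields one condition. The sign \<open>e\<close> selects the
  branch on which the coordinates will be positive, and the symmetry of the cross under reflection
  absorbs it.\<close>

lemma AC_hyperbola_coordinate_null:
  assumes M: "M \<noteq> 0" and \<mu>: "\<mu> \<in> AC_hyperbola M (lattice_cross \<alpha> \<beta>)" and E: "E \<in> sets borel"
    and e: "e = 1 \<or> e = - 1"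
  shows "\<mu> {x. frac (e * \<alpha> * fst x / 2) \<in> E} = 0" "\<mu> {x. frac (e * \<beta> * snd x / 2) \<in> E} = 0"
proof -
  have cm: "complex_borel_measure \<mu>" and van: "\<And>\<xi>. \<xi> \<in> lattice_cross \<alpha> \<beta> \<Longrightarrow> fourier \<mu> \<xi> = 0"
    using \<mu> by (auto simp: AC_hyperbola_def AC_vanishing_def AC_def)
  have ke: "of_int k * e \<in> \<int>" for k :: int using e by auto
  have "fourier \<mu> (of_int k *\<^sub>R (e * \<alpha>, 0)) = 0" for k :: int
  proof (rule van)
    have "of_int k * (e * \<alpha>) = \<alpha> * (of_int k * e)" by simp
    then show "of_int k *\<^sub>R (e * \<alpha>, 0) \<in> lattice_cross \<alpha> \<beta>" using ke by (auto simp: lattice_cross_def)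
  qed
  from fourier_vanishing_imp_frac_null[OF cm this E]
  show "\<mu> {x. frac (e * \<alpha> * fst x / 2) \<in> E} = 0"
    by (simp add: inner_prod_def mult.commute)
  have "fourier \<mu> (of_int k *\<^sub>R (0, e * \<beta>)) = 0" for k :: int
  proof (rule van)
    have "of_int k * (e * \<beta>) = \<beta> * (of_int k * e)" by simp
    then show "of_int k *\<^sub>R (0, e * \<beta>) \<in> lattice_cross \<alpha> \<beta>" using ke by (auto simp: lattice_cross_def)
  qed
  from fourier_vanishing_imp_frac_null[OF cm this E]
  show "\<mu> {x. frac (e * \<beta> * snd x / 2) \<in> E} = 0"
    by (simp add: inner_prod_def mult.commute)
qed

text \<open>On the chosen branch \<open>s\<close> is a positive coordinate, and the equation of the
  hyperbola turns the second condition into one about \<open>c / s\<close>. The image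
  \<open>D\<close> of \<open>\<nu>\<close> under \<open>s\<close> thus satisfies both periodicities
  on the half-line, and since \<open>s\<close> is injective on the branch, vanishing of
  \<open>D\<close> gives vanishing of \<open>\<nu>\<close>.\<close>

lemma signed_measure_on_branch_eq_0:
  fixes \<nu> :: "(real \<times> real) set \<Rightarrow> real"
  assumes pos: "0 < \<alpha>" "0 < \<beta>" "0 < M" and small: "\<alpha> * \<beta> * M\<^sup>2 < 16 * pi\<^sup>2" and e: "e = 1 \<or> e = - 1"
    and \<nu>: "signed_measure \<nu>"
    and off: "\<And>A. A \<in> sets borel \<Longrightarrow> A \<inter> {x \<in> hyperbola M. 0 < e * fst x} = {} \<Longrightarrow> \<nu> A = 0"
    and ac: "\<And>A. A \<in> sets borel \<Longrightarrow> emeasure (hyperbola_arc_length M) A = 0 \<Longrightarrow> \<nu> A = 0"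
    and per1: "\<And>E. E \<in> sets borel \<Longrightarrow> \<nu> {x. frac (e * \<alpha> * fst x / 2) \<in> E} = 0"
    and per2: "\<And>E. E \<in> sets borel \<Longrightarrow> \<nu> {x. frac (e * \<beta> * snd x / 2) \<in> E} = 0"
    and A: "A \<in> sets borel"
  shows "\<nu> A = 0"
proof -
  define c where "c = \<alpha> * \<beta> * M\<^sup>2 / (16 * pi\<^sup>2)"
  have c: "0 < c" "c < 1" using pos small by (auto simp: c_def)
  have ee: "e * e = 1" "e \<noteq> 0" using e by auto
  define s where "s x = e * \<alpha> * fst x / 2" for x :: "real \<times> real"
  define G where "G = {x \<in> hyperbola M. 0 < e * fst x}"
  have sm: "s \<in> borel_measurable borel" unfolding s_def by (intro borel_measurable_continuous_onI continuous_intros) auto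
  have vim: "{x. f x \<in> B} \<in> sets borel" if "f \<in> borel_measurable borel" "B \<in> sets borel"
    for f :: "real \<times> real \<Rightarrow> real" and B
    using measurable_sets[OF that] by (simp add: vimage_def)
  have hb: "hyperbola M \<in> sets borel"
  proof -
    have "(\<lambda>x::real \<times> real. fst x * snd x) \<in> borel_measurable borel"
      by (intro borel_measurable_continuous_onI continuous_intros)
    from vim[OF this, of "{M\<^sup>2 / (4 * pi\<^sup>2)}"] show ?thesis by (simp add: hyperbola_def)
  qed
  have G: "G \<in> sets borel"
  proof -
    have "(\<lambda>x::real \<times> real. e * fst x) \<in> borel_measurable borel"
      by (intro borel_measurable_continuous_onI continuous_intros)
    from vim[OF this, of "{0<..}"] have "hyperbola M \<inter> {x. e * fst x \<in> {0<..}} \<in> sets borel"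
      using hb by (intro sets.Int) auto
    moreover have "hyperbola M \<inter> {x. e * fst x \<in> {0<..}} = G" by (auto simp: G_def)
    ultimately show ?thesis by simp
  qed
  have \<nu>G: "\<nu> B = \<nu> (B \<inter> G)" if "B \<in> sets borel" for B
  proof -
    have "\<nu> (B - G) = 0" using that G by (intro off) (auto simp: G_def)
    then show ?thesis using signed_measure_split[OF \<nu> that G] by simp
  qed
  have sG: "0 < s x" "c / s x = e * \<beta> * snd x / 2" "hyperbola_param M (2 * e * s x / \<alpha>) = x" if "x \<in> G" for x
  proof -
    have "0 < e * fst x" using that by (simp add: G_def)
    from mult_pos_pos[OF pos(1) this] have "0 < \<alpha> * (e * fst x) / 2" by linarith
    moreover have "s x = \<alpha> * (e * fst x) / 2" by (simp add: s_def)
    ultimately show "0 < s x" by simp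
    have f0: "fst x \<noteq> 0" using that by (auto simp: G_def)
    have x: "fst x * snd x = M\<^sup>2 / (4 * pi\<^sup>2)" using that by (simp add: G_def hyperbola_def)
    then have snd: "snd x = M\<^sup>2 / (4 * pi\<^sup>2) / fst x" using f0 by (simp add: eq_divide_eq mult_ac)
    have "c / s x = (e * e) * (\<beta> * M\<^sup>2 / (8 * pi\<^sup>2)) / (e * fst x)"
      using ee pos f0 by (simp add: c_def s_def field_simps)
    also have "\<dots> = e * \<beta> * snd x / 2" using ee(2) f0 by (simp add: snd field_simps)
    finally show "c / s x = e * \<beta> * snd x / 2" .
    have "2 * e * s x / \<alpha> = (e * e) * fst x" using pos by (simp add: s_def)
    then show "hyperbola_param M (2 * e * s x / \<alpha>) = x"
      using ee(1) snd by (simp add: hyperbola_param_def prod_eq_iff)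
  qed
  define D where "D B = \<nu> {x. s x \<in> B}" for B
  have D: "signed_measure D"
    unfolding signed_measure_def D_def
  proof (intro allI impI)
    fix F :: "nat \<Rightarrow> real set" assume F: "range F \<subseteq> sets borel" "disjoint_family F"
    have "disjoint_family (\<lambda>n. {x. s x \<in> F n})" using F(2) unfolding disjoint_family_on_def by blast
    then have "(\<lambda>n. \<nu> {x. s x \<in> F n}) sums \<nu> (\<Union>n. {x. s x \<in> F n})"
      using F(1) by (intro signed_measureD[OF \<nu>] vim sm) auto
    moreover have "(\<Union>n. {x. s x \<in> F n}) = {x. s x \<in> (\<Union>n. F n)}" by auto
    ultimately show "(\<lambda>n. \<nu> {x. s x \<in> F n}) sums \<nu> {x. s x \<in> (\<Union>n. F n)}" by simp
  qed
  have D0: "D B = 0" if B: "B \<in> sets borel" for B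
  proof (rule hyperbola_branch_uniqueness[OF c D _ _ _ _ B])
    fix B :: "real set" assume B: "B \<in> sets borel"
    show "D B = 0" if "B \<inter> {0<..} = {}"
      unfolding D_def using that sG(1) by (intro off vim[OF sm B]) (force simp: G_def[symmetric])
    show "D B = 0" if N: "emeasure lborel B = 0"
      unfolding D_def
    proof (rule ac[OF vim[OF sm B]])
      have "e * \<alpha> / 2 \<noteq> 0" using ee pos by simp
      from null_set_scale[OF this B N] have "emeasure lborel {t. e * \<alpha> / 2 * t \<in> B} = 0" .
      moreover have "{t. e * \<alpha> / 2 * t \<in> B} \<in> sets borel"
        by (rule scale_vimage_borel[OF B])
      ultimately have "emeasure lborel {t. t \<noteq> 0 \<and> hyperbola_param M t \<in> {x. s x \<in> B}} \<le> 0"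
        using emeasure_mono[of "{t. t \<noteq> 0 \<and> hyperbola_param M t \<in> {x. s x \<in> B}}" "{t. e * \<alpha> / 2 * t \<in> B}" lborel]
        by (auto simp: s_def hyperbola_param_def)
      then show "emeasure (hyperbola_arc_length M) {x. s x \<in> B} = 0"
        using hyperbola_arc_length_null_iff[OF vim[OF sm B]] by simp
    qed
    show "D {x. frac x \<in> B} = 0" using per1[OF B] by (simp add: D_def s_def)
    \<comment> \<open>The identity \<open>c / s x = e * \<beta> * snd x / 2\<close> is available on
      the branch, so both sets are cut down to \<open>G\<close>, which carries
      \<open>\<nu>\<close>.\<close>
    have "{x. frac (c / s x) \<in> B} \<inter> G = {x. frac (e * \<beta> * snd x / 2) \<in> B} \<inter> G"
    proof (rule set_eqI)
      fix x
      show "x \<in> {x. frac (c / s x) \<in> B} \<inter> G \<longleftrightarrow> x \<in> {x. frac (e * \<beta> * snd x / 2) \<in> B} \<inter> G"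
        by (cases "x \<in> G") (simp_all only: Int_iff mem_Collect_eq sG(2) simp_thms)
    qed
    moreover have "{x. frac (c / s x) \<in> B} \<in> sets borel" using sm by (intro vim B) measurable
    moreover have "{x::real \<times> real. frac (e * \<beta> * snd x / 2) \<in> B} \<in> sets borel"
    proof -
      have "(\<lambda>x::real \<times> real. e * \<beta> * snd x / 2) \<in> borel_measurable borel"
        by (intro borel_measurable_continuous_onI continuous_intros) auto
      from vim[OF measurable_compose[OF this borel_measurable_frac] B] show ?thesis .
    qed
    ultimately show "D {x. frac (c / x) \<in> B} = 0"
      using per2[OF B] \<nu>G[of "{x. frac (c / s x) \<in> B}"] \<nu>G[of "{x. frac (e * \<beta> * snd x / 2) \<in> B}"]
      by (simp add: D_def)
  qed
  define B where "B = {t. hyperbola_param M (2 * e * t / \<alpha>) \<in> A}"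
  have B: "B \<in> sets borel"
  proof -
    have "(\<lambda>t. hyperbola_param M (2 * e * t / \<alpha>)) \<in> borel_measurable borel" by measurable
    from measurable_sets[OF this A] show ?thesis by (simp add: B_def vimage_def)
  qed
  have "A \<inter> G = {x. s x \<in> B} \<inter> G" using sG(3) by (auto simp: B_def)
  then show ?thesis using \<nu>G[OF A] \<nu>G[OF vim[OF sm B]] D0[OF B] by (simp add: D_def)
qed


section \<open>A nonzero measure carried by a single branch\<close>

lemma jordan_pos_zero: "jordan_pos (\<lambda>A::'a::topological_space set. 0) = null_measure borel"
proof (rule measure_eqI)
  fix A :: "'a set" assume "A \<in> sets (jordan_pos (\<lambda>A. 0))"
  moreover have "signed_measure (\<lambda>A::'a set. 0)" by (simp add: signed_measure_def)
  moreover have "positive_set (\<lambda>A::'a set. 0) UNIV" "positive_set (\<lambda>A::'a set. - 0) (- UNIV)"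
    by (auto simp: positive_set_def)
  ultimately show "emeasure (jordan_pos (\<lambda>A. 0)) A = emeasure (null_measure borel) A"
    using emeasure_jordan_pos[of "\<lambda>A::'a set. 0" UNIV A] by simp
qed simp

lemma zero_in_AC_hyperbola: "(\<lambda>A. 0) \<in> AC_hyperbola M \<Lambda>"
  by (simp add: AC_hyperbola_def AC_vanishing_def AC_def complex_borel_measure_def
      fourier_def cmeasure_integral_def jordan_pos_zero)

text \<open>\<open>H\<close> separates the two images up to null sets and is therefore a Hahn set
  for their difference. So the images are themselves the Jordan parts, and the transform becomes a
  difference of integrals over \<open>m\<close>.\<close>

lemma fourier_difference_of_images:
  fixes m :: "real measure" and X Y :: "real \<Rightarrow> real \<times> real"
  assumes m: "finite_measure m" "sets m = sets borel"
    and X: "X \<in> borel_measurable borel" and Y: "Y \<in> borel_measurable borel"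
    and H: "H \<in> sets borel" "AE t in m. X t \<in> H" "AE t in m. Y t \<notin> H"
  defines "\<mu> \<equiv> (\<lambda>A. if A \<in> sets borel then complex_of_real (measure m {t. X t \<in> A} - measure m {t. Y t \<in> A}) else 0)"
  shows "complex_borel_measure \<mu>"
    and "fourier \<mu> \<xi> = (LINT t|m. exp (\<i> * of_real (pi * (X t \<bullet> \<xi>)))) - (LINT t|m. exp (\<i> * of_real (pi * (Y t \<bullet> \<xi>))))"
proof -
  interpret finite_measure m by fact
  have sp: "space m = UNIV" using m(2) by (metis sets_eq_imp_space_eq space_borel)
  have Xm: "X \<in> measurable m borel" and Ym: "Y \<in> measurable m borel"
    using X Y m(2) by (simp_all cong: measurable_cong_sets)
  have vX: "{t. X t \<in> A} \<in> sets m" if "A \<in> sets borel" for A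
    using measurable_sets[OF Xm that] by (simp add: vimage_def sp)
  have vY: "{t. Y t \<in> A} \<in> sets m" if "A \<in> sets borel" for A
    using measurable_sets[OF Ym that] by (simp add: vimage_def sp)
  define \<nu> where "\<nu> A = (if A \<in> sets borel then measure m {t. X t \<in> A} - measure m {t. Y t \<in> A} else 0)" for A
  have sums: "(\<lambda>n. measure m {t. X t \<in> F n} - measure m {t. Y t \<in> F n}) sums
      (measure m {t. X t \<in> (\<Union>n. F n)} - measure m {t. Y t \<in> (\<Union>n. F n)})"
    if F: "range F \<subseteq> sets borel" "disjoint_family F" for F :: "nat \<Rightarrow> (real \<times> real) set"
  proof -
    have "disjoint_family (\<lambda>n. {t. X t \<in> F n})" "disjoint_family (\<lambda>n. {t. Y t \<in> F n})"
      using F(2) unfolding disjoint_family_on_def by blast+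
    then have "(\<lambda>n. measure m {t. X t \<in> F n}) sums measure m (\<Union>n. {t. X t \<in> F n})"
      "(\<lambda>n. measure m {t. Y t \<in> F n}) sums measure m (\<Union>n. {t. Y t \<in> F n})"
      using F(1) vX vY by (auto intro!: finite_measure_UNION)
    moreover have "(\<Union>n. {t. X t \<in> F n}) = {t. X t \<in> (\<Union>n. F n)}" "(\<Union>n. {t. Y t \<in> F n}) = {t. Y t \<in> (\<Union>n. F n)}"
      by auto
    ultimately show ?thesis by (simp add: sums_diff)
  qed
  have \<mu>: "\<mu> = (\<lambda>A. complex_of_real (\<nu> A))" by (auto simp: \<mu>_def \<nu>_def)
  have UNb: "(\<Union>n. F n) \<in> sets borel" if "range F \<subseteq> sets borel" for F :: "nat \<Rightarrow> (real \<times> real) set"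
    using that by auto
  have \<nu>: "signed_measure \<nu>"
    unfolding signed_measure_def
  proof (intro allI impI)
    fix F :: "nat \<Rightarrow> (real \<times> real) set" assume F: "range F \<subseteq> sets borel" "disjoint_family F"
    have "F n \<in> sets borel" for n using F by auto
    then show "(\<lambda>n. \<nu> (F n)) sums \<nu> (\<Union>n. F n)" using sums[OF F] UNb[OF F(1)] by (simp add: \<nu>_def)
  qed
  then show "complex_borel_measure \<mu>"
    unfolding complex_borel_measure_def \<mu> signed_measure_def
  proof (intro conjI allI impI sums_of_real)
    show "complex_of_real (\<nu> A) = 0" if "A \<notin> sets borel" for A using that by (simp add: \<nu>_def)
  qed blast
  have X0: "measure m {t. X t \<in> B} = 0" if "B \<in> sets borel" "B \<subseteq> - H" for B
  proof -
    have "AE t in m. t \<notin> {t. X t \<in> B}" using H(2) by eventually_elim (use that in auto)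
    then show ?thesis using vX[OF that(1)] AE_iff_null_sets measure_eq_0_null_sets by blast
  qed
  have Y0: "measure m {t. Y t \<in> B} = 0" if "B \<in> sets borel" "B \<subseteq> H" for B
  proof -
    have "AE t in m. t \<notin> {t. Y t \<in> B}" using H(3) by eventually_elim (use that in auto)
    then show ?thesis using vY[OF that(1)] AE_iff_null_sets measure_eq_0_null_sets by blast
  qed
  have pos: "positive_set \<nu> H" "positive_set (\<lambda>A. - \<nu> A) (- H)"
    using H(1) X0 Y0 by (auto simp: positive_set_def \<nu>_def)
  have split: "measure m {t. Z t \<in> A} = measure m {t. Z t \<in> A \<inter> H} + measure m {t. Z t \<in> A \<inter> - H}"
    if A: "A \<in> sets borel" and Z: "\<And>B. B \<in> sets borel \<Longrightarrow> {t. Z t \<in> B} \<in> sets m" for A and Z :: "real \<Rightarrow> real \<times> real"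
  proof -
    have "{t. Z t \<in> A} = {t. Z t \<in> A \<inter> H} \<union> {t. Z t \<in> A \<inter> - H}" by auto
    then show ?thesis using A H(1) by (simp only:) (intro finite_measure_Union Z; auto)
  qed
  have jX: "jordan_pos \<nu> = distr m borel X"
  proof (rule measure_eqI)
    fix A :: "(real \<times> real) set" assume "A \<in> sets (jordan_pos \<nu>)"
    then have A: "A \<in> sets borel" by simp
    have "\<nu> (A \<inter> H) = measure m {t. X t \<in> A}"
      using A H(1) split[OF A vX] X0[of "A \<inter> - H"] Y0[of "A \<inter> H"] by (simp add: \<nu>_def)
    then show "emeasure (jordan_pos \<nu>) A = emeasure (distr m borel X) A"
      using A Xm by (simp add: emeasure_jordan_pos[OF \<nu> pos] emeasure_distr emeasure_eq_measure vimage_def sp)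
  qed simp
  have jY: "jordan_pos (\<lambda>A. - \<nu> A) = distr m borel Y"
  proof (rule measure_eqI)
    fix A :: "(real \<times> real) set" assume "A \<in> sets (jordan_pos (\<lambda>A. - \<nu> A))"
    then have A: "A \<in> sets borel" by simp
    have "- \<nu> (A \<inter> - H) = measure m {t. Y t \<in> A}"
      using A H(1) split[OF A vY] X0[of "A \<inter> - H"] Y0[of "A \<inter> H"] by (simp add: \<nu>_def)
    moreover have "positive_set (\<lambda>A. - (- \<nu> A)) (- (- H))" using pos by simp
    ultimately show "emeasure (jordan_pos (\<lambda>A. - \<nu> A)) A = emeasure (distr m borel Y) A"
      using A Ym emeasure_jordan_pos[OF signed_measure_uminus[OF \<nu>] pos(2) _ A]
      by (simp add: emeasure_distr emeasure_eq_measure vimage_def sp)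
  qed simp
  have f: "(\<lambda>x. exp (\<i> * of_real (pi * (x \<bullet> \<xi>)))) \<in> borel_measurable borel"
    by (intro borel_measurable_continuous_onI continuous_intros)
  show "fourier \<mu> \<xi> = (LINT t|m. exp (\<i> * of_real (pi * (X t \<bullet> \<xi>)))) - (LINT t|m. exp (\<i> * of_real (pi * (Y t \<bullet> \<xi>))))"
    unfolding fourier_def cmeasure_integral_def \<mu>
    unfolding Re_complex_of_real Im_complex_of_real minus_zero jX jY jordan_pos_zero
      integral_distr[OF Xm f] integral_distr[OF Ym f] by simp
qed

text \<open>Almost everywhere \<open>X t\<close> has coordinate \<open>s = t < 1\<close> and
  \<open>Y t\<close> has \<open>s = c / t > 1\<close>, so \<open>1 \<le> c\<close> keeps the two
  copies apart. On the first axis the transform compares coefficients at \<open>t\<close> and at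
  \<open>c / t\<close>, on the second the same two with roles exchanged; invariance makes both
  differences vanish.\<close>

lemma exists_nonzero_measure_on_branch:
  assumes pos: "0 < \<alpha>" "0 < \<beta>" "0 < M" and large: "16 * pi\<^sup>2 \<le> \<alpha> * \<beta> * M\<^sup>2" and e: "e = 1 \<or> e = - 1"
  shows "\<exists>\<mu>\<in>AC_hyperbola M (lattice_cross \<alpha> \<beta>). \<mu> \<noteq> (\<lambda>A. 0) \<and>
    (\<forall>A\<in>sets borel. A \<inter> {x. 0 < e * fst x} = {} \<longrightarrow> \<mu> A = 0)"
proof -
  define c where "c = \<alpha> * \<beta> * M\<^sup>2 / (16 * pi\<^sup>2)"
  have c: "1 \<le> c" using large by (simp add: c_def)
  have ee: "e * e = 1" "e \<noteq> 0" using e by auto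
  obtain m where fin: "finite_measure m" and sm: "sets m = sets borel" and mpos: "0 < measure m UNIV"
    and supp: "AE t in m. t \<in> {0<..<1}"
    and ac: "\<And>N. N \<in> sets borel \<Longrightarrow> emeasure lborel N = 0 \<Longrightarrow> emeasure m N = 0"
    and inv: "\<And>k::int. (LINT x|m. cis (2 * pi * of_int k * x)) = (LINT x|m. cis (2 * pi * of_int k * (c / x)))"
    using gauss_invariant_measure[OF c] by blast
  interpret finite_measure m by (rule fin)
  have sp: "space m = UNIV" using sm by (metis sets_eq_imp_space_eq space_borel)
  define X where "X t = hyperbola_param M (2 * e / \<alpha> * t)" for t
  define Y where "Y t = X (c / t)" for t
  have X: "X \<in> borel_measurable borel" unfolding X_def by measurable
  have Y: "Y \<in> borel_measurable borel" unfolding Y_def using X by measurable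
  define H where "H = {x::real \<times> real. e * \<alpha> * fst x / 2 < 1}"
  have H: "H \<in> sets borel"
    unfolding H_def by (intro borel_open open_Collect_less continuous_intros) auto
  have sX: "e * \<alpha> * fst (X t) / 2 = t" for t
    using ee pos by (simp add: X_def hyperbola_param_def field_simps)
  have XH: "AE t in m. X t \<in> H" using supp
    by eventually_elim (simp only: H_def mem_Collect_eq sX greaterThanLessThan_iff)
  have YH: "AE t in m. Y t \<notin> H" using supp
  proof eventually_elim
    case (elim t)
    then have "1 \<le> c / t" using c by (simp add: field_simps)
    then show ?case by (simp only: H_def Y_def mem_Collect_eq sX not_less)
  qed
  define \<mu> where "\<mu> A = (if A \<in> sets borel then complex_of_real (measure m {t. X t \<in> A} - measure m {t. Y t \<in> A}) else 0)" for A
  have cm: "complex_borel_measure \<mu>"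
    and four: "\<And>\<xi>. fourier \<mu> \<xi> = (LINT t|m. exp (\<i> * of_real (pi * (X t \<bullet> \<xi>)))) - (LINT t|m. exp (\<i> * of_real (pi * (Y t \<bullet> \<xi>))))"
    using fourier_difference_of_images[OF fin sm X Y H XH YH] unfolding \<mu>_def by blast+
  have null: "measure m {t. Z t \<in> A} = 0"
    if A: "A \<in> sets borel" and Z: "Z \<in> borel_measurable borel" and ae: "AE t in m. Z t \<notin> A"
    for A and Z :: "real \<Rightarrow> real \<times> real"
  proof -
    have "{t. Z t \<in> A} \<in> sets m" using measurable_sets[OF Z A] by (simp add: vimage_def sm)
    moreover have "AE t in m. t \<notin> {t. Z t \<in> A}" using ae by simp
    ultimately show ?thesis using AE_iff_null_sets measure_eq_0_null_sets by blast
  qed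
  have zero: "\<mu> A = 0" if "A \<in> sets borel" "AE t in m. X t \<notin> A" "AE t in m. Y t \<notin> A" for A
    using null[OF that(1) X that(2)] null[OF that(1) Y that(3)] by (simp add: \<mu>_def)
  have Xh: "X t \<in> hyperbola M" if "0 < t" for t
    using that ee pos by (simp add: X_def hyperbola_param_def hyperbola_def)
  have Xe: "0 < e * fst (X t)" if "0 < t" for t
    using that ee pos by (simp add: X_def hyperbola_param_def mult.assoc[symmetric])
  have z1: "\<mu> A = 0" if A: "A \<in> sets borel" and d: "\<And>t. 0 < t \<Longrightarrow> X t \<notin> A" for A
  proof (rule zero[OF A])
    show "AE t in m. X t \<notin> A" using supp by eventually_elim (use d in auto)
    show "AE t in m. Y t \<notin> A" using supp by eventually_elim (use d c in \<open>auto simp: Y_def\<close>)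
  qed
  have "\<mu> A = 0" if A: "A \<in> sets borel" "emeasure (hyperbola_arc_length M) A = 0" for A
  proof (rule zero[OF A(1)])
    define N where "N = {t. t \<noteq> 0 \<and> hyperbola_param M t \<in> A}"
    have Nb: "N \<in> sets borel"
      unfolding N_def by (rule hyperbola_param_vimage_borel[OF A(1)])
    have N0: "emeasure lborel N = 0" using A(2) hyperbola_arc_length_null_iff[OF A(1)] by (simp add: N_def)
    have a: "2 * e / \<alpha> \<noteq> 0" using ee pos by simp
    have S: "{t. 2 * e / \<alpha> * t \<in> N} \<in> sets borel"
      by (rule scale_vimage_borel[OF Nb])
    have S0: "emeasure lborel {t. 2 * e / \<alpha> * t \<in> N} = 0" by (rule null_set_scale[OF a Nb N0])
    have T: "{t. 0 < t \<and> c / t \<in> {t. 2 * e / \<alpha> * t \<in> N}} \<in> sets borel"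
      using gauss_branch_borel[OF S, of c 0] by simp
    have "c \<noteq> 0" using c by simp
    note T0 = null_set_divide[OF this S S0]
    have "AE t in m. t \<notin> {t. 2 * e / \<alpha> * t \<in> N}"
      using ac[OF S S0] S sm by (intro AE_not_in) auto
    then show "AE t in m. X t \<notin> A"
      using supp by eventually_elim (use a in \<open>auto simp: X_def N_def\<close>)
    have "AE t in m. t \<notin> {t. 0 < t \<and> c / t \<in> {t. 2 * e / \<alpha> * t \<in> N}}"
      using ac[OF T T0] T sm by (intro AE_not_in) auto
    then show "AE t in m. Y t \<notin> A"
      using supp
    proof eventually_elim
      case (elim t)
      then have "0 < t" "2 * e / \<alpha> * (c / t) \<notin> N"
        unfolding mem_Collect_eq greaterThanLessThan_iff by blast+
      moreover have "2 * e / \<alpha> * (c / t) \<noteq> 0" using a \<open>c \<noteq> 0\<close> elim by simp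
      ultimately show ?case unfolding X_def Y_def N_def by blast
    qed
  qed
  moreover have "\<mu> A = 0" if "A \<in> sets borel" "A \<inter> hyperbola M = {}" for A
    using that Xh by (intro z1) auto
  moreover have "fourier \<mu> \<xi> = 0" if \<xi>: "\<xi> \<in> lattice_cross \<alpha> \<beta>" for \<xi>
  proof -
    have inner1: "pi * (X t \<bullet> (\<alpha> * of_int n, 0)) = 2 * pi * (e * of_int n) * t" for t and n :: int
      using pos by (simp add: X_def hyperbola_param_def inner_prod_def)
    have inner2: "pi * (X t \<bullet> (0, \<beta> * of_int n)) = 2 * pi * (e * of_int n) * (c / t)" for t and n :: int
    \<comment> \<open>At \<open>t = 0\<close> both sides are 0, because division by 0 yields
      0.\<close>
    proof (cases "t = 0")
      case False
      have "pi * (X t \<bullet> (0, \<beta> * of_int n)) = (e * e) * (pi * (\<beta> * of_int n * M\<^sup>2 * \<alpha> / (8 * pi\<^sup>2 * (e * t))))"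
        using ee pos False by (simp add: X_def hyperbola_param_def inner_prod_def field_simps)
      also have "\<dots> = 2 * pi * (e * of_int n) * (c / t)"
        using ee(2) False by (simp add: c_def field_simps)
      finally show ?thesis .
    qed (simp add: X_def hyperbola_param_def inner_prod_def)
    have ci: "exp (\<i> * of_real r) = cis r" for r by (simp add: cis_conv_exp)
    have "\<exists>k::int. e * of_int n = of_int k" for n :: int
      using e by (auto intro: exI[of _ n] exI[of _ "- n"])
    then obtain k :: "int \<Rightarrow> int" where k: "\<And>n. e * of_int n = of_int (k n)" by metis
    have cc: "c / (c / t) = t" for t using c by simp
    from \<xi> consider n :: int where "\<xi> = (\<alpha> * of_int n, 0)" | n :: int where "\<xi> = (0, \<beta> * of_int n)"
      unfolding lattice_cross_def Ints_def by auto
    then show ?thesis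
    proof cases
      case 1
      show ?thesis unfolding four 1 Y_def inner1 ci k using inv by simp
    next
      case 2
      show ?thesis unfolding four 2 Y_def inner2 ci k cc using inv by simp
    qed
  qed
  ultimately have "\<mu> \<in> AC_hyperbola M (lattice_cross \<alpha> \<beta>)"
    using cm by (simp add: AC_hyperbola_def AC_vanishing_def AC_def)
  moreover have "\<mu> A = 0" if "A \<in> sets borel" "A \<inter> {x. 0 < e * fst x} = {}" for A
    using that Xe by (intro z1) auto
  \<comment> \<open>\<open>H\<close> contains almost all of the positive copy and almost nothing of
    the negative one, so this value is the total mass of \<open>m\<close>.\<close>
  moreover have "\<mu> H \<noteq> 0"
  proof -
    have "measure m {t. Y t \<in> H} = 0" by (rule null[OF H Y YH])
    moreover have "measure m {t. X t \<in> H} = measure m UNIV"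
    proof (rule finite_measure_eq_AE)
      show "AE t in m. t \<in> {t. X t \<in> H} \<longleftrightarrow> t \<in> UNIV" using XH by eventually_elim simp
      show "{t. X t \<in> H} \<in> sets m" using measurable_sets[OF X H] by (simp add: vimage_def sm)
    qed (simp add: sm)
    ultimately show ?thesis using H mpos by (simp add: \<mu>_def)
  qed
  ultimately show ?thesis by (intro bexI[of _ \<mu>]) auto
qed

text \<open>\<open>S\<close> is the branch on which the data are given, so two measures with equal
  data differ by one carried by the other branch, \<open>e * fst x > 0\<close>. In the opposite
  direction, a nonzero measure on that other branch has the same restriction to \<open>S\<close> as
  the zero measure. The sign \<open>e\<close> treats both branches at once.\<close>

lemma branch_uniqueness_iff:
  fixes \<alpha> \<beta> M e :: real
  assumes pos: "0 < \<alpha>" "0 < \<beta>" "0 < M" and e: "e = 1 \<or> e = - 1"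
    and S: "S = {x \<in> hyperbola M. e * fst x < 0}"
  shows "(\<forall>\<mu> \<in> AC_hyperbola M (lattice_cross \<alpha> \<beta>). \<forall>\<nu> \<in> AC_hyperbola M (lattice_cross \<alpha> \<beta>).
      restrict_cmeasure \<mu> S = restrict_cmeasure \<nu> S \<longrightarrow> \<mu> = \<nu>) \<longleftrightarrow> \<alpha> * \<beta> * M\<^sup>2 < 16 * pi\<^sup>2"
proof
  assume uniq: "\<forall>\<mu> \<in> AC_hyperbola M (lattice_cross \<alpha> \<beta>). \<forall>\<nu> \<in> AC_hyperbola M (lattice_cross \<alpha> \<beta>).
      restrict_cmeasure \<mu> S = restrict_cmeasure \<nu> S \<longrightarrow> \<mu> = \<nu>"
  show "\<alpha> * \<beta> * M\<^sup>2 < 16 * pi\<^sup>2"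
  proof (rule ccontr)
    assume "\<not> ?thesis"
    then obtain \<mu> where \<mu>: "\<mu> \<in> AC_hyperbola M (lattice_cross \<alpha> \<beta>)" "\<mu> \<noteq> (\<lambda>A. 0)"
      "\<And>A. A \<in> sets borel \<Longrightarrow> A \<inter> {x. 0 < e * fst x} = {} \<Longrightarrow> \<mu> A = 0"
      using exists_nonzero_measure_on_branch[OF pos _ e] by (auto simp: not_less)
    have "\<mu> (A \<inter> S) = 0" for A
    \<comment> \<open>For a non-Borel intersection the value is 0 by the normalisation of complex
      measures.\<close>
    proof (cases "A \<inter> S \<in> sets borel")
      case True
      then show ?thesis by (rule \<mu>(3)) (auto simp: S)
    next
      case False
      then show ?thesis using \<mu>(1) by (auto simp: AC_hyperbola_def AC_vanishing_def AC_def complex_borel_measure_def)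
    qed
    then have "restrict_cmeasure \<mu> S = restrict_cmeasure (\<lambda>A. 0) S"
      by (simp add: restrict_cmeasure_def fun_eq_iff)
    then show False using uniq \<mu>(1,2) zero_in_AC_hyperbola by blast
  qed
next
  assume small: "\<alpha> * \<beta> * M\<^sup>2 < 16 * pi\<^sup>2"
  show "\<forall>\<mu> \<in> AC_hyperbola M (lattice_cross \<alpha> \<beta>). \<forall>\<nu> \<in> AC_hyperbola M (lattice_cross \<alpha> \<beta>).
      restrict_cmeasure \<mu> S = restrict_cmeasure \<nu> S \<longrightarrow> \<mu> = \<nu>"
  proof (intro ballI impI)
    fix \<mu> \<nu> assume \<mu>: "\<mu> \<in> AC_hyperbola M (lattice_cross \<alpha> \<beta>)" and \<nu>: "\<nu> \<in> AC_hyperbola M (lattice_cross \<alpha> \<beta>)"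
      and eq: "restrict_cmeasure \<mu> S = restrict_cmeasure \<nu> S"
    have "M \<noteq> 0" using pos by simp
    have cm: "complex_borel_measure \<mu>" "complex_borel_measure \<nu>"
      and off: "\<And>A. A \<in> sets borel \<Longrightarrow> A \<inter> hyperbola M = {} \<Longrightarrow> \<mu> A = 0 \<and> \<nu> A = 0"
      and ac: "\<And>A. A \<in> sets borel \<Longrightarrow> emeasure (hyperbola_arc_length M) A = 0 \<Longrightarrow> \<mu> A = 0 \<and> \<nu> A = 0"
      using \<mu> \<nu> by (auto simp: AC_hyperbola_def AC_vanishing_def AC_def)
    have Sb: "S \<in> sets borel"
    proof -
      have "{x::real \<times> real. fst x * snd x = M\<^sup>2 / (4 * pi\<^sup>2)} \<in> sets borel"
        by (intro borel_closed closed_Collect_eq continuous_intros)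
      moreover have "{x::real \<times> real. e * fst x < 0} \<in> sets borel"
        by (intro borel_open open_Collect_less continuous_intros)
      moreover have "S = {x::real \<times> real. fst x * snd x = M\<^sup>2 / (4 * pi\<^sup>2)} \<inter> {x. e * fst x < 0}"
        by (auto simp: S hyperbola_def)
      ultimately show ?thesis by (simp only: sets.Int)
    qed
    have off': "\<mu> A = \<nu> A" if A: "A \<in> sets borel" "A \<inter> {x \<in> hyperbola M. 0 < e * fst x} = {}" for A
    proof -
      have "(A - S) \<inter> hyperbola M = {}"
      proof -
        have "fst x \<noteq> 0" if "x \<in> hyperbola M" for x using that \<open>M \<noteq> 0\<close> by (auto simp: hyperbola_def)
        then have nz: "e * fst x \<noteq> 0" if "x \<in> hyperbola M" for x using that e by auto
        have "x \<notin> A - S" if x: "x \<in> hyperbola M" for x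
          using nz[OF x] x A(2) by (cases "0 < e * fst x") (auto simp: S)
        then show ?thesis by blast
      qed
      then have "\<mu> (A - S) = 0" "\<nu> (A - S) = 0" using off[of "A - S"] A(1) Sb by auto
      moreover have "\<mu> (A \<inter> S) = \<nu> (A \<inter> S)"
        using fun_cong[OF eq, of A] A(1) by (simp add: restrict_cmeasure_def)
      ultimately show ?thesis
        using signed_measure_split[OF signed_measure_Re[OF cm(1)] A(1) Sb] signed_measure_split[OF signed_measure_Im[OF cm(1)] A(1) Sb]
          signed_measure_split[OF signed_measure_Re[OF cm(2)] A(1) Sb] signed_measure_split[OF signed_measure_Im[OF cm(2)] A(1) Sb]
        by (simp add: complex_eq_iff)
    qed
    have diff: "signed_measure (\<lambda>A. f A - g A)" if "signed_measure f" "signed_measure g" for f g :: "(real \<times> real) set \<Rightarrow> real"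
      using that unfolding signed_measure_def by (auto intro: sums_diff)
    note per = AC_hyperbola_coordinate_null[OF \<open>M \<noteq> 0\<close> \<mu> _ e] AC_hyperbola_coordinate_null[OF \<open>M \<noteq> 0\<close> \<nu> _ e]
    have "\<mu> A = \<nu> A" if A: "A \<in> sets borel" for A
    proof -
      have "Re (\<mu> A) - Re (\<nu> A) = 0"
        by (rule signed_measure_on_branch_eq_0[OF pos small e diff[OF signed_measure_Re[OF cm(1)] signed_measure_Re[OF cm(2)]] _ _ _ _ A])
           (simp_all add: off' ac per)
      moreover have "Im (\<mu> A) - Im (\<nu> A) = 0"
        by (rule signed_measure_on_branch_eq_0[OF pos small e diff[OF signed_measure_Im[OF cm(1)] signed_measure_Im[OF cm(2)]] _ _ _ _ A])
           (simp_all add: off' ac per)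
      ultimately show ?thesis by (simp add: complex_eq_iff)
    qed
    moreover have "\<mu> A = \<nu> A" if "A \<notin> sets borel" for A
      using that cm by (simp add: complex_borel_measure_def)
    ultimately show "\<mu> = \<nu>" by blast
  qed
qed

theorem corollary1p6p2:
  fixes \<alpha> \<beta> M :: real
  assumes "\<alpha> > 0" and "\<beta> > 0" and "M > 0"
  shows "((\<forall>\<mu> \<in> AC_hyperbola M (lattice_cross \<alpha> \<beta>). \<forall>\<nu> \<in> AC_hyperbola M (lattice_cross \<alpha> \<beta>).
             restrict_cmeasure \<mu> (hyperbola_neg M) = restrict_cmeasure \<nu> (hyperbola_neg M) \<longrightarrow> \<mu> = \<nu>)
           \<longleftrightarrow> \<alpha> * \<beta> * M\<^sup>2 < 16 * pi\<^sup>2)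
       \<and> ((\<forall>\<mu> \<in> AC_hyperbola M (lattice_cross \<alpha> \<beta>). \<forall>\<nu> \<in> AC_hyperbola M (lattice_cross \<alpha> \<beta>).
             restrict_cmeasure \<mu> (hyperbola_pos M) = restrict_cmeasure \<nu> (hyperbola_pos M) \<longrightarrow> \<mu> = \<nu>)
           \<longleftrightarrow> \<alpha> * \<beta> * M\<^sup>2 < 16 * pi\<^sup>2)"
proof
  have "fst x \<noteq> 0" if "x \<in> hyperbola M" for x
    using that assms(3) by (auto simp: hyperbola_def)
  then have "hyperbola_neg M = {x \<in> hyperbola M. 1 * fst x < 0}"
    by (force simp: hyperbola_neg_def hyperbola_pos_def)
  from branch_uniqueness_iff[OF assms _ this]
  show "(\<forall>\<mu> \<in> AC_hyperbola M (lattice_cross \<alpha> \<beta>). \<forall>\<nu> \<in> AC_hyperbola M (lattice_cross \<alpha> \<beta>).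
      restrict_cmeasure \<mu> (hyperbola_neg M) = restrict_cmeasure \<nu> (hyperbola_neg M) \<longrightarrow> \<mu> = \<nu>)
    \<longleftrightarrow> \<alpha> * \<beta> * M\<^sup>2 < 16 * pi\<^sup>2" by simp
  have "hyperbola_pos M = {x \<in> hyperbola M. - 1 * fst x < 0}"
    by (auto simp: hyperbola_pos_def)
  from branch_uniqueness_iff[OF assms _ this]
  show "(\<forall>\<mu> \<in> AC_hyperbola M (lattice_cross \<alpha> \<beta>). \<forall>\<nu> \<in> AC_hyperbola M (lattice_cross \<alpha> \<beta>).
      restrict_cmeasure \<mu> (hyperbola_pos M) = restrict_cmeasure \<nu> (hyperbola_pos M) \<longrightarrow> \<mu> = \<nu>)
    \<longleftrightarrow> \<alpha> * \<beta> * M\<^sup>2 < 16 * pi\<^sup>2" by simp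
qed

end
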